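(* Let $a\in(-1,0)\cup(0,1)$ and let $C_a$ be the Chebyshev's method of $p_a(z)=(z^2-1)(z^2-a)$. If $U'$ is a multiply connected Fatou component of $C_a$, then there is an integer $m\ge 0$ such that $C_a^{m}(U')$ is a Fatou component surrounding a non-zero pole of $C_a$. Moreover, if $U$ is a periodic Fatou component on which $C_a^{m}(U')$ lands, then $U$ is an attracting domain or a parabolic domain corresponding to a real periodic point. In particular, there is no Herman ring for $C_a$.
   Context: For a polynomial $p$, the Chebyshev's method of $p$ is the rational map $C_p(z)=z-\left[1+\frac12 L_p(z)\right]\frac{p(z)}{p'(z)}$ with $L_p(z)=\frac{p(z)p''(z)}{(p'(z))^2}$, regarded as a self-map of the Riemann sphere $\widehat{\mathbb C}$. For $p_a(z)=(z^2-1)(z^2-a)$ write $C_a:=C_{p_a}$. The poles of $C_a$ (points of $\mathbb C$ mapped to $\infty$) are $0$ and $\pm\sqrt{(a+1)/2}$; the non-zero poles are $\pm\sqrt{(a+1)/2}$. The point $\infty$ is a (repelling) fixed point of $C_a$. The Fatou set $\mathcal F(C_a)$ is the set of points of $\widehat{\mathbb C}$ having a neighbourhood on which $\{C_a^n\}_{n>0}$ is normal; its complement is the Julia set $\mathcal J(C_a)$. A Fatou component is a connected component of $\mathcal F(C_a)$. A Fatou component $U'$ lands on a Fatou component $U$ if $C_a^k(U')=U$ for some $k\ge 0$. A Fatou component surrounds a point if the point lies in a bounded component of its complement. A periodic Fatou component is an attracting domain (an immediate basin of an attracting or superattracting periodic point), a parabolic domain, a Siegel disk or a Herman ring; "corresponding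 to a real periodic point" means that the attracting/parabolic periodic point to which the component is associated is real. *)

theory Defs
  imports "HOL-Analysis.Analysis" "HOL-Computational_Algebra.Polynomial"
begin

section \<open>The Riemann sphere\<close>

datatype rsphere = Fin complex | Infty

primrec finite_part :: "rsphere \<Rightarrow> complex" where
  "finite_part (Fin z) = z"
| "finite_part Infty = 0"

primrec sphere_inverse :: "rsphere \<Rightarrow> rsphere" where
  "sphere_inverse (Fin z) = (if z = 0 then Infty else Fin (inverse z))"
| "sphere_inverse Infty = Fin 0"

text \<open>Inverse stereographic projection onto the unit sphere of \<open>\<complex> \<times> \<real>\<close>. The metric put on
  the Riemann sphere is the chordal one.\<close>

primrec stereo :: "rsphere \<Rightarrow> complex \<times> real" where
  "stereo (Fin z) = ((2 / (1 + (cmod z)\<^sup>2)) *\<^sub>R z, ((cmod z)\<^sup>2 - 1) / ((cmod z)\<^sup>2 + 1))"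
| "stereo Infty = (0, 1)"

lemma stereo_eq_iff: "stereo x = stereo y \<longleftrightarrow> x = y"
proof
  assume eq: "stereo x = stereo y"
  have pos: "1 + r\<^sup>2 \<noteq> 0" "r\<^sup>2 + 1 \<noteq> 0" for r :: real
    by (smt (verit) zero_le_power2)+
  have snd_Fin: "snd (stereo (Fin z)) = 1 - 2 / (1 + (cmod z)\<^sup>2)" for z
    using pos[of "cmod z"] by (simp add: field_simps)
  show "x = y"
  proof (cases x; cases y)
    fix z w assume [simp]: "x = Fin z" "y = Fin w"
    have "2 / (1 + (cmod z)\<^sup>2) = 2 / (1 + (cmod w)\<^sup>2)"
      using arg_cong[OF eq, of snd] unfolding \<open>x = Fin z\<close> \<open>y = Fin w\<close> snd_Fin by simp
    moreover have "(2 / (1 + (cmod z)\<^sup>2)) *\<^sub>R z = (2 / (1 + (cmod w)\<^sup>2)) *\<^sub>R w"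
      using arg_cong[OF eq, of fst] by simp
    ultimately show "x = y"
      using pos[of "cmod w"] by auto
  next
    fix z assume [simp]: "x = Fin z" "y = Infty"
    show "x = y"
      using arg_cong[OF eq, of snd] snd_Fin[of z] pos[of "cmod z"] by simp
  next
    fix w assume [simp]: "x = Infty" "y = Fin w"
    show "x = y"
      using arg_cong[OF eq, of snd] snd_Fin[of w] pos[of "cmod w"] by simp
  qed simp
qed simp

instantiation rsphere :: metric_space
begin

definition dist_rsphere :: "rsphere \<Rightarrow> rsphere \<Rightarrow> real" where
  "dist_rsphere x y = dist (stereo x) (stereo y)"

definition uniformity_rsphere :: "(rsphere \<times> rsphere) filter" where
  "uniformity_rsphere = (INF e\<in>{0<..}. principal {(x, y). dist x y < e})"

definition open_rsphere :: "rsphere set \<Rightarrow> bool" where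
  "open_rsphere U \<longleftrightarrow> (\<forall>x\<in>U. eventually (\<lambda>(x', y). x' = x \<longrightarrow> y \<in> U) uniformity)"

instance
proof
  show "dist x y = 0 \<longleftrightarrow> x = y" for x y :: rsphere
    by (simp add: dist_rsphere_def stereo_eq_iff)
  show "dist x y \<le> dist x z + dist y z" for x y z :: rsphere
    by (simp add: dist_rsphere_def dist_triangle2)
qed (rule uniformity_rsphere_def open_rsphere_def)+

end


section \<open>Chebyshev's method\<close>

definition chebyshev_L :: "complex poly \<Rightarrow> complex \<Rightarrow> complex" where
  "chebyshev_L p z = poly p z * poly (pderiv (pderiv p)) z / (poly (pderiv p) z)\<^sup>2"

text \<open>The formula is meaningful where \<open>p'\<close> does not vanish. The limit is taken over punctured
  neighbourhoods, and so extends the formula continuously to the zeros of \<open>p'\<close> and to \<open>\<infinity>\<close>;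
  the convention \<open>x / 0 = 0\<close> plays no role for non-constant \<open>p\<close>.\<close>

definition chebyshev_method :: "complex poly \<Rightarrow> rsphere \<Rightarrow> rsphere" where
  "chebyshev_method p x = Lim (at x) (\<lambda>y. let z = finite_part y in
     Fin (z - (1 + chebyshev_L p z / 2) * (poly p z / poly (pderiv p) z)))"

definition quartic :: "real \<Rightarrow> complex poly" where
  "quartic a = [:-1, 0, 1:] * [:- of_real a, 0, 1:]"

definition cheb_quartic :: "real \<Rightarrow> rsphere \<Rightarrow> rsphere" where
  "cheb_quartic a = chebyshev_method (quartic a)"


section \<open>Fatou components\<close>

definition normal_on :: "rsphere set \<Rightarrow> (rsphere \<Rightarrow> rsphere) set \<Rightarrow> bool" where
  "normal_on U \<F> \<longleftrightarrow> (\<forall>g :: nat \<Rightarrow> rsphere \<Rightarrow> rsphere. range g \<subseteq> \<F> \<longrightarrow>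
     (\<exists>r h. strict_mono (r :: nat \<Rightarrow> nat) \<and>
        (\<forall>K. compact K \<and> K \<subseteq> U \<longrightarrow> uniform_limit K (\<lambda>n. g (r n)) h sequentially)))"

definition Fatou_set :: "(rsphere \<Rightarrow> rsphere) \<Rightarrow> rsphere set" where
  "Fatou_set f = {x. \<exists>U. open U \<and> x \<in> U \<and> normal_on U {f ^^ n |n. n > 0}}"

definition Fatou_component :: "(rsphere \<Rightarrow> rsphere) \<Rightarrow> rsphere set \<Rightarrow> bool" where
  "Fatou_component f U \<longleftrightarrow> U \<in> components (Fatou_set f)"

definition periodic_Fatou_component :: "(rsphere \<Rightarrow> rsphere) \<Rightarrow> rsphere set \<Rightarrow> bool" where
  "periodic_Fatou_component f U \<longleftrightarrow> Fatou_component f U \<and> (\<exists>p>0. (f ^^ p) ` U = U)"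

definition lands_on :: "(rsphere \<Rightarrow> rsphere) \<Rightarrow> rsphere set \<Rightarrow> rsphere set \<Rightarrow> bool" where
  "lands_on f V U \<longleftrightarrow> (\<exists>k. (f ^^ k) ` V = U)"

definition multiply_connected :: "rsphere set \<Rightarrow> bool" where
  "multiply_connected U \<longleftrightarrow> \<not> simply_connected U"

text \<open>The set \<open>Fin ` B\<close> is a component of the complement that is a bounded subset of the plane.\<close>

definition surrounds :: "rsphere set \<Rightarrow> complex \<Rightarrow> bool" where
  "surrounds U z \<longleftrightarrow> (\<exists>B. Fin ` B \<in> components (- U) \<and> bounded B \<and> z \<in> B)"


section \<open>Types of periodic Fatou components\<close>

text \<open>Multiplier of \<open>g\<close> at a fixed point; at \<open>\<infinity>\<close> it is computed in the coordinate \<open>1/z\<close>.\<close>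

definition multiplier :: "(rsphere \<Rightarrow> rsphere) \<Rightarrow> rsphere \<Rightarrow> complex" where
  "multiplier g x = (case x of
     Fin z \<Rightarrow> deriv (\<lambda>w. finite_part (g (Fin w))) z
   | Infty \<Rightarrow> deriv (\<lambda>w. finite_part (sphere_inverse (g (sphere_inverse (Fin w))))) 0)"

text \<open>\<open>U\<close> is the immediate basin of the attracting or superattracting periodic point \<open>x\<close>, that is
  the component containing \<open>x\<close> of the basin of \<open>x\<close> under \<open>f ^^ p\<close>. Here and below \<open>p\<close> need not be
  the least period; the notions do not depend on this choice.\<close>

definition attracting_domain :: "(rsphere \<Rightarrow> rsphere) \<Rightarrow> rsphere set \<Rightarrow> rsphere \<Rightarrow> bool" where
  "attracting_domain f U x \<longleftrightarrow> periodic_Fatou_component f U \<and>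
     (\<exists>p>0. (f ^^ p) x = x \<and> cmod (multiplier (f ^^ p) x) < 1 \<and>
        U = connected_component_set {y. (\<lambda>k. (f ^^ (k * p)) y) \<longlonglongrightarrow> x} x)"

definition parabolic_domain :: "(rsphere \<Rightarrow> rsphere) \<Rightarrow> rsphere set \<Rightarrow> rsphere \<Rightarrow> bool" where
  "parabolic_domain f U x \<longleftrightarrow> Fatou_component f U \<and> x \<in> frontier U \<and>
     (\<exists>p>0. (f ^^ p) ` U = U \<and> (f ^^ p) x = x \<and>
        (\<exists>q>0. multiplier (f ^^ p) x ^ q = 1) \<and>
        (\<forall>y\<in>U. (\<lambda>k. (f ^^ (k * p)) y) \<longlonglongrightarrow> x))"

definition sphere_analytic_on :: "(complex \<Rightarrow> rsphere) \<Rightarrow> complex set \<Rightarrow> bool" where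
  "sphere_analytic_on \<phi> A \<longleftrightarrow> continuous_on A \<phi> \<and>
     (\<forall>z\<in>A. if \<phi> z = Infty then (\<lambda>w. finite_part (sphere_inverse (\<phi> w))) analytic_on {z}
            else (\<lambda>w. finite_part (\<phi> w)) analytic_on {z})"

text \<open>Some iterate of \<open>f\<close> on \<open>U\<close> is conformally conjugate to an irrational rotation of a round
  annulus.\<close>

definition Herman_ring :: "(rsphere \<Rightarrow> rsphere) \<Rightarrow> rsphere set \<Rightarrow> bool" where
  "Herman_ring f U \<longleftrightarrow> Fatou_component f U \<and>
     (\<exists>p>0. (f ^^ p) ` U = U \<and>
       (\<exists>R>1. \<exists>\<theta> :: real. \<exists>\<phi>. \<theta> \<notin> \<rat> \<and>
          sphere_analytic_on \<phi> {z. 1 < cmod z \<and> cmod z < R} \<and>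
          bij_betw \<phi> {z. 1 < cmod z \<and> cmod z < R} U \<and>
          (\<forall>z. 1 < cmod z \<and> cmod z < R \<longrightarrow> (f ^^ p) (\<phi> z) = \<phi> (cis (2 * pi * \<theta>) * z))))"

end

theory Submission
  imports Defs "HOL-Complex_Analysis.Complex_Analysis"
begin

text \<open>All poles of \<open>C\<^sub>a\<close> are real and \<open>\<infinity>\<close> is a repelling fixed point, so the Julia set is the closure of the
  backward orbit of \<open>\<infinity>\<close>: by Montel's theorem for omitted values, the iterates are normal wherever they
  avoid the poles. A loop around a hole of a multiply connected component therefore encloses a
  preimage of \<open>\<infinity>\<close>, and the first image of its interior that contains a pole shows that some image of the
  component surrounds a pole; in particular this image meets the real line.

  On a component meeting the real line all limits of iterates are constant: a non-constant limit
  would produce an injective iterate mapping a real interval into itself with all points recurrent,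
  so its square would be the identity there, and hence everywhere. If the surrounded pole were \<open>0\<close>,
  the component would also meet the (invariant) imaginary axis, and all limits would lie in
  \<open>{0, \<infinity>}\<close>, which is impossible since \<open>0\<close> is mapped to the repelling point \<open>\<infinity>\<close>. On a periodic component
  meeting the real line the constant limit is a real fixed point of an iterate whose multiplier
  is real: the point is attracting if it lies in the component, and otherwise its multiplier is
  \<open>\<plusminus>1\<close>. Constant limits also exclude rotations, hence Herman rings.\<close>

section \<open>The chordal metric\<close>

text \<open>Infinity is a Julia point, so the Fatou set is an open set \<open>G\<close> of the plane
  on which iterating \<open>f\<close> means iterating the holomorphic function \<open>c\<close>; a
  normal sequence converges there locally uniformly to a holomorphic function or to infinity. The
  values omitted in Montel's theorem are two of the poles. At infinity \<open>c z / z\<close> tends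
  to 84/128, hence the multiplier 32/21 in the coordinate \<open>1/z\<close>.

  A non-constant limit leads to a component with the identity as a limit, because by Hurwitz its
  values are attained by iterates and are thus Fatou points. A constant limit on a periodic
  component is fixed by the return map; fixed points are isolated, which upgrades subsequences to
  convergence of all orbits. A limit inside the component is attracting by Cauchy's estimate. A
  limit on the boundary is not attracting, as attracting points are Fatou points, and not repelling,
  as orbits tend to it; modulus 1 remains, which for a real multiplier means a root of unity. The
  real line is invariant, so whatever the surrounding component lands on meets it too.\<close>

lemma dist_Fin: "dist (Fin z) (Fin w) = 2 * cmod (z - w) / (sqrt (1 + (cmod z)\<^sup>2) * sqrt (1 + (cmod w)\<^sup>2))"
proof -
  define A B where "A = 1 + (cmod z)\<^sup>2" and "B = 1 + (cmod w)\<^sup>2"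
  have AB: "A > 0" "B > 0"
    by (auto simp: A_def B_def add_pos_nonneg)
  have zz: "z \<bullet> z = A - 1" "w \<bullet> w = B - 1"
    by (simp_all add: A_def B_def power2_norm_eq_inner)
  have "(dist (Fin z) (Fin w))\<^sup>2 = (norm ((2/A) *\<^sub>R z - (2/B) *\<^sub>R w))\<^sup>2 + ((A - 2) / A - (B - 2) / B)\<^sup>2"
    by (simp add: dist_rsphere_def dist_norm norm_Pair A_def B_def add.commute)
  also have "\<dots> = ((2/A)\<^sup>2 * (A - 1) - 2 * (2/A) * (2/B) * (z \<bullet> w) + (2/B)\<^sup>2 * (B - 1)) + (2/B - 2/A)\<^sup>2"
    proof -
    have "(norm (s *\<^sub>R z - t *\<^sub>R w))\<^sup>2 = s\<^sup>2 * (A - 1) - 2 * s * t * (z \<bullet> w) + t\<^sup>2 * (B - 1)" for s t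
      unfolding power2_norm_eq_inner
      by (simp only: inner_diff_left inner_diff_right inner_scaleR_left inner_scaleR_right zz inner_commute[of w z])
        (simp add: algebra_simps power2_eq_square)
    moreover have "(A - 2) / A - (B - 2) / B = 2/B - 2/A"
      using AB by (simp add: field_simps)
    ultimately show ?thesis
      by simp
  qed
  also have "\<dots> = 4 * (A - 1 - 2 * (z \<bullet> w) + (B - 1)) / (A * B)"
    using AB by (simp add: field_simps power2_eq_square)
  also have "A - 1 - 2 * (z \<bullet> w) + (B - 1) = (cmod (z - w))\<^sup>2"
    by (simp only: power2_norm_eq_inner inner_diff_left inner_diff_right zz inner_commute[of w z])
  finally have *: "(dist (Fin z) (Fin w))\<^sup>2 = (2 * cmod (z - w))\<^sup>2 / (A * B)"
    by (simp add: power_mult_distrib)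
  then have "dist (Fin z) (Fin w) = sqrt ((2 * cmod (z - w))\<^sup>2 / (A * B))"
    by (metis real_sqrt_unique zero_le_dist)
  then show ?thesis
    by (simp add: real_sqrt_divide real_sqrt_mult A_def B_def)
qed

lemma dist_Fin_le: "dist (Fin z) (Fin w) \<le> 2 * dist z w"
proof -
  have "1 \<le> sqrt (1 + (cmod z)\<^sup>2) * sqrt (1 + (cmod w)\<^sup>2)"
    using mult_mono[of 1 "sqrt (1 + (cmod z)\<^sup>2)" 1 "sqrt (1 + (cmod w)\<^sup>2)"] by simp
  then show ?thesis
    unfolding dist_Fin dist_norm
    by (smt (verit) divide_le_eq_1 frac_le norm_ge_zero div_by_1)
qed

lemma sphere_inverse_inverse [simp]: "sphere_inverse (sphere_inverse x) = x"
  by (cases x) auto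

lemma sphere_inverse_eq_iff [simp]: "sphere_inverse x = sphere_inverse y \<longleftrightarrow> x = y"
  by (metis sphere_inverse_inverse)

text \<open>On the unit sphere, inversion is the rotation by the angle pi about the real axis. This
  makes it an isometry of the chordal metric, so that facts near 0 carry over to infinity.\<close>

lemma stereo_sphere_inverse:
  "stereo (sphere_inverse x) = (cnj (fst (stereo x)), - snd (stereo x))"
proof (cases x)
  case (Fin z)
  show ?thesis
  proof (cases "z = 0")
    case False
    have *: "1 + (cmod z)\<^sup>2 \<noteq> 0"
      by (smt (verit) zero_le_power2)
    have inv: "inverse z = (1 / (cmod z)\<^sup>2) *\<^sub>R cnj z"
      using complex_div_cnj[of 1 z] by (simp add: inverse_eq_divide scaleR_conv_of_real)
    have "2 / (1 + (cmod (inverse z))\<^sup>2) * (1 / (cmod z)\<^sup>2) = 2 / (1 + (cmod z)\<^sup>2)"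
      using False * unfolding norm_inverse power_inverse
      by (simp add: field_simps)
    then have 1: "(2 / (1 + (cmod (inverse z))\<^sup>2)) *\<^sub>R inverse z = (2 / (1 + (cmod z)\<^sup>2)) *\<^sub>R cnj z"
      by (metis inv scaleR_scaleR)
    have 2: "((cmod (inverse z))\<^sup>2 - 1) / ((cmod (inverse z))\<^sup>2 + 1) = - (((cmod z)\<^sup>2 - 1) / ((cmod z)\<^sup>2 + 1))"
    proof -
      have "(inverse s - 1) / (inverse s + 1) = - ((s - 1) / (s + 1))" if "s > 0" for s :: real
        using that by (simp add: divide_simps)
      from this[of "(cmod z)\<^sup>2"] show ?thesis
        using False unfolding norm_inverse power_inverse by simp
    qed
    show ?thesis
      using False 1 2 by (simp add: Fin)
  qed (simp add: Fin)
qed simp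

lemma dist_sphere_inverse [simp]: "dist (sphere_inverse x) (sphere_inverse y) = dist x y"
proof -
  have "dist (cnj u) (cnj v) = dist u v" for u v
    by (metis complex_cnj_diff complex_mod_cnj dist_norm)
  moreover have "dist (- a) (- b) = dist a b" for a b :: real
    by (simp add: dist_norm)
  ultimately show ?thesis
    by (simp add: dist_rsphere_def stereo_sphere_inverse dist_Pair_Pair)
      (metis dist_Pair_Pair prod.collapse)
qed

lemma dist_Infty: "dist (Fin z) Infty = 2 / sqrt (1 + (cmod z)\<^sup>2)"
proof (cases "z = 0")
  case True
  then show ?thesis by (simp add: dist_rsphere_def dist_Pair_Pair dist_norm)
next
  case False
  have "dist (Fin z) Infty = dist (Fin (inverse z)) (Fin 0)"
    using dist_sphere_inverse[of "Fin z" Infty] False by simp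
  also have "\<dots> = 2 * inverse (cmod z) / sqrt (1 + (inverse (cmod z))\<^sup>2)"
    by (simp add: dist_Fin norm_inverse)
  also have "\<dots> = 2 / (cmod z * sqrt (1 + (inverse (cmod z))\<^sup>2))"
    by (simp add: divide_simps)
  also have "cmod z * sqrt (1 + (inverse (cmod z))\<^sup>2) = sqrt ((cmod z)\<^sup>2 * (1 + (inverse (cmod z))\<^sup>2))"
    by (simp add: real_sqrt_mult)
  also have "(cmod z)\<^sup>2 * (1 + (inverse (cmod z))\<^sup>2) = 1 + (cmod z)\<^sup>2"
    using False by (simp add: field_simps)
  finally show ?thesis .
qed

lemma continuous_on_stereo: "continuous_on UNIV stereo"
  by (auto simp: continuous_on_iff dist_rsphere_def)

lemma continuous_on_Fin [continuous_intros]: "continuous_on S f \<Longrightarrow> continuous_on S (\<lambda>x. Fin (f x))"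
proof -
  have "continuous_on UNIV Fin"
    by (rule lipschitz_on_continuous_on[of 2]) (auto intro!: lipschitz_onI dist_Fin_le)
  then show "continuous_on S f \<Longrightarrow> continuous_on S (\<lambda>x. Fin (f x))"
    using continuous_on_compose2 by blast
qed

lemma tendsto_Fin [tendsto_intros]: "(f \<longlongrightarrow> l) F \<Longrightarrow> ((\<lambda>x. Fin (f x)) \<longlongrightarrow> Fin l) F"
  using continuous_on_tendsto_compose[of UNIV Fin f l F] continuous_on_Fin[OF continuous_on_id, of UNIV] by auto

lemma continuous_on_sphere_inverse: "continuous_on S sphere_inverse"
  by (auto simp: continuous_on_iff)

text \<open>Projection from the north pole, written out so that continuity of
  \<open>finite_part\<close> off \<open>Infty\<close> can be read from it.\<close>

lemma finite_part_stereo: "finite_part x = (1 / (1 - snd (stereo x))) *\<^sub>R fst (stereo x)"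
proof (cases x)
  case (Fin z)
  have *: "1 + (cmod z)\<^sup>2 \<noteq> 0"
    by (smt (verit) zero_le_power2)
  then have "1 - snd (stereo x) = 2 / (1 + (cmod z)\<^sup>2)"
    by (simp add: Fin field_simps)
  then have "1 / (1 - snd (stereo x)) * (2 / (1 + (cmod z)\<^sup>2)) = 1"
    using * by simp
  then show ?thesis
    by (metis Fin finite_part.simps(1) fst_conv scaleR_one scaleR_scaleR stereo.simps(1))
qed simp

lemma snd_stereo_eq_1_iff: "snd (stereo x) = 1 \<longleftrightarrow> x = Infty"
proof (cases x)
  case (Fin z)
  have "((cmod z)\<^sup>2 - 1) / ((cmod z)\<^sup>2 + 1) \<noteq> 1"
    by (metis diff_add_cancel add_cancel_left_right diff_minus_eq_add divide_eq_1_iff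
        minus_diff_eq one_neq_neg_one add_right_cancel uminus_add_conv_diff)
  with Fin show ?thesis
    by simp
qed simp

lemma continuous_on_finite_part: "continuous_on (- {Infty}) finite_part"
proof -
  have "continuous_on (- {Infty}) (\<lambda>x. (1 / (1 - snd (stereo x))) *\<^sub>R fst (stereo x))"
    using snd_stereo_eq_1_iff
    by (intro continuous_intros continuous_on_subset[OF continuous_on_stereo]) force+
  then show ?thesis
    by (simp add: finite_part_stereo[abs_def])
qed

lemma open_Fin_image:
  assumes "open S" shows "open (Fin ` S)"
proof -
  have "Fin ` S = finite_part -` S \<inter> - {Infty}"
    by (auto simp: image_iff) (metis finite_part.simps(1) rsphere.exhaust)
  moreover have "open \<dots>"
    by (rule continuous_open_preimage[OF continuous_on_finite_part, simplified Int_commute]) (use assms in auto)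
  ultimately show ?thesis
    by simp
qed

lemma tendsto_finite_part:
  assumes "(f \<longlongrightarrow> Fin z) F" shows "((\<lambda>x. finite_part (f x)) \<longlongrightarrow> z) F"
proof -
  have "isCont finite_part (Fin z)"
    using continuous_on_finite_part by (subst (asm) continuous_on_eq_continuous_at) auto
  from isCont_tendsto_compose[OF this assms] show ?thesis
    by simp
qed

lemma tendsto_Fin_iff: "((\<lambda>x. Fin (f x)) \<longlongrightarrow> Fin l) F \<longleftrightarrow> (f \<longlongrightarrow> l) F"
  using tendsto_Fin tendsto_finite_part by fastforce

lemma dist_Infty_less_iff:
  assumes "0 < R" shows "dist (Fin z) Infty < 2 / sqrt (1 + R\<^sup>2) \<longleftrightarrow> R < cmod z"
proof -
  have "sqrt (1 + R\<^sup>2) > 0" "sqrt (1 + (cmod z)\<^sup>2) > 0"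
    by (simp_all add: add_pos_nonneg)
  then have "dist (Fin z) Infty < 2 / sqrt (1 + R\<^sup>2) \<longleftrightarrow> sqrt (1 + R\<^sup>2) < sqrt (1 + (cmod z)\<^sup>2)"
    unfolding dist_Infty by (auto simp: field_simps)
  also have "\<dots> \<longleftrightarrow> R < cmod z"
    using assms by (simp add: abs_less_iff power_mono_iff flip: abs_le_square_iff not_le)
  finally show ?thesis .
qed

lemma eventually_dist_Infty:
  assumes "0 < e" obtains R where "R > 0" "\<And>z. R < cmod z \<Longrightarrow> dist (Fin z) Infty < e"
proof
  show "2 / e > 0" using assms by simp
  fix z assume z: "2 / e < cmod z"
  have "cmod z < sqrt (1 + (cmod z)\<^sup>2)"
    by (simp add: real_less_rsqrt)
  then have "2 / e < sqrt (1 + (cmod z)\<^sup>2)"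
    using z by linarith
  then show "dist (Fin z) Infty < e"
    unfolding dist_Infty using assms by (simp add: field_simps add_pos_nonneg)
qed

lemma tendsto_Infty_iff: "((\<lambda>x. Fin (f x)) \<longlongrightarrow> Infty) F \<longleftrightarrow> filterlim f at_infinity F"
proof
  assume L: "((\<lambda>x. Fin (f x)) \<longlongrightarrow> Infty) F"
  show "filterlim f at_infinity F"
    unfolding filterlim_at_infinity[OF order_refl]
  proof (intro allI impI)
    fix R :: real assume R: "R > 0"
    have "\<forall>\<^sub>F x in F. dist (Fin (f x)) Infty < 2 / sqrt (1 + R\<^sup>2)"
      using R by (intro tendstoD[OF L]) (simp add: add_pos_nonneg)
    then show "\<forall>\<^sub>F x in F. R \<le> cmod (f x)"
      by eventually_elim (use dist_Infty_less_iff R in auto)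
  qed
next
  assume L: "filterlim f at_infinity F"
  show "((\<lambda>x. Fin (f x)) \<longlongrightarrow> Infty) F"
  proof (rule tendstoI)
    fix e :: real assume "e > 0"
    then obtain R where R: "R > 0" "\<And>z. R < cmod z \<Longrightarrow> dist (Fin z) Infty < e"
      using eventually_dist_Infty by blast
    have "\<forall>\<^sub>F x in F. R + 1 \<le> cmod (f x)"
      using L R(1) unfolding filterlim_at_infinity[OF order_refl] by (meson add_pos_pos zero_less_one)
    then show "\<forall>\<^sub>F x in F. dist (Fin (f x)) Infty < e"
      by eventually_elim (use R in auto)
  qed
qed

text \<open>The closed unit disk and its image under inversion cover the sphere.\<close>

lemma compact_rsphere: "compact (UNIV :: rsphere set)"
proof -
  have "UNIV = Fin ` cball 0 1 \<union> sphere_inverse ` Fin ` cball 0 1"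
  proof -
    have "x \<in> Fin ` cball 0 1 \<union> sphere_inverse ` Fin ` cball 0 1" for x
    proof (cases x)
      case (Fin z)
      show ?thesis
      proof (cases "cmod z \<le> 1")
        case False
        then have "cmod (inverse z) \<le> 1" "z \<noteq> 0" by (auto simp: norm_inverse inverse_le_1_iff)
        then have "x = sphere_inverse (Fin (inverse z))" "inverse z \<in> cball 0 1"
          by (auto simp: Fin)
        then show ?thesis by blast
      qed (auto simp: Fin)
    next
      case Infty
      then have "x = sphere_inverse (Fin 0)" by simp
      then show ?thesis by (intro UnI2) (metis centre_in_cball image_eqI zero_le_one)
    qed
    then show ?thesis by auto
  qed
  moreover have "compact (Fin ` cball 0 1)"
    by (intro compact_continuous_image continuous_intros compact_cball)
  ultimately show ?thesis
    by (metis compact_Un compact_continuous_image continuous_on_sphere_inverse)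
qed

section \<open>The plane inside the sphere: components and charts\<close>

lemma homeomorphism_Fin: "homeomorphism S (Fin ` S) Fin finite_part"
proof -
  have "continuous_on (Fin ` S) finite_part"
    by (rule continuous_on_subset[OF continuous_on_finite_part]) auto
  then show ?thesis
    by (auto simp: homeomorphism_def image_image intro!: continuous_intros)
qed

lemma connected_Fin_image_iff: "connected (Fin ` S) \<longleftrightarrow> connected S"
  using homeomorphism_Fin homeomorphic_connectedness homeomorphic_def by blast

lemma components_Fin_image: "U \<in> components (Fin ` S) \<longleftrightarrow> (\<exists>W\<in>components S. U = Fin ` W)"
proof -
  have *: "Fin ` W \<in> components (Fin ` S)" if "W \<in> components S" for W
    unfolding in_components_maximal
  proof (intro conjI allI impI)
    show "Fin ` W \<noteq> {}" "Fin ` W \<subseteq> Fin ` S" "connected (Fin ` W)"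
      using that by (auto simp: connected_Fin_image_iff in_components_maximal)
    fix D assume D: "D \<noteq> {} \<and> Fin ` W \<subseteq> D \<and> D \<subseteq> Fin ` S \<and> connected D"
    then obtain D' where D': "D = Fin ` D'" "D' \<subseteq> S"
      by (meson subset_image_iff)
    then have "D' \<noteq> {}" "W \<subseteq> D'" "connected D'"
      using D connected_Fin_image_iff by auto
    then show "D = Fin ` W"
      using that D' unfolding in_components_maximal by metis
  qed
  show ?thesis
  proof
    assume U: "U \<in> components (Fin ` S)"
    then obtain z where z: "z \<in> S" "Fin z \<in> U"
      by (metis in_components_nonempty in_components_subset ex_in_conv imageE subsetD)
    have "Fin ` connected_component_set S z \<in> components (Fin ` S)"
      using z by (intro * componentsI) auto
    moreover have "Fin z \<in> Fin ` connected_component_set S z"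
      using z by (simp add: )
    ultimately show "\<exists>W\<in>components S. U = Fin ` W"
      using U z by (metis IntI components_nonoverlap componentsI empty_iff)
  qed (use * in auto)
qed

text \<open>The standard atlas, given by parametrizations from the plane: the first misses infinity,
  the second misses 0.\<close>

abbreviation charts :: "(complex \<Rightarrow> rsphere) set" where
  "charts \<equiv> {Fin, sphere_inverse \<circ> Fin}"

lemma open_sphere_inverse_image:
  assumes "open S" shows "open (sphere_inverse ` S)"
proof -
  have "sphere_inverse ` S = sphere_inverse -` S"
    by (rule set_eqI) (metis image_iff sphere_inverse_inverse vimageE vimageI)
  then show ?thesis
    using assms continuous_on_sphere_inverse[of UNIV] by (simp add: open_vimage)
qed

lemma open_chart_image: "\<phi> \<in> charts \<Longrightarrow> open S \<Longrightarrow> open (\<phi> ` S)"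
  by (auto simp only: insert_iff empty_iff image_comp[symmetric] intro!: open_Fin_image open_sphere_inverse_image)

lemma continuous_chart: "\<phi> \<in> charts \<Longrightarrow> continuous_on S \<phi>"
  by (auto simp only: insert_iff empty_iff intro!: continuous_on_compose continuous_on_Fin[OF continuous_on_id, simplified id_def] continuous_on_sphere_inverse)

lemma inj_chart: "\<phi> \<in> charts \<Longrightarrow> inj \<phi>"
  by (auto simp only: insert_iff empty_iff inj_on_def o_apply sphere_inverse_eq_iff rsphere.inject)

section \<open>Rational maps with a repelling fixed point at infinity\<close>

text \<open>The map is \<open>N / D\<close> in lowest terms. The degrees make infinity a fixed
  point; its multiplier in the coordinate \<open>1/z\<close> is
  \<open>lead_coeff D / lead_coeff N\<close>, so the coefficient condition says that it is
  repelling. The two distinct poles are the omitted values for Montel's theorem.\<close>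

locale rational_repelling_infinity =
  fixes N D :: "complex poly"
  assumes no_common_zero: "poly D z = 0 \<Longrightarrow> poly N z \<noteq> 0"
    and degree_N: "degree N = Suc (degree D)"
    and lead_coeff_less: "cmod (lead_coeff N) < cmod (lead_coeff D)"
    and two_poles: "\<exists>p q. p \<noteq> q \<and> poly D p = 0 \<and> poly D q = 0"
begin

definition c :: "complex \<Rightarrow> complex" where
  "c z = poly N z / poly D z"

definition f :: "rsphere \<Rightarrow> rsphere" where
  "f x = (case x of Fin z \<Rightarrow> if poly D z = 0 then Infty else Fin (c z) | Infty \<Rightarrow> Infty)"

lemma f_simps [simp]:
  "f Infty = Infty"
  "poly D z = 0 \<Longrightarrow> f (Fin z) = Infty"
  "poly D z \<noteq> 0 \<Longrightarrow> f (Fin z) = Fin (c z)"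
  by (simp_all add: f_def)

lemma N_nonzero [simp]: "N \<noteq> 0" and D_nonzero [simp]: "D \<noteq> 0"
  using degree_N lead_coeff_less by auto

text \<open>Over a finite value \<open>w\<close> the fibre consists of zeros of
  \<open>N - smult w D\<close>, which is non-zero because \<open>N\<close> has the larger
  degree.\<close>

lemma finite_fibre: "finite (f -` {y})"
proof (cases y)
  case (Fin w)
  have "N \<noteq> smult w D"
    using degree_N degree_smult_le[of w D] by auto
  then have "finite (Fin ` {z. poly (N - smult w D) z = 0})"
    by (intro finite_imageI poly_roots_finite) simp
  moreover have "f -` {y} \<subseteq> Fin ` {z. poly (N - smult w D) z = 0}"
  proof
    fix x assume x: "x \<in> f -` {y}"
    then obtain z where z: "x = Fin z"
      using Fin by (cases x) auto
    then have "poly D z \<noteq> 0" "c z = w"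
      using x Fin by (auto simp: f_def split: if_splits)
    then show "x \<in> Fin ` {z. poly (N - smult w D) z = 0}"
      by (auto simp: z c_def field_simps)
  qed
  ultimately show ?thesis
    by (rule finite_subset[rotated])
next
  case Infty
  have "finite (insert Infty (Fin ` {z. poly D z = 0}))"
    by (intro finite.insertI finite_imageI poly_roots_finite) simp
  moreover have "f -` {y} \<subseteq> insert Infty (Fin ` {z. poly D z = 0})"
    using Infty by (auto simp: f_def split: rsphere.splits if_splits)
  ultimately show ?thesis
    by (rule finite_subset[rotated])
qed

text \<open>At a regular point \<open>c\<close> itself is the local expression. At a pole the target
  is inverted, and \<open>D / N\<close> is holomorphic since there is no common zero. At infinity
  both sides are inverted.\<close>

lemma chart:
  obtains \<phi> \<psi> g \<zeta> r where "\<phi> \<in> charts" "\<psi> \<in> charts"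
    "r > 0" "g holomorphic_on ball \<zeta> r" "\<phi> \<zeta> = x" "\<And>z. z \<in> ball \<zeta> r \<Longrightarrow> f (\<phi> z) = \<psi> (g z)"
proof -
  let ?thesis' = "\<exists>\<phi> \<psi> g \<zeta> r. \<phi> \<in> charts \<and> \<psi> \<in> charts \<and>
     r > 0 \<and> g holomorphic_on ball \<zeta> r \<and> \<phi> \<zeta> = x \<and> (\<forall>z\<in>ball \<zeta> r. f (\<phi> z) = \<psi> (g z))"
  have nz: "\<exists>r>0. \<forall>z\<in>ball \<zeta> r. poly p z \<noteq> 0" if "poly p \<zeta> \<noteq> 0" for p :: "complex poly" and \<zeta>
  proof -
    have "open {z. poly p z \<noteq> 0}"
      by (intro open_Collect_neq continuous_intros)
    then show ?thesis
      using that unfolding open_contains_ball by blast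
  qed
  have ?thesis'
  proof (cases x)
    case (Fin \<zeta>)
    show ?thesis'
    proof (cases "poly D \<zeta> = 0")
      case False
      then obtain r where r: "r > 0" "\<forall>z\<in>ball \<zeta> r. poly D z \<noteq> 0" using nz by blast
      then show ?thesis' unfolding Fin
        by (intro exI[of _ Fin] exI[of _ Fin] exI[of _ c] exI[of _ \<zeta>] exI[of _ r])
          (auto simp: c_def[abs_def] intro!: holomorphic_intros)
    next
      case True
      then obtain r where r: "r > 0" "\<forall>z\<in>ball \<zeta> r. poly N z \<noteq> 0"
        using nz no_common_zero by blast
      have "f (Fin z) = sphere_inverse (Fin (poly D z / poly N z))" if "z \<in> ball \<zeta> r" for z
        using r that by (auto simp: f_def c_def)
      then show ?thesis' unfolding Fin
        using r by (intro exI[of _ Fin] exI[of _ "sphere_inverse \<circ> Fin"] exI[of _ "\<lambda>z. poly D z / poly N z"] exI[of _ \<zeta>] exI[of _ r])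
          (auto intro!: holomorphic_intros)
    qed
  next
    case Infty
    have "poly (reflect_poly N) 0 \<noteq> 0" by simp
    then obtain r where r: "r > 0" "\<forall>z\<in>ball 0 r. poly (reflect_poly N) z \<noteq> 0" using nz by blast
    \<comment> \<open>The reciprocal of \<open>c (1/z)\<close> in terms of reflected polynomials;
      the factor \<open>z\<close> accounts for the degrees differing by one.\<close>
    define g where "g = (\<lambda>z. z * poly (reflect_poly D) z / poly (reflect_poly N) z)"
    have "f (sphere_inverse (Fin z)) = sphere_inverse (Fin (g z))" if z: "z \<in> ball 0 r" for z
    proof (cases "z = 0")
      case False
      have "g z = poly D (inverse z) / poly N (inverse z)" "poly N (inverse z) \<noteq> 0"
        using r(2)[rule_format, OF z] False by (auto simp: g_def poly_reflect_poly_nz degree_N)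
      then show ?thesis
        using False by (auto simp: f_def c_def)
    qed (simp add: g_def)
    moreover have "g holomorphic_on ball 0 r"
      using r unfolding g_def by (auto intro!: holomorphic_intros)
    ultimately show ?thesis'
      using r Infty by (intro exI[of _ "sphere_inverse \<circ> Fin"] exI[of _ g] exI[of _ 0] exI[of _ r]) auto
  qed
  then show thesis
    using that by blast
qed

lemma continuous_on_f: "continuous_on S f"
proof -
  have "isCont f x" for x
  proof -
    obtain \<phi> \<psi> r g \<zeta> where \<phi>: "\<phi> \<in> charts" and \<psi>: "\<psi> \<in> charts"
      and r: "r > 0" and g: "g holomorphic_on ball \<zeta> r" and x: "\<phi> \<zeta> = x" and eq: "\<And>z. z \<in> ball \<zeta> r \<Longrightarrow> f (\<phi> z) = \<psi> (g z)"
      by (rule chart[of x]) (rule that)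
    have cont: "continuous_on (ball \<zeta> r) (\<lambda>z. \<psi> (g z))"
      by (intro continuous_on_compose2[OF continuous_chart[OF \<psi>, of UNIV]] holomorphic_on_imp_continuous_on g) auto
    show ?thesis
      unfolding continuous_at_open
    proof (intro allI impI)
      fix T assume T: "open T \<and> f x \<in> T"
      let ?A = "(\<lambda>z. \<psi> (g z)) -` T \<inter> ball \<zeta> r"
      have "open ?A"
        using T continuous_open_preimage[OF cont open_ball, of T] by (simp add: Int_commute)
      then have "open (\<phi> ` ?A)"
        by (rule open_chart_image[OF \<phi>])
      moreover have "x \<in> \<phi> ` ?A"
        using T x eq[of \<zeta>] r by auto
      ultimately show "\<exists>S. open S \<and> x \<in> S \<and> (\<forall>x'\<in>S. f x' \<in> T)"
        using eq by (intro exI[of _ "\<phi> ` ?A"]) auto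
    qed
  qed
  then show ?thesis
    by (simp add: continuous_at_imp_continuous_on)
qed

text \<open>The open mapping theorem in charts; finite fibres rule out a constant local
  expression.\<close>

lemma open_image_f:
  assumes S: "open S" shows "open (f ` S)"
proof (subst open_subopen, intro ballI)
  fix y assume "y \<in> f ` S"
  then obtain x where xS: "x \<in> S" "y = f x" by auto
  obtain \<phi> \<psi> r g \<zeta> where \<phi>: "\<phi> \<in> charts" and \<psi>: "\<psi> \<in> charts"
      and r: "r > 0" and g: "g holomorphic_on ball \<zeta> r" and x: "\<phi> \<zeta> = x" and eq: "\<And>z. z \<in> ball \<zeta> r \<Longrightarrow> f (\<phi> z) = \<psi> (g z)"
      by (rule chart[of x]) (rule that)
  have nc: "\<not> g constant_on ball \<zeta> r"
  proof
    assume "g constant_on ball \<zeta> r"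
    then obtain w where w: "\<And>z. z \<in> ball \<zeta> r \<Longrightarrow> g z = w"
      by (auto simp: constant_on_def)
    have "\<phi> ` ball \<zeta> r \<subseteq> f -` {\<psi> w}"
      using w eq by auto
    then have "finite (\<phi> ` ball \<zeta> r)"
      using finite_fibre finite_subset by blast
    then have "finite (ball \<zeta> r)"
      using inj_chart[OF \<phi>] by (meson finite_imageD inj_on_subset subset_UNIV)
    moreover have "infinite (ball \<zeta> r)"
      using r uncountable_ball uncountable_infinite by blast
    ultimately show False by simp
  qed
  have "continuous_on UNIV \<phi>" using continuous_chart[OF \<phi>] .
  then have "open (\<phi> -` S)"
    using S by (simp add: open_vimage)
  then have U: "open (ball \<zeta> r \<inter> \<phi> -` S)"
    by (intro open_Int) auto
  have "open (g ` (ball \<zeta> r \<inter> \<phi> -` S))"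
    by (rule open_mapping_thm[OF g open_ball connected_ball U _ nc]) auto
  then have "open (\<psi> ` g ` (ball \<zeta> r \<inter> \<phi> -` S))"
    by (rule open_chart_image[OF \<psi>])
  moreover have "y \<in> \<psi> ` g ` (ball \<zeta> r \<inter> \<phi> -` S)"
    using x xS eq[of \<zeta>] r by auto
  moreover have "\<psi> ` g ` (ball \<zeta> r \<inter> \<phi> -` S) \<subseteq> f ` S"
    using eq by (auto simp: image_iff) metis
  ultimately show "\<exists>T. open T \<and> y \<in> T \<and> T \<subseteq> f ` S"
    by blast
qed

lemma continuous_on_funpow_f: "continuous_on S (f ^^ n)"
  proof (induction n)
  case (Suc n)
  show ?case
    unfolding funpow.simps by (intro continuous_on_compose Suc continuous_on_f)
qed (simp add: id_def)

lemma open_image_funpow_f: "open S \<Longrightarrow> open ((f ^^ n) ` S)"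
  by (induction n) (simp_all add: open_image_f image_comp[symmetric] del: o_apply)

text \<open>\<open>c z / z\<close> tends to the quotient of the leading coefficients, and
  \<open>\<mu>\<close> is chosen between its modulus and 1. In this form the repelling nature of
  infinity is used later: moduli shrink outside a large disk.\<close>

lemma near_infinity:
  obtains R \<mu> where "R > 0" "0 < \<mu>" "\<mu> < 1" "\<And>z. R \<le> cmod z \<Longrightarrow> poly D z \<noteq> 0 \<and> cmod (c z) \<le> \<mu> * cmod z"
proof -
  define l where "l = lead_coeff N / lead_coeff D"
  have "cmod l < 1"
    using lead_coeff_less by (simp add: l_def norm_divide divide_less_eq)
  then obtain \<mu> where \<mu>: "cmod l < \<mu>" "\<mu> < 1"
    using dense by blast
  have "((\<lambda>z. (poly N z / z ^ degree N) / (poly D z / z ^ degree D)) \<longlongrightarrow> l) at_infinity"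
    unfolding l_def by (intro tendsto_divide poly_divide_tendsto_aux) auto
  then have "((\<lambda>z. cmod ((poly N z / z ^ degree N) / (poly D z / z ^ degree D))) \<longlongrightarrow> cmod l) at_infinity"
    by (rule tendsto_norm)
  then have "\<forall>\<^sub>F z in at_infinity. cmod ((poly N z / z ^ degree N) / (poly D z / z ^ degree D)) < \<mu>"
    using \<mu>(1) order_tendstoD(2) by blast
  moreover have "finite {z. poly D z = 0}"
    by (intro poly_roots_finite) simp
  then obtain B where "\<And>z. poly D z = 0 \<Longrightarrow> cmod z \<le> B"
    using finite_imp_bounded bounded_iff by (metis (mono_tags, lifting) mem_Collect_eq)
  moreover obtain R0 where "\<And>z. R0 \<le> cmod z \<Longrightarrow> cmod ((poly N z / z ^ degree N) / (poly D z / z ^ degree D)) < \<mu>"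
    using calculation(1) unfolding eventually_at_infinity by blast
  ultimately have *: "poly D z \<noteq> 0 \<and> cmod (c z) \<le> \<mu> * cmod z" if "max 1 (max (B + 1) R0) \<le> cmod z" for z
  proof -
    have z: "z \<noteq> 0" "poly D z \<noteq> 0" "cmod ((poly N z / z ^ degree N) / (poly D z / z ^ degree D)) < \<mu>"
      using that \<open>\<And>z. poly D z = 0 \<Longrightarrow> cmod z \<le> B\<close>[of z]
        \<open>\<And>z. R0 \<le> cmod z \<Longrightarrow> cmod ((poly N z / z ^ degree N) / (poly D z / z ^ degree D)) < \<mu>\<close>[of z] by auto
    have "(poly N z / z ^ degree N) / (poly D z / z ^ degree D) = c z / z"
      using z by (simp add: c_def degree_N)
    then show ?thesis
      using z by (simp add: norm_divide divide_less_eq)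
  qed
  show thesis
    by (rule that[of "max 1 (max (B + 1) R0)" \<mu>]) (use * \<mu> in \<open>auto intro: le_less_trans[OF norm_ge_zero]\<close>)
qed

end

section \<open>Normal families of holomorphic functions\<close>

definition loc_unif_limit :: "complex set \<Rightarrow> (nat \<Rightarrow> complex \<Rightarrow> complex) \<Rightarrow> (complex \<Rightarrow> complex) \<Rightarrow> bool" where
  "loc_unif_limit S F h \<longleftrightarrow> (\<forall>K. compact K \<and> K \<subseteq> S \<longrightarrow> uniform_limit K F h sequentially)"

text \<open>Locally uniform chordal convergence to the constant \<open>Infty\<close>, expressed by
  planar functions.\<close>

definition loc_unif_infinity :: "complex set \<Rightarrow> (nat \<Rightarrow> complex \<Rightarrow> complex) \<Rightarrow> bool" where
  "loc_unif_infinity S F \<longleftrightarrow>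
     (\<forall>K. compact K \<and> K \<subseteq> S \<longrightarrow> (\<forall>B. \<forall>\<^sub>F n in sequentially. \<forall>z\<in>K. B \<le> cmod (F n z)))"

text \<open>A Schottky-type bound: omitting 0 and 1 and being bounded at one point forces bounds on
  compact sets, after which Montel's theorem for bounded families applies.\<close>

lemma normal_omitting_0_1_bounded:
  assumes S: "open S" "connected S" "w \<in> S" and hol: "\<And>n. F n holomorphic_on S"
    and omit: "\<And>n z. z \<in> S \<Longrightarrow> F n z \<noteq> 0 \<and> F n z \<noteq> 1"
    and bound: "\<And>n. cmod (F n w) \<le> 1"
  obtains r h where "strict_mono (r :: nat \<Rightarrow> nat)" "h holomorphic_on S" "loc_unif_limit S (\<lambda>n. F (r n)) h"
proof -
  obtain h r where "h holomorphic_on S" "strict_mono (r :: nat \<Rightarrow> nat)"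
    "\<And>K. \<lbrakk>compact K; K \<subseteq> S\<rbrakk> \<Longrightarrow> uniform_limit K (F \<circ> r) h sequentially"
  proof (rule Montel[OF S(1), of "range F" F])
    fix K assume K: "compact K" "K \<subseteq> S"
    obtain B where "\<And>h z. h \<in> range F \<Longrightarrow> z \<in> K \<Longrightarrow> cmod (h z) \<le> B"
      by (rule GPicard3[OF S subset_refl, of "range F" K]) (use hol omit bound K in auto)
    then show "\<exists>B. \<forall>h\<in>range F. \<forall>z\<in>K. cmod (h z) \<le> B"
      by blast
  qed (use hol in auto)
  then show thesis
    using that by (auto simp: loc_unif_limit_def o_def)
qed

text \<open>If the functions are not infinitely often at most 1 in modulus at \<open>w\<close>, pass
  to reciprocals, which omit the same values. By Hurwitz the limit of the reciprocals is either
  identically 0, which is divergence to infinity, or free of zeros and can be inverted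
  again.\<close>

lemma normal_omitting_0_1:
  assumes S: "open S" "connected S" and hol: "\<And>n. F n holomorphic_on S"
    and omit: "\<And>n z. z \<in> S \<Longrightarrow> F n z \<noteq> 0 \<and> F n z \<noteq> 1"
  shows "\<exists>r :: nat \<Rightarrow> nat. strict_mono r \<and> ((\<exists>h. h holomorphic_on S \<and> loc_unif_limit S (\<lambda>n. F (r n)) h) \<or> loc_unif_infinity S (\<lambda>n. F (r n)))"
proof (cases "S = {}")
  case True
  then show ?thesis
    by (auto simp: loc_unif_infinity_def intro!: exI[of _ id] strict_mono_id)
next
  case False
  then obtain w where w: "w \<in> S" by blast
  show ?thesis
  proof (cases "infinite {n. cmod (F n w) \<le> 1}")
    case True
    then obtain r :: "nat \<Rightarrow> nat" where r: "strict_mono r" "\<And>n. cmod (F (r n) w) \<le> 1"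
      using infinite_enumerate by blast
    obtain s h where "strict_mono (s :: nat \<Rightarrow> nat)" "h holomorphic_on S" "loc_unif_limit S (\<lambda>n. F (r (s n))) h"
      by (rule normal_omitting_0_1_bounded[OF S w, of "\<lambda>n. F (r n)"]) (use hol omit r in auto)
    then show ?thesis
      using r strict_mono_o[of r s] by (intro exI[of _ "r \<circ> s"]) auto
  next
    case False
    then have "infinite {n. \<not> cmod (F n w) \<le> 1}"
      using finite_Collect_not by blast
    then obtain r :: "nat \<Rightarrow> nat" where r: "strict_mono r" "\<And>n. cmod (F (r n) w) > 1"
      using infinite_enumerate by (metis (mono_tags, lifting) mem_Collect_eq not_le)
    obtain s h where s: "strict_mono (s :: nat \<Rightarrow> nat)" and h: "h holomorphic_on S"
      and lim: "loc_unif_limit S (\<lambda>n z. inverse (F (r (s n)) z)) h"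
      by (rule normal_omitting_0_1_bounded[OF S w, of "\<lambda>n z. inverse (F (r n) z)"])
        (use hol omit r(2) in \<open>auto intro!: holomorphic_intros simp: norm_inverse inverse_le_1_iff less_imp_le\<close>)
    have rs: "strict_mono (r \<circ> s)"
      using r s by (intro strict_mono_o)
    show ?thesis
    proof (cases "\<forall>z\<in>S. h z = 0")
      case True
      have "\<forall>\<^sub>F n in sequentially. \<forall>z\<in>K. B \<le> cmod (F (r (s n)) z)" if K: "compact K" "K \<subseteq> S" for K B
      proof -
        have "uniform_limit K (\<lambda>n z. inverse (F (r (s n)) z)) h sequentially"
          using lim K by (auto simp: loc_unif_limit_def)
        from uniform_limitD[OF this, of "inverse (max B 1)"]
        have "\<forall>\<^sub>F n in sequentially. \<forall>z\<in>K. dist (inverse (F (r (s n)) z)) (h z) < inverse (max B 1)"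
          by simp
        then show ?thesis
        proof eventually_elim
          case (elim n)
          show ?case
          proof
            fix z assume z: "z \<in> K"
            then have "dist (inverse (F (r (s n)) z)) 0 < inverse (max B 1)"
              using elim True K by (metis subsetD)
            then have "inverse (cmod (F (r (s n)) z)) < inverse (max B 1)"
              by (simp only: dist_0_norm dist_commute norm_inverse)
            moreover have "cmod (F (r (s n)) z) > 0"
              using z K omit by auto
            ultimately have "max B 1 < cmod (F (r (s n)) z)"
              using inverse_less_imp_less by blast
            then show "B \<le> cmod (F (r (s n)) z)"
              by simp
          qed
        qed
      qed
      then show ?thesis
        using rs by (intro exI[of _ "r \<circ> s"]) (auto simp: loc_unif_infinity_def)
    next
      case False
      have nz: "h z \<noteq> 0" if "z \<in> S" for z
      proof (cases "h constant_on S")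
        case True
        then show ?thesis
          using False that by (auto simp: constant_on_def)
      next
        case nonconst: False
        show ?thesis
          by (rule Hurwitz_no_zeros[OF S _ h _ nonconst _ that, of "\<lambda>n z. inverse (F (r (s n)) z)"])
            (use lim hol omit in \<open>auto intro!: holomorphic_intros simp: loc_unif_limit_def\<close>)
      qed
      have "uniform_limit K (\<lambda>n. F (r (s n))) (\<lambda>z. inverse (h z)) sequentially" if K: "compact K" "K \<subseteq> S" for K
      proof (cases "K = {}")
        case False
        have "continuous_on K (\<lambda>z. cmod (h z))"
          using h K by (intro continuous_intros holomorphic_on_imp_continuous_on) (rule holomorphic_on_subset)
        from continuous_attains_inf[OF K(1) False this] obtain z0 where
          z0: "z0 \<in> K" "\<And>z. z \<in> K \<Longrightarrow> cmod (h z0) \<le> cmod (h z)" by blast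
        have "uniform_limit K (\<lambda>n z. inverse (inverse (F (r (s n)) z))) (inverse \<circ> h) sequentially"
        proof (rule uniform_lim_inverse[OF _ z0(2)])
          show "0 < cmod (h z0)" using nz z0 K by auto
        qed (use lim K in \<open>auto simp: loc_unif_limit_def\<close>)
        then show ?thesis
          by (simp add: o_def)
      qed simp
      then show ?thesis
        using rs h nz by (intro exI[of _ "r \<circ> s"]) (auto simp: loc_unif_limit_def intro!: exI[of _ "\<lambda>z. inverse (h z)"] holomorphic_intros)
    qed
  qed
qed

lemma normal_omitting_two_values:
  assumes S: "open S" "connected S" and hol: "\<And>n. F n holomorphic_on S"
    and pq: "p \<noteq> q" and omit: "\<And>n z. z \<in> S \<Longrightarrow> F n z \<noteq> p \<and> F n z \<noteq> q"
  obtains r where "strict_mono (r :: nat \<Rightarrow> nat)"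
    "(\<exists>h. h holomorphic_on S \<and> loc_unif_limit S (\<lambda>n. F (r n)) h) \<or> loc_unif_infinity S (\<lambda>n. F (r n))"
proof -
  define g where "g n z = (F n z - p) / (q - p)" for n z
  have F: "F n z = p + (q - p) * g n z" for n z
    using pq by (simp add: g_def)
  have "\<exists>r :: nat \<Rightarrow> nat. strict_mono r \<and> ((\<exists>h. h holomorphic_on S \<and> loc_unif_limit S (\<lambda>n. g (r n)) h) \<or> loc_unif_infinity S (\<lambda>n. g (r n)))"
    by (rule normal_omitting_0_1[OF S])
      (use pq hol omit in \<open>auto simp: g_def[abs_def] divide_eq_1_iff intro!: holomorphic_intros\<close>)
  then obtain r where r: "strict_mono (r :: nat \<Rightarrow> nat)"
    and alt: "(\<exists>h. h holomorphic_on S \<and> loc_unif_limit S (\<lambda>n. g (r n)) h) \<or> loc_unif_infinity S (\<lambda>n. g (r n))"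
    by blast
  from alt show thesis
  proof
    assume "\<exists>h. h holomorphic_on S \<and> loc_unif_limit S (\<lambda>n. g (r n)) h"
    then obtain h where h: "h holomorphic_on S" "loc_unif_limit S (\<lambda>n. g (r n)) h" by blast
    have "loc_unif_limit S (\<lambda>n z. p + (q - p) * g (r n) z) (\<lambda>z. p + (q - p) * h z)"
      using h(2) unfolding loc_unif_limit_def by (auto intro!: uniform_limit_intros)
    then have "loc_unif_limit S (\<lambda>n. F (r n)) (\<lambda>z. p + (q - p) * h z)"
      by (simp add: F[abs_def])
    then show thesis
      using h(1) by (intro that[OF r] disjI1 exI[of _ "\<lambda>z. p + (q - p) * h z"] conjI holomorphic_intros)
  next
    assume g: "loc_unif_infinity S (\<lambda>n. g (r n))"
    have "loc_unif_infinity S (\<lambda>n. F (r n))"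
      unfolding loc_unif_infinity_def
    proof (intro allI impI)
      fix K B assume K: "compact K \<and> K \<subseteq> S"
      have "\<forall>\<^sub>F n in sequentially. \<forall>z\<in>K. (B + cmod p) / cmod (q - p) \<le> cmod (g (r n) z)"
        using g K unfolding loc_unif_infinity_def by blast
      then show "\<forall>\<^sub>F n in sequentially. \<forall>z\<in>K. B \<le> cmod (F (r n) z)"
      proof eventually_elim
        case (elim n)
        show ?case
        proof
          fix z assume "z \<in> K"
          then have "B + cmod p \<le> cmod ((q - p) * g (r n) z)"
            using elim pq by (simp add: divide_le_eq norm_mult mult.commute)
          also have "\<dots> \<le> cmod (F (r n) z) + cmod p"
            using norm_triangle_ineq4[of "F (r n) z" p] by (simp add: F)
          finally show "B \<le> cmod (F (r n) z)" by simp
        qed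
      qed
    qed
    then show thesis
      by (intro that[OF r] disjI2)
  qed
qed

lemma loc_unif_limit_tendsto:
  assumes "loc_unif_limit S F h" "z \<in> S" shows "(\<lambda>n. F n z) \<longlonglongrightarrow> h z"
  proof -
  have "uniform_limit {z} F h sequentially"
    using assms unfolding loc_unif_limit_def by (metis compact_sing empty_subsetI insert_subset)
  then show ?thesis
    by (rule tendsto_uniform_limitI) simp
qed

text \<open>The argument may move with the index; this is what passing to the limit in a composition
  of two sequences of iterates requires.\<close>

lemma loc_unif_limit_continuous_tendsto:
  assumes "open S" and h: "continuous_on S h" and lim: "loc_unif_limit S F h"
    and z: "z \<in> S" and y: "y \<longlonglongrightarrow> z"
  shows "(\<lambda>n. F n (y n)) \<longlonglongrightarrow> h z"
proof -
  obtain e where e: "e > 0" "cball z e \<subseteq> S"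
    using assms(1) z open_contains_cball by blast
  have ul: "uniform_limit (cball z e) F h sequentially"
    using lim e by (simp add: loc_unif_limit_def)
  have ev: "\<forall>\<^sub>F n in sequentially. y n \<in> cball z e"
    using tendstoD[OF y e(1)] by eventually_elim (simp add: dist_commute)
  have 1: "(\<lambda>n. h (y n)) \<longlonglongrightarrow> h z"
    by (rule continuous_on_tendsto_compose[OF h y z]) (use ev e in \<open>auto elim!: eventually_mono\<close>)
  show ?thesis
  proof (rule tendstoI)
    fix d :: real assume d: "d > 0"
    have "\<forall>\<^sub>F n in sequentially. \<forall>x\<in>cball z e. dist (F n x) (h x) < d/2"
      by (rule uniform_limitD[OF ul]) (use d in simp)
    moreover have "\<forall>\<^sub>F n in sequentially. dist (h (y n)) (h z) < d/2"
      by (rule tendstoD[OF 1]) (use d in simp)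
    ultimately show "\<forall>\<^sub>F n in sequentially. dist (F n (y n)) (h z) < d"
      using ev
    proof eventually_elim
      case (elim n)
      then show ?case
        using dist_triangle[of "F n (y n)" "h z" "h (y n)"] by fastforce
    qed
  qed
qed

lemma loc_unif_infinity_filterlim:
  assumes "open S" and lim: "loc_unif_infinity S F" and z: "z \<in> S" and y: "y \<longlonglongrightarrow> z"
  shows "filterlim (\<lambda>n. F n (y n)) at_infinity sequentially"
proof -
  obtain e where e: "e > 0" "cball z e \<subseteq> S"
    using assms(1) z open_contains_cball by blast
  have ev: "\<forall>\<^sub>F n in sequentially. y n \<in> cball z e"
    using tendstoD[OF y e(1)] by eventually_elim (simp add: dist_commute)
  show ?thesis
    unfolding filterlim_at_infinity[OF order_refl]
  proof (intro allI impI)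
    fix B :: real
    have "\<forall>\<^sub>F n in sequentially. \<forall>x\<in>cball z e. B \<le> cmod (F n x)"
      using lim e unfolding loc_unif_infinity_def by auto
    then show "\<forall>\<^sub>F n in sequentially. B \<le> cmod (F n (y n))"
      using ev by eventually_elim auto
  qed
qed

section \<open>The Julia set as closure of the backward orbit of infinity\<close>

definition exterior :: "real \<Rightarrow> rsphere set" where
  "exterior s = insert Infty (Fin ` {z. s < cmod z})"

lemma exterior_eq: "s > 0 \<Longrightarrow> exterior s = sphere_inverse ` Fin ` ball 0 (inverse s)"
proof (rule set_eqI)
  fix x assume s: "s > 0"
  have "x \<in> sphere_inverse ` Fin ` ball 0 (inverse s) \<longleftrightarrow> sphere_inverse x \<in> Fin ` ball 0 (inverse s)"
    by (metis image_iff sphere_inverse_inverse)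
  also have "\<dots> \<longleftrightarrow> x \<in> exterior s"
  proof (cases x)
    case (Fin z)
    have "cmod (inverse z) < inverse s \<longleftrightarrow> s < cmod z" if "z \<noteq> 0"
      using that s inverse_less_iff_less[of s "cmod z"] inverse_less_iff_less[of "cmod z" s] 
      by (metis norm_inverse zero_less_norm_iff inverse_less_iff_less)
    then show ?thesis
      using s by (auto simp: Fin exterior_def)
  next
    case Infty
    then show ?thesis using s by (auto simp: exterior_def)
  qed
  finally show "x \<in> exterior s \<longleftrightarrow> x \<in> sphere_inverse ` Fin ` ball 0 (inverse s)" by simp
qed

lemma open_exterior: "s > 0 \<Longrightarrow> open (exterior s)"
  by (simp add: exterior_eq open_sphere_inverse_image open_Fin_image)

lemma connected_exterior: "s > 0 \<Longrightarrow> connected (exterior s)"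
  by (simp add: exterior_eq connected_continuous_image continuous_on_sphere_inverse connected_Fin_image_iff)

lemma exterior_mono: "s \<le> t \<Longrightarrow> exterior t \<subseteq> exterior s"
  by (auto simp: exterior_def)

lemma exterior_subset_open:
  assumes "open S" "Infty \<in> S" obtains s where "s > 0" "\<And>t. s \<le> t \<Longrightarrow> exterior t \<subseteq> S"
proof -
  obtain e where e: "e > 0" "ball Infty e \<subseteq> S"
    using assms open_contains_ball by blast
  obtain R where R: "R > 0" "\<And>z. R < cmod z \<Longrightarrow> dist (Fin z) Infty < e"
    using eventually_dist_Infty[OF e(1)] by metis
  have "exterior t \<subseteq> S" if "R \<le> t" for t
    using R(2) that e assms(2) by (force simp: exterior_def dist_commute)
  then show thesis
    using R that by blast
qed

context rational_repelling_infinity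
begin

text \<open>The image is open and contains \<open>Infty\<close>. A boundary point of it comes from
  the circle of radius \<open>s\<close> by compactness, so its modulus is at most
  \<open>\<mu> * s\<close>. Hence the connected set \<open>exterior (\<mu> * s)\<close> meets the
  image but not its boundary.\<close>

lemma image_exterior:
  assumes R: "R > 0" "0 < \<mu>" "\<mu> < 1" "\<And>z. R \<le> cmod z \<Longrightarrow> poly D z \<noteq> 0 \<and> cmod (c z) \<le> \<mu> * cmod z"
    and s: "R \<le> s"
  shows "exterior (\<mu> * s) \<subseteq> f ` exterior s"
proof (rule ccontr)
  let ?T = "f ` exterior s"
  assume "\<not> exterior (\<mu> * s) \<subseteq> ?T"
  moreover have "Infty \<in> exterior (\<mu> * s) \<inter> ?T"
    by (auto simp: exterior_def image_iff)
  ultimately have "exterior (\<mu> * s) \<inter> frontier ?T \<noteq> {}"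
    using s R by (intro connected_Int_frontier connected_exterior) auto
  then obtain y where y: "y \<in> exterior (\<mu> * s)" "y \<in> closure ?T" "y \<notin> ?T"
    using open_image_f[OF open_exterior[of s]] s R by (auto simp: frontier_def interior_open)
  let ?C = "- (Fin ` ball 0 s)"
  have "compact ?C"
    using compact_Int_closed[OF compact_rsphere closed_Compl[OF open_Fin_image[OF open_ball]]] by simp
  then have "compact (f ` ?C)"
    by (intro compact_continuous_image continuous_on_f)
  moreover have "exterior s \<subseteq> ?C"
    by (auto simp: exterior_def)
  ultimately have "closure ?T \<subseteq> f ` ?C"
    by (intro closure_minimal compact_imp_closed image_mono)
  then obtain x where x: "y = f x" "x \<in> ?C" using y by auto
  then have "x \<notin> exterior s" using y by auto
  then obtain z where z: "x = Fin z" "cmod z = s"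
    using x(2) by (cases x) (auto simp: exterior_def image_iff)
  then have "y = Fin (c z)" "cmod (c z) \<le> \<mu> * s"
    using R(4)[of z] s x by auto
  then show False
    using y(1) by (auto simp: exterior_def)
qed

lemma funpow_image_exterior:
  assumes R: "R > 0" "0 < \<mu>" "\<mu> < 1" "\<And>z. R \<le> cmod z \<Longrightarrow> poly D z \<noteq> 0 \<and> cmod (c z) \<le> \<mu> * cmod z"
    and s: "R \<le> s"
  shows "\<forall>\<^sub>F k in sequentially. exterior R \<subseteq> (f ^^ k) ` exterior s"
proof -
  \<comment> \<open>The radius is cut off at \<open>R\<close> because the estimate on
    \<open>c\<close> holds only down to that modulus.\<close>
  have *: "exterior (max R (\<mu> ^ k * s)) \<subseteq> (f ^^ k) ` exterior s" for k
  proof (induction k)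
    case 0
    then show ?case using s by (auto simp: max_def)
  next
    case (Suc k)
    have "exterior (max R (\<mu> ^ Suc k * s)) \<subseteq> exterior (\<mu> * max R (\<mu> ^ k * s))"
    proof (rule exterior_mono)
      have "\<mu> * R \<le> R" using R by (simp add: mult_le_cancel_right1)
      then show "\<mu> * max R (\<mu> ^ k * s) \<le> max R (\<mu> ^ Suc k * s)"
        by (auto simp: max_def)
    qed
    also have "\<dots> \<subseteq> f ` exterior (max R (\<mu> ^ k * s))"
      by (rule image_exterior[OF R]) auto
    also have "\<dots> \<subseteq> f ` (f ^^ k) ` exterior s"
      by (rule image_mono[OF Suc])
    finally show ?case
      by (simp only: image_comp funpow.simps)
  qed
  have "(\<lambda>k. \<mu> ^ k * s) \<longlonglongrightarrow> 0 * s"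
    using R by (intro tendsto_mult LIMSEQ_realpow_zero) auto
  then have "\<forall>\<^sub>F k in sequentially. \<mu> ^ k * s < R"
    using R(1) by (intro order_tendstoD(2)) auto
  then show ?thesis
    proof eventually_elim
    case (elim k)
    then show ?case
      using *[of k] by (simp add: max_def)
  qed
qed

section \<open>The backward orbit of infinity and its complement\<close>

definition backward_orbit :: "rsphere set" where
  "backward_orbit = {x. \<exists>n. (f ^^ n) x = Infty}"

lemma Infty_backward_orbit [simp]: "Infty \<in> backward_orbit"
  by (auto simp: backward_orbit_def intro!: exI[of _ 0])

lemma funpow_f_Infty [simp]: "(f ^^ n) Infty = Infty"
  by (induction n) auto

lemma backward_orbit_f_iff [simp]: "f x \<in> backward_orbit \<longleftrightarrow> x \<in> backward_orbit"
proof
  assume "f x \<in> backward_orbit"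
  then obtain n where "(f ^^ n) (f x) = Infty" by (auto simp: backward_orbit_def)
  then have "(f ^^ Suc n) x = Infty" by (simp add: funpow_swap1)
  then show "x \<in> backward_orbit" unfolding backward_orbit_def by blast
next
  assume "x \<in> backward_orbit"
  then obtain n where "(f ^^ n) x = Infty" by (auto simp: backward_orbit_def)
  then have "(f ^^ n) (f x) = Infty"
    by (metis f_simps(1) funpow_swap1)
  then show "f x \<in> backward_orbit" unfolding backward_orbit_def by blast
qed

text \<open>Openness of \<open>f\<close> gives one direction of complete invariance, continuity the
  other.\<close>

lemma closure_backward_orbit_f_iff [simp]:
  "f x \<in> closure backward_orbit \<longleftrightarrow> x \<in> closure backward_orbit"
proof
  assume fx: "f x \<in> closure backward_orbit"
  show "x \<in> closure backward_orbit"
    unfolding closure_iff_nhds_not_empty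
  proof (intro allI impI)
    fix A U assume U: "U \<subseteq> A" "open U" "x \<in> U"
    then have "open (f ` U)" "f x \<in> f ` U"
      using open_image_f by auto
    then have "f ` U \<inter> backward_orbit \<noteq> {}"
      using fx open_Int_closure_eq_empty by blast
    then show "backward_orbit \<inter> A \<noteq> {}"
      using U by auto
  qed
next
  assume "x \<in> closure backward_orbit"
  moreover have "f ` closure backward_orbit \<subseteq> closure (f ` backward_orbit)"
    by (rule continuous_image_closure_subset[OF continuous_on_f[of UNIV]]) auto
  moreover have "f ` backward_orbit \<subseteq> backward_orbit"
    by auto
  ultimately show "f x \<in> closure backward_orbit"
    using closure_mono by blast
qed

text \<open>The Fatou set in the coordinate of the plane, as \<open>Fatou_set_f\<close> shows.
  Defined through the backward orbit, it is completely invariant and free of poles before anything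
  is known about normality.\<close>

definition G :: "complex set" where
  "G = {z. Fin z \<notin> closure backward_orbit}"

lemma open_G: "open G"
proof -
  have "G = Fin -` (- closure backward_orbit)"
    by (auto simp: G_def)
  then show ?thesis
    using continuous_on_Fin[OF continuous_on_id, of UNIV]
    by (metis open_vimage open_Compl closed_closure)
qed

lemma Fin_G: "Fin ` G = - closure backward_orbit"
proof -
  have "Infty \<in> closure backward_orbit"
    using closure_subset Infty_backward_orbit by blast
  then have "x \<in> Fin ` G" if "x \<notin> closure backward_orbit" for x
    using that by (cases x) (auto simp: G_def)
  then show ?thesis
    by (auto simp: G_def)
qed

lemma G_step:
  assumes "z \<in> G" shows "poly D z \<noteq> 0" "c z \<in> G" "f (Fin z) = Fin (c z)"
proof -
  show nz: "poly D z \<noteq> 0"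
  proof
    assume "poly D z = 0"
    then have "f (Fin z) \<in> backward_orbit" by simp
    then have "Fin z \<in> closure backward_orbit"
      using closure_subset backward_orbit_f_iff by blast
    then show False using assms by (simp add: G_def)
  qed
  then show "f (Fin z) = Fin (c z)" by simp
  then show "c z \<in> G"
    using assms closure_backward_orbit_f_iff[of "Fin z"] by (simp add: G_def)
qed

lemma funpow_c_G: "z \<in> G \<Longrightarrow> (c ^^ n) z \<in> G"
  by (induction n) (auto simp: G_step)

lemma funpow_f_G: "z \<in> G \<Longrightarrow> (f ^^ n) (Fin z) = Fin ((c ^^ n) z)"
  by (induction n) (auto simp: G_step(3) funpow_c_G)

text \<open>After hitting a pole the iterates of \<open>c\<close> take junk values (\<open>x / 0 = 0\<close>), so \<open>c ^^ M\<close> represents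
  \<open>f ^^ M\<close> only off \<open>E M\<close>.\<close>

definition E :: "nat \<Rightarrow> complex set" where
  "E M = {z. \<exists>j<M. poly D ((c ^^ j) z) = 0}"

lemma E_0 [simp]: "E 0 = {}"
  by (simp add: E_def)

lemma E_mono: "M \<le> M' \<Longrightarrow> E M \<subseteq> E M'"
  unfolding E_def using less_le_trans by blast

lemma funpow_f_E: "z \<notin> E M \<Longrightarrow> (f ^^ M) (Fin z) = Fin ((c ^^ M) z)"
proof (induction M)
  case (Suc M)
  then have "z \<notin> E M" "poly D ((c ^^ M) z) \<noteq> 0"
    by (auto simp: E_def)
  then show ?case
    using Suc.IH by simp
qed simp

lemma E_imp_Infty:
  assumes "z \<in> E M" shows "(f ^^ M) (Fin z) = Infty"
proof -
  \<comment> \<open>The first time at which a pole is hit: up to then the iterates of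
    \<open>c\<close> are genuine, and afterwards \<open>f\<close> stays at
    \<open>Infty\<close>.\<close>
  define j where "j = (LEAST j. poly D ((c ^^ j) z) = 0)"
  obtain i where i: "i < M" "poly D ((c ^^ i) z) = 0"
    using assms by (auto simp: E_def)
  have j: "poly D ((c ^^ j) z) = 0"
    unfolding j_def by (rule LeastI[of _ i]) (rule i)
  have "j \<le> i"
    unfolding j_def by (rule Least_le) (rule i)
  then have "j < M"
    using i by simp
  have "z \<notin> E j"
    unfolding E_def j_def using not_less_Least by auto
  then have "(f ^^ Suc j) (Fin z) = Infty"
    using j funpow_f_E by simp
  moreover have "(f ^^ M) (Fin z) = (f ^^ (M - Suc j)) ((f ^^ Suc j) (Fin z))"
    using \<open>j < M\<close> by (simp only: funpow_add[THEN fun_cong, unfolded o_apply, symmetric]) simp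
  ultimately show ?thesis
    by simp
qed

lemma E_iff: "z \<in> E M \<longleftrightarrow> (f ^^ M) (Fin z) = Infty"
  using E_imp_Infty funpow_f_E by force

lemma backward_orbit_eq: "Fin z \<in> backward_orbit \<longleftrightarrow> (\<exists>M. z \<in> E M)"
  by (simp add: backward_orbit_def E_iff)

lemma G_disjoint_E: "z \<in> G \<Longrightarrow> z \<notin> E M"
  using closure_subset backward_orbit_eq by (auto simp: G_def)

lemma finite_preimage_funpow_f: "finite S \<Longrightarrow> finite ((f ^^ M) -` S)"
proof (induction M arbitrary: S)
  case (Suc M)
  have "f -` S = (\<Union>y\<in>S. f -` {y})" by auto
  then have "finite (f -` S)"
    using Suc.prems finite_fibre by simp
  then have "finite ((f ^^ M) -` (f -` S))"
    by (rule Suc.IH)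
  then show ?case
    by (simp only: vimage_comp funpow.simps)
qed (simp add: id_def)

lemma finite_E: "finite (E M)"
proof -
  have "Fin ` E M \<subseteq> (f ^^ M) -` {Infty}"
    by (auto simp: E_iff)
  then have "finite (Fin ` E M)"
    using finite_preimage_funpow_f finite_subset by blast
  then show ?thesis
    by (simp add: finite_image_iff inj_on_def)
qed

lemma open_Compl_E: "open (- E M)"
  by (simp add: finite_E finite_imp_closed open_Compl)

text \<open>Connectedness lets the identity theorem act on the whole domain of \<open>c ^^ M\<close>
  at once.\<close>

lemma connected_Compl_E: "connected (- E M)"
  using connected_open_delete_finite[OF open_UNIV connected_UNIV _ finite_E[of M]]
  by (simp add: Compl_eq_Diff_UNIV)

lemma holomorphic_on_c: "(\<And>z. z \<in> S \<Longrightarrow> poly D z \<noteq> 0) \<Longrightarrow> c holomorphic_on S"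
  unfolding c_def[abs_def] by (intro holomorphic_intros) auto

lemma holomorphic_on_funpow_c: "S \<inter> E M = {} \<Longrightarrow> (c ^^ M) holomorphic_on S"
proof (induction M)
  case 0
  then show ?case by (simp add: id_def holomorphic_on_ident)
next
  case (Suc M)
  have "c holomorphic_on (c ^^ M) ` S"
    using Suc.prems by (intro holomorphic_on_c) (auto simp: E_def)
  moreover have "(c ^^ M) holomorphic_on S"
    using Suc.prems E_mono[of M "Suc M"] by (intro Suc.IH) auto
  ultimately show ?case
    unfolding funpow.simps by (intro holomorphic_on_compose)
qed

lemma holomorphic_on_funpow_c_G: "S \<subseteq> G \<Longrightarrow> (c ^^ M) holomorphic_on S"
  using G_disjoint_E by (intro holomorphic_on_funpow_c) blast

text \<open>Orbits in \<open>G\<close> never meet a pole, so two poles are omitted by all iterates.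
  The times form an arbitrary sequence since differences of times, which need not increase, occur
  later.\<close>

lemma normal_G:
  assumes "open S" "connected S" "S \<subseteq> G"
  obtains r where "strict_mono (r :: nat \<Rightarrow> nat)"
    "(\<exists>h. h holomorphic_on S \<and> loc_unif_limit S (\<lambda>j. c ^^ n (r j)) h) \<or> loc_unif_infinity S (\<lambda>j. c ^^ n (r j))"
proof -
  obtain p q where pq: "p \<noteq> q" "poly D p = 0" "poly D q = 0"
    using two_poles by blast
  have omit: "(c ^^ m) z \<noteq> p \<and> (c ^^ m) z \<noteq> q" if "z \<in> S" for m z
    using G_step(1)[OF funpow_c_G[of z m]] that assms(3) pq by auto
  show thesis
    by (rule normal_omitting_two_values[OF assms(1,2), of "\<lambda>j. c ^^ n j" p q])
      (use that pq omit holomorphic_on_funpow_c_G[OF assms(3)] in auto)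
qed

end

section \<open>The Fatou set and its components\<close>

lemma compact_Fin_image_iff: "compact (Fin ` K) \<longleftrightarrow> compact K"
  using homeomorphism_Fin homeomorphic_compactness homeomorphic_def by blast

lemma open_Fatou_set: "open (Fatou_set g)"
  unfolding Fatou_set_def by (subst open_subopen) blast

context rational_repelling_infinity
begin

text \<open>On a small disk both planar alternatives become uniform chordal limits:
  \<open>Fin\<close> at most doubles distances, and large moduli are chordally close to
  \<open>Infty\<close>.\<close>

lemma G_subset_Fatou_set: "Fin ` G \<subseteq> Fatou_set f"
proof
  fix x assume "x \<in> Fin ` G"
  then obtain z where z: "x = Fin z" "z \<in> G" by blast
  then obtain e where e: "e > 0" "ball z e \<subseteq> G"
    using open_G open_contains_ball by blast
  let ?U = "Fin ` ball z e"
  have "normal_on ?U {f ^^ n |n. n > 0}"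
    unfolding normal_on_def
  proof (intro allI impI)
    fix g :: "nat \<Rightarrow> rsphere \<Rightarrow> rsphere"
    assume "range g \<subseteq> {f ^^ n |n. n > 0}"
    then have "\<forall>j. \<exists>n. g j = f ^^ n" by blast
    then obtain n where n: "\<And>j. g j = f ^^ n j" by metis
    obtain r where r: "strict_mono (r :: nat \<Rightarrow> nat)" and alt: "(\<exists>h. h holomorphic_on ball z e \<and>
        loc_unif_limit (ball z e) (\<lambda>j. c ^^ n (r j)) h) \<or> loc_unif_infinity (ball z e) (\<lambda>j. c ^^ n (r j))"
      by (rule normal_G[OF open_ball connected_ball e(2)])
    have gF: "g (r j) (Fin w) = Fin ((c ^^ n (r j)) w)" if "w \<in> ball z e" for w j
      using that e(2) by (simp add: n funpow_f_G subset_iff)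
    show "\<exists>r h. strict_mono r \<and> (\<forall>K. compact K \<and> K \<subseteq> ?U \<longrightarrow> uniform_limit K (\<lambda>n. g (r n)) h sequentially)"
      using alt
    proof
      assume "\<exists>h. h holomorphic_on ball z e \<and> loc_unif_limit (ball z e) (\<lambda>j. c ^^ n (r j)) h"
      then obtain h where h: "loc_unif_limit (ball z e) (\<lambda>j. c ^^ n (r j)) h" by blast
      have "uniform_limit K (\<lambda>n. g (r n)) (\<lambda>x. Fin (h (finite_part x))) sequentially" if K: "compact K" "K \<subseteq> ?U" for K
      proof (rule uniform_limitI)
        fix d :: real assume "d > 0"
        obtain L where L: "L \<subseteq> ball z e" "K = Fin ` L"
          using K(2) by (meson subset_image_iff)
        then have "uniform_limit L (\<lambda>j. c ^^ n (r j)) h sequentially"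
          using K h by (auto simp: loc_unif_limit_def compact_Fin_image_iff)
        from uniform_limitD[OF this, of "d/2"]
        have "\<forall>\<^sub>F j in sequentially. \<forall>w\<in>L. dist ((c ^^ n (r j)) w) (h w) < d/2"
          using \<open>d > 0\<close> by simp
        then show "\<forall>\<^sub>F j in sequentially. \<forall>x\<in>K. dist (g (r j) x) (Fin (h (finite_part x))) < d"
        proof eventually_elim
          case (elim j)
          show ?case
          proof
            fix x assume "x \<in> K"
            then obtain w where w: "w \<in> L" "x = Fin w" using L by auto
            have "dist (g (r j) x) (Fin (h w)) \<le> 2 * dist ((c ^^ n (r j)) w) (h w)"
              using w L gF dist_Fin_le by auto
            also have "\<dots> < d"
              using elim w by fastforce
            finally show "dist (g (r j) x) (Fin (h (finite_part x))) < d"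
              using w by simp
          qed
        qed
      qed
      then show ?thesis using r by blast
    next
      assume inf: "loc_unif_infinity (ball z e) (\<lambda>j. c ^^ n (r j))"
      have "uniform_limit K (\<lambda>n. g (r n)) (\<lambda>x. Infty) sequentially" if K: "compact K" "K \<subseteq> ?U" for K
      proof (rule uniform_limitI)
        fix d :: real assume "d > 0"
        then obtain R where R: "R > 0" "\<And>z. R < cmod z \<Longrightarrow> dist (Fin z) Infty < d"
          using eventually_dist_Infty by metis
        obtain L where L: "L \<subseteq> ball z e" "K = Fin ` L"
          using K(2) by (meson subset_image_iff)
        then have "\<forall>\<^sub>F j in sequentially. \<forall>w\<in>L. R + 1 \<le> cmod ((c ^^ n (r j)) w)"
          using K inf unfolding loc_unif_infinity_def compact_Fin_image_iff[symmetric] by blast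
        then show "\<forall>\<^sub>F j in sequentially. \<forall>x\<in>K. dist (g (r j) x) Infty < d"
        proof eventually_elim
          case (elim j)
          show ?case
          proof
            fix x assume "x \<in> K"
            then obtain w where w: "w \<in> L" "x = Fin w" using L by auto
            then have "R < cmod ((c ^^ n (r j)) w)" using elim by fastforce
            then show "dist (g (r j) x) Infty < d"
              using w L gF R by auto
          qed
        qed
      qed
      then show ?thesis using r by blast
    qed
  qed
  moreover have "open ?U" "x \<in> ?U"
    using z e by (auto intro: open_Fin_image)
  ultimately show "x \<in> Fatou_set f"
    unfolding Fatou_set_def by blast
qed

text \<open>Near a preimage of \<open>\<infinity>\<close> the images of a small neighbourhood under the iterates grow to contain
  a fixed neighbourhood of \<open>\<infinity>\<close>, whereas equicontinuity would keep them small.\<close>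

lemma backward_orbit_not_normal:
  assumes U: "open U" "y \<in> U" "y \<in> backward_orbit"
  shows "\<not> normal_on U {f ^^ n |n. n > 0}"
proof
  assume N: "normal_on U {f ^^ n |n. n > 0}"
  obtain n where n: "(f ^^ n) y = Infty"
    using U(3) by (auto simp: backward_orbit_def)
  obtain R \<mu> where R: "R > 0" "0 < \<mu>" "\<mu> < 1" "\<And>z. R \<le> cmod z \<Longrightarrow> poly D z \<noteq> 0 \<and> cmod (c z) \<le> \<mu> * cmod z"
    by (rule near_infinity) (rule that)
  \<comment> \<open>\<open>Suc j\<close> keeps the exponents positive, as membership in the family
    demands.\<close>
  have "range (\<lambda>j. f ^^ Suc j) \<subseteq> {f ^^ n |n. n > 0}" by blast
  from N[unfolded normal_on_def, rule_format, OF this] obtain r h where r: "strict_mono r"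
    and lim: "\<And>K. compact K \<Longrightarrow> K \<subseteq> U \<Longrightarrow> uniform_limit K (\<lambda>j. f ^^ Suc (r j)) h sequentially"
    by blast
  obtain e where e: "e > 0" "cball y e \<subseteq> U"
    using U open_contains_cball by blast
  let ?K = "cball y e"
  have ul: "uniform_limit ?K (\<lambda>j. f ^^ Suc (r j)) h sequentially"
    using e compact_Int_closed[OF compact_rsphere closed_cball, of y e] by (intro lim) simp_all
  have cont: "continuous_on ?K h"
    by (rule uniform_limit_theorem[OF _ ul]) (auto intro!: always_eventually continuous_on_funpow_f simp del: funpow.simps)
  have ry: "r j \<ge> n \<Longrightarrow> (f ^^ Suc (r j)) y = Infty" for j
    using n funpow_f_Infty funpow_add[of "Suc (r j) - n" n f] by simp
  have "(\<lambda>j. (f ^^ Suc (r j)) y) \<longlonglongrightarrow> h y"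
    by (rule tendsto_uniform_limitI[OF ul]) (use e in simp)
  moreover have "(\<lambda>j. (f ^^ Suc (r j)) y) \<longlonglongrightarrow> Infty"
  proof (rule tendsto_eventually)
    show "\<forall>\<^sub>F j in sequentially. (f ^^ Suc (r j)) y = Infty"
      using eventually_ge_at_top[of n]
    proof eventually_elim
      case (elim j)
      then show ?case
        using ry seq_suble[OF r, of j] by (simp del: funpow.simps)
    qed
  qed
  ultimately have hy: "h y = Infty"
    using LIMSEQ_unique by blast
  \<comment> \<open>The chordal radius of the disk \<open>exterior (R + 1)\<close>. The point
    \<open>R + 1/2\<close> belongs to \<open>exterior R\<close> but not to this disk, which yields
    the contradiction at the end.\<close>
  define d where "d = 2 / sqrt (1 + (R + 1)\<^sup>2)"
  have d: "d > 0" by (simp add: d_def add_pos_nonneg)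
  obtain e' where e': "e' > 0" "e' \<le> e" "\<And>x. dist x y < e' \<Longrightarrow> dist (h x) Infty < d / 2"
  proof -
    have "\<exists>e'>0. \<forall>x\<in>?K. dist x y < e' \<longrightarrow> dist (h x) (h y) < d / 2"
      using cont[unfolded continuous_on_iff, rule_format, of y "d / 2"] d e(1) by auto
    then obtain e' where "e' > 0" "\<And>x. x \<in> ?K \<Longrightarrow> dist x y < e' \<Longrightarrow> dist (h x) Infty < d / 2"
      using hy by auto
    then show thesis
      using e by (intro that[of "min e e'"]) (auto simp: dist_commute)
  qed
  have "open ((f ^^ n) ` ball y e')" "Infty \<in> (f ^^ n) ` ball y e'"
    using e' n by (auto intro!: open_image_funpow_f simp: image_iff intro: bexI[of _ y])
  then obtain s where s: "\<And>t. s \<le> t \<Longrightarrow> exterior t \<subseteq> (f ^^ n) ` ball y e'"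
    using exterior_subset_open by metis
  have "\<forall>\<^sub>F k in sequentially. exterior R \<subseteq> (f ^^ k) ` exterior (max R s)"
    by (rule funpow_image_exterior[OF R]) auto
  then obtain k0 where k0: "\<And>k. k \<ge> k0 \<Longrightarrow> exterior R \<subseteq> (f ^^ k) ` exterior (max R s)"
    unfolding eventually_sequentially by blast
  have "\<forall>\<^sub>F j in sequentially. \<forall>x\<in>?K. dist ((f ^^ Suc (r j)) x) (h x) < d / 2"
    by (rule uniform_limitD[OF ul]) (use d in simp)
  moreover have "\<forall>\<^sub>F j in sequentially. j \<ge> k0 + n"
    by (rule eventually_ge_at_top)
  ultimately have "\<forall>\<^sub>F j in sequentially. False"
  proof eventually_elim
    case (elim j)
    have j: "r j \<ge> k0 + n"
      using elim seq_suble[OF r, of j] by simp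
    have "exterior R \<subseteq> (f ^^ (Suc (r j) - n)) ` exterior (max R s)"
      using j by (intro k0) simp
    also have "\<dots> \<subseteq> (f ^^ (Suc (r j) - n)) ` (f ^^ n) ` ball y e'"
      by (intro image_mono s) simp
    also have "\<dots> = (f ^^ Suc (r j)) ` ball y e'"
      using j by (simp only: image_comp funpow_add[symmetric]) simp
    also have "\<dots> \<subseteq> ball Infty d"
    proof
      fix w assume "w \<in> (f ^^ Suc (r j)) ` ball y e'"
      then obtain x where x: "w = (f ^^ Suc (r j)) x" "dist x y < e'"
        by (auto simp: dist_commute)
      then have "dist w (h x) < d / 2" "dist (h x) Infty < d / 2"
        using elim e'(2,3) by (auto simp: dist_commute simp del: funpow.simps)
      then show "w \<in> ball Infty d"
        using dist_triangle[of w Infty "h x"] by (simp add: dist_commute)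
    qed
    finally have "exterior R \<subseteq> ball Infty d" .
    moreover have "Fin (of_real (R + 1/2)) \<in> exterior R"
      using R(1) by (simp add: exterior_def del: of_real_add)
    ultimately have "dist (Fin (of_real (R + 1/2))) Infty < d"
      by (auto simp: dist_commute)
    then have "R + 1 < cmod (of_real (R + 1/2))"
      using dist_Infty_less_iff[of "R + 1"] R(1) by (simp add: d_def del: of_real_add)
    then show False
      using R(1) by (simp del: of_real_add)
  qed
  then show False by simp
qed

lemma Fatou_set_f: "Fatou_set f = Fin ` G"
proof
  have "Fatou_set f \<inter> backward_orbit = {}"
    using backward_orbit_not_normal by (auto simp: Fatou_set_def)
  then have "Fatou_set f \<inter> closure backward_orbit = {}"
    using open_Fatou_set open_Int_closure_eq_empty by blast
  then show "Fatou_set f \<subseteq> Fin ` G"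
    by (auto simp: Fin_G)
qed (rule G_subset_Fatou_set)

lemma Fatou_component_f: "Fatou_component f U \<longleftrightarrow> (\<exists>W\<in>components G. U = Fin ` W)"
  by (simp add: Fatou_component_def Fatou_set_f components_Fin_image)

lemma open_component_G: "W \<in> components G \<Longrightarrow> open W"
  using open_G open_components by blast

lemma component_G_subset: "W \<in> components G \<Longrightarrow> W \<subseteq> G"
  by (rule in_components_subset)

lemma component_G_eqI:
  assumes "V \<in> components G" "connected T" "T \<subseteq> G" "T \<inter> V \<noteq> {}" shows "T \<subseteq> V"
  using assms components_maximal by blast

text \<open>Let \<open>V\<close> be the component containing the image. A boundary point of the
  image inside \<open>V\<close> would, by compactness, be the value of \<open>f\<close> at a point
  of the closure of \<open>W\<close>. Complete invariance makes that point a Fatou point, and its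
  component meets \<open>W\<close>, so it lies in \<open>W\<close> and the value lies in the image
  after all.\<close>

lemma Fatou_component_image:
  assumes W: "W \<in> components G"
  shows "c ` W \<in> components G"
proof -
  have WG: "W \<subseteq> G" "connected W" "W \<noteq> {}" "open W"
    using W in_components_connected in_components_nonempty open_component_G component_G_subset by auto
  then obtain w where w: "w \<in> W" by blast
  then have cw: "c w \<in> G"
    using WG G_step by blast
  define V where "V = connected_component_set G (c w)"
  have V: "V \<in> components G" "c w \<in> V"
    using cw by (auto simp: V_def componentsI)
  have cont: "continuous_on W c"
    using WG G_step(1) by (intro holomorphic_on_imp_continuous_on holomorphic_on_c) auto
  have sub: "c ` W \<subseteq> V"
    by (rule component_G_eqI[OF V(1)])
      (use WG cont V w in \<open>auto intro: connected_continuous_image G_step\<close>)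
  have fW: "f ` Fin ` W = Fin ` c ` W"
    unfolding image_image using WG G_step(3) by (intro image_cong) auto
  have "open (Fin ` c ` W)"
    using open_image_f[OF open_Fin_image[OF WG(4)]] by (simp add: fW)
  have "V \<subseteq> c ` W"
  proof (rule ccontr)
    assume "\<not> V \<subseteq> c ` W"
    then have "Fin ` V \<inter> frontier (Fin ` c ` W) \<noteq> {}"
      using V w in_components_connected[OF V(1)] 
      by (intro connected_Int_frontier) (auto simp: connected_Fin_image_iff)
    then obtain v where v: "v \<in> V" "Fin v \<in> closure (Fin ` c ` W)" "v \<notin> c ` W"
      using \<open>open (Fin ` c ` W)\<close> by (auto simp: frontier_def interior_open)
    have "compact (f ` closure (Fin ` W))"
      using compact_Int_closed[OF compact_rsphere closed_closure]
      by (intro compact_continuous_image continuous_on_f) simp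
    then have "closure (Fin ` c ` W) \<subseteq> f ` closure (Fin ` W)"
      unfolding fW[symmetric] by (intro closure_minimal image_mono closure_subset compact_imp_closed)
    then obtain x where x: "x \<in> closure (Fin ` W)" "Fin v = f x"
      using v by blast
    have "f x \<notin> closure backward_orbit"
      using v V(1) component_G_subset x by (force simp: G_def)
    then have "x \<in> Fin ` G"
      by (simp add: Fin_G)
    then obtain u where u: "x = Fin u" "u \<in> G" by blast
    define V' where "V' = connected_component_set G u"
    have V': "V' \<in> components G" "u \<in> V'" "open V'"
      using u by (auto simp: V'_def componentsI intro: open_component_G)
    have "Fin ` V' \<inter> Fin ` W \<noteq> {}"
      using x(1) u V' open_Fin_image[of V'] open_Int_closure_eq_empty[of "Fin ` V'" "Fin ` W"] by blast
    then have "V' = W"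
      using V'(1) W components_nonoverlap by blast
    then have "v \<in> c ` W"
      using x(2) u V' G_step(3) by auto
    then show False using v by simp
  qed
  then show ?thesis
    using sub V by auto
qed

lemma funpow_component:
  assumes W: "W \<in> components G" shows "(c ^^ n) ` W \<in> components G"
proof (induction n)
  case (Suc n)
  then show ?case
    using Fatou_component_image[OF Suc] by (simp add: image_comp)
qed (simp add: W)

lemma funpow_f_image: "W \<subseteq> G \<Longrightarrow> (f ^^ n) ` Fin ` W = Fin ` (c ^^ n) ` W"
  unfolding image_image by (intro image_cong) (auto simp: funpow_f_G)

end

section \<open>Limits of iterates on components meeting the real line\<close>

lemma funpow_funpow: "(g ^^ i) ((g ^^ j) z) = (g ^^ (i + j)) z"
  by (simp add: funpow_add)

context rational_repelling_infinity
begin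

text \<open>By the identity theorem \<open>f ^^ M\<close> would be the identity off the finite set
  \<open>E M\<close>. Approaching a pole \<open>p\<close>, the values would tend both to
  \<open>p\<close> and to \<open>Infty\<close>.\<close>

lemma funpow_f_not_identity:
  assumes M: "M > 0" and q: "q islimpt S" "q \<notin> E M" and id: "\<And>z. z \<in> S \<Longrightarrow> (f ^^ M) (Fin z) = Fin z"
  shows False
proof -
  have S: "z \<notin> E M" "(c ^^ M) z = z" if "z \<in> S" for z
    using id[OF that] E_iff[of z M] funpow_f_E[of z M] by auto
  have eq: "(c ^^ M) z - z = 0" if "z \<notin> E M" for z
  proof (rule analytic_continuation[of "\<lambda>z. (c ^^ M) z - z" "- E M" S q])
    show "(\<lambda>z. (c ^^ M) z - z) holomorphic_on - E M"
      by (intro holomorphic_intros holomorphic_on_funpow_c) auto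
  qed (use S q that in \<open>auto simp: open_Compl_E connected_Compl_E\<close>)
  obtain p where p: "poly D p = 0"
    using two_poles by blast
  then have "p \<in> E M"
    using M by (auto simp: E_def intro!: exI[of _ 0])
  then have fp: "(f ^^ M) (Fin p) = Infty"
    by (simp add: E_iff)
  have "((\<lambda>z. (f ^^ M) (Fin z)) \<longlongrightarrow> (f ^^ M) (Fin p)) (at p)"
    by (intro continuous_on_tendsto_compose[OF continuous_on_funpow_f[of UNIV M]] tendsto_intros) auto
  moreover have "\<forall>\<^sub>F z in at p. (f ^^ M) (Fin z) = Fin z"
  proof -
    have "open (- (E M - {p}))"
      by (intro open_Compl finite_imp_closed finite_Diff finite_E)
    then have "\<forall>\<^sub>F z in at p. z \<in> - (E M - {p})"
      by (intro eventually_at_in_open') auto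
    moreover have "\<forall>\<^sub>F z in at p. z \<noteq> p"
      by (simp add: eventually_at_filter)
    ultimately show ?thesis
    proof eventually_elim
      case (elim z)
      then have "z \<notin> E M" by auto
      then show ?case using eq[of z] funpow_f_E by simp
    qed
  qed
  ultimately have "((\<lambda>z. Fin z) \<longlongrightarrow> Infty) (at p)"
    using fp by (simp add: tendsto_cong)
  moreover have "((\<lambda>z. Fin z) \<longlongrightarrow> Fin p) (at p)"
    by (intro tendsto_intros)
  ultimately show False
    using tendsto_unique[of "at p" "\<lambda>z. Fin z" Infty "Fin p"] by simp
qed

text \<open>The times \<open>m j\<close> are differences of the original iteration times \<open>n j\<close>.\<close>

lemma nonconstant_limit_imp_identity_limit:
  assumes W: "W \<in> components G" and n: "strict_mono n" and h: "h holomorphic_on W"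
    and lim: "loc_unif_limit W (\<lambda>j. c ^^ n j) h" and nc: "\<not> h constant_on W" and x: "x \<in> W"
  obtains V m i where "V \<in> components G" "(c ^^ i) x \<in> V" "\<And>j. j \<le> m j"
    "loc_unif_limit V (\<lambda>j. c ^^ m j) (\<lambda>z. z)"
proof -
  have WG: "W \<subseteq> G" "connected W" "open W"
    using W in_components_connected open_component_G component_G_subset by auto
  \<comment> \<open>By Hurwitz a value of a non-constant limit is attained by an iterate, so
    \<open>h x\<close> is a Fatou point and not merely a limit of such points.\<close>
  have hit: "\<exists>j. \<exists>z\<in>W. (c ^^ n j) z = h x"
  proof (rule ccontr)
    assume "\<not> ?thesis"
    then have nz: "(c ^^ n j) z - h x \<noteq> 0" if "z \<in> W" for z j
      using that by auto
    have "\<not> (\<lambda>z. h z - h x) constant_on W"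
      using nc by (auto simp: constant_on_def) (metis diff_add_cancel)
    have "h x - h x \<noteq> 0"
    proof (rule Hurwitz_no_zeros[OF WG(3,2) _ _ _ \<open>\<not> (\<lambda>z. h z - h x) constant_on W\<close> _ x])
      show "(\<lambda>z. (c ^^ n j) z - h x) holomorphic_on W" for j
        by (intro holomorphic_intros holomorphic_on_funpow_c_G WG)
      show "(\<lambda>z. h z - h x) holomorphic_on W"
        by (intro holomorphic_intros h)
      show "uniform_limit K (\<lambda>j z. (c ^^ n j) z - h x) (\<lambda>z. h z - h x) sequentially"
        if "compact K" "K \<subseteq> W" for K
        using lim that by (intro uniform_limit_intros) (simp add: loc_unif_limit_def)
    qed (use nz in auto)
    then show False by simp
  qed
  then have hxG: "h x \<in> G"
    using WG(1) funpow_c_G by (metis subsetD)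
  define V where "V = connected_component_set G (h x)"
  have V: "V \<in> components G" "h x \<in> V"
    using hxG by (auto simp: V_def componentsI)
  have VG: "V \<subseteq> G" "connected V" "open V"
    using V in_components_connected open_component_G component_G_subset by auto
  have "(\<lambda>j. (c ^^ n j) x) \<longlonglongrightarrow> h x"
    by (rule loc_unif_limit_tendsto[OF lim x])
  then have "\<forall>\<^sub>F j in sequentially. (c ^^ n j) x \<in> V"
    using V VG(3) by (rule_tac topological_tendstoD)
  then obtain J where J: "\<And>j. j \<ge> J \<Longrightarrow> (c ^^ n j) x \<in> V"
    by (auto simp: eventually_sequentially)
  have n_le: "n (j + J) + j \<le> n (2 * j + J)" for j
  proof -
    have "n (j + J) + i \<le> n (j + J + i)" for i
    proof (induction i)
      case (Suc i)
      then show ?case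
        using strict_monoD[OF n, of "j + J + i" "j + J + Suc i"] by simp
    qed simp
    from this[of j] show ?thesis by (simp add: mult_2 add.assoc add.commute[of J])
  qed
  \<comment> \<open>Both \<open>n (2 * j + J)\<close> and \<open>n (j + J)\<close> run along
    \<open>n\<close>, and they differ by at least \<open>j\<close>, so the differences grow beyond
    all bounds.\<close>
  define m where "m j = n (2 * j + J) - n (j + J)" for j
  have m: "j \<le> m j" for j
    using n_le[of j] by (simp add: m_def)
  have m_add: "(c ^^ m j) ((c ^^ n (j + J)) z) = (c ^^ n (2 * j + J)) z" for j z
    using n_le[of j] by (simp add: funpow_funpow m_def)
  obtain r where r: "strict_mono (r :: nat \<Rightarrow> nat)" and alt: "(\<exists>g. g holomorphic_on V \<and>
        loc_unif_limit V (\<lambda>j. c ^^ m (r j)) g) \<or> loc_unif_infinity V (\<lambda>j. c ^^ m (r j))"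
    by (rule normal_G[OF VG(3,2,1)])
  define T where "T = h -` V \<inter> W"
  have T: "open T" "x \<in> T" "T \<subseteq> W"
    using continuous_open_preimage[OF holomorphic_on_imp_continuous_on[OF h] WG(3) VG(3)] x V
    by (auto simp: T_def Int_commute)
  have sub: "(\<lambda>j. (c ^^ n (r j + J)) z) \<longlonglongrightarrow> h z" "(\<lambda>j. (c ^^ n (2 * r j + J)) z) \<longlonglongrightarrow> h z" if "z \<in> T" for z
  proof -
    have *: "(\<lambda>j. (c ^^ n j) z) \<longlonglongrightarrow> h z"
      using that T by (intro loc_unif_limit_tendsto[OF lim]) auto
    show "(\<lambda>j. (c ^^ n (r j + J)) z) \<longlonglongrightarrow> h z"
      using LIMSEQ_subseq_LIMSEQ[OF *, of "\<lambda>j. r j + J"] r by (simp add: o_def strict_mono_def)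
    show "(\<lambda>j. (c ^^ n (2 * r j + J)) z) \<longlonglongrightarrow> h z"
      using LIMSEQ_subseq_LIMSEQ[OF *, of "\<lambda>j. 2 * r j + J"] r by (simp add: o_def strict_mono_def)
  qed
  from alt obtain g where g: "g holomorphic_on V" "loc_unif_limit V (\<lambda>j. c ^^ m (r j)) g"
  proof
    assume inf: "loc_unif_infinity V (\<lambda>j. c ^^ m (r j))"
    have "filterlim (\<lambda>j. (c ^^ m (r j)) ((c ^^ n (r j + J)) x)) at_infinity sequentially"
      by (rule loc_unif_infinity_filterlim[OF VG(3) inf V(2) sub(1)[OF T(2)]])
    then have "filterlim (\<lambda>j. (c ^^ n (2 * r j + J)) x) at_infinity sequentially"
      by (simp add: m_add)
    then show thesis
      using sub(2)[OF T(2)] not_tendsto_and_filterlim_at_infinity sequentially_bot by blast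
  qed blast
  \<comment> \<open>In the limit \<open>m_add\<close> says that \<open>g\<close> fixes
    \<open>h z\<close>. Since \<open>h\<close> is open, these points fill an open set, and
    \<open>g\<close> is the identity on \<open>V\<close>.\<close>
  have gh: "g (h z) - h z = 0" if "z \<in> T" for z
  proof -
    have "(\<lambda>j. (c ^^ m (r j)) ((c ^^ n (r j + J)) z)) \<longlonglongrightarrow> g (h z)"
      using that by (intro loc_unif_limit_continuous_tendsto[OF VG(3) holomorphic_on_imp_continuous_on[OF g(1)] g(2) _ sub(1)])
        (auto simp: T_def)
    then have "(\<lambda>j. (c ^^ n (2 * r j + J)) z) \<longlonglongrightarrow> g (h z)"
      by (simp add: m_add)
    then have "g (h z) = h z"
      using sub(2)[OF that] by (rule LIMSEQ_unique)
    then show ?thesis by simp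
  qed
  have "open (h ` T)"
    by (rule open_mapping_thm[OF h WG(3,2) T(1,3) nc])
  then have "h x islimpt h ` T"
    using T by (intro interior_limit_point) (auto simp: interior_open)
  have g_id: "g z = z" if "z \<in> V" for z
  proof -
    have "g z - z = 0"
      by (rule analytic_continuation[of "\<lambda>z. g z - z" V "h ` T" "h x"])
        (use VG V g that gh \<open>h x islimpt h ` T\<close> in \<open>auto intro!: holomorphic_intros simp: T_def\<close>)
    then show ?thesis by simp
  qed
  have "loc_unif_limit V (\<lambda>j. c ^^ m (r j)) (\<lambda>z. z)"
    using g(2) g_id unfolding loc_unif_limit_def uniform_limit_iff by (auto simp: subset_iff)
  moreover have "j \<le> m (r j)" for j
    using m[of "r j"] seq_suble[OF r, of j] by simp
  ultimately show thesis
    using J[of J] by (intro that[OF V(1), of "n J" "\<lambda>j. m (r j)"]) auto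
qed

text \<open>Two points with a common image after \<open>i\<close> steps share all later images,
  hence also their limits, which are the points themselves.\<close>

lemma identity_limit_imp_inj_on:
  assumes V: "V \<in> components G" and m: "\<And>j. j \<le> m j"
    and lim: "loc_unif_limit V (\<lambda>j. c ^^ m j) (\<lambda>z. z)"
  shows "inj_on (c ^^ i) V"
proof (rule inj_onI)
  fix u v assume uv: "u \<in> V" "v \<in> V" "(c ^^ i) u = (c ^^ i) v"
  have "\<forall>\<^sub>F j in sequentially. (c ^^ m j) u = (c ^^ m j) v"
    using eventually_ge_at_top[of i]
  proof eventually_elim
    case (elim j)
    then have "(c ^^ m j) z = (c ^^ (m j - i)) ((c ^^ i) z)" for z
      using m[of j] by (simp add: funpow_funpow)
    then show ?case using uv by simp
  qed
  then show "u = v"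
    using loc_unif_limit_tendsto[OF lim uv(1)] loc_unif_limit_tendsto[OF lim uv(2)] LIMSEQ_unique
    by (auto simp: tendsto_cong)
qed

text \<open>Applied with \<open>i = 2 * M\<close>: the return times become multiples of
  \<open>2 * M\<close>, so points are recurrent under the square of \<open>c ^^ M\<close>.\<close>

lemma identity_limit_funpow:
  assumes V: "V \<in> components G" and lim: "loc_unif_limit V (\<lambda>j. c ^^ m j) (\<lambda>z. z)" and z: "z \<in> V"
  shows "(\<lambda>j. (c ^^ (i * m j)) z) \<longlonglongrightarrow> z"
proof (induction i)
  case (Suc i)
  have "(\<lambda>j. (c ^^ m j) ((c ^^ (i * m j)) z)) \<longlonglongrightarrow> z"
    by (rule loc_unif_limit_continuous_tendsto[OF open_component_G[OF V] _ lim z Suc]) (intro continuous_intros)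
  then show ?case by (simp add: funpow_add)
qed simp

end

locale real_rational_repelling_infinity = rational_repelling_infinity +
  assumes real_c: "z \<in> \<real> \<Longrightarrow> c z \<in> \<real>"
begin

lemma funpow_c_real: "z \<in> \<real> \<Longrightarrow> (c ^^ n) z \<in> \<real>"
  by (induction n) (auto simp: real_c)

text \<open>An increasing self-map of an interval all of whose points are recurrent is the identity; this is
  applied to the square of an iterate close to the identity.\<close>

lemma no_identity_limit:
  assumes V: "V \<in> components G" and y: "of_real y \<in> V" and m: "\<And>j. j \<le> m j"
    and lim: "loc_unif_limit V (\<lambda>j. c ^^ m j) (\<lambda>z. z)"
  shows False
proof -
  have VG: "V \<subseteq> G" "open V"
    using V open_component_G component_G_subset by auto
  define X where "X = {t::real. of_real t \<in> V}"
  have "X = of_real -` V" by (auto simp: X_def)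
  then have "open X"
    using VG(2) by (simp add: open_vimage continuous_on_of_real_id)
  define I where "I = connected_component_set X y"
  have I: "open I" "y \<in> I" "I \<subseteq> X" "connected I"
    using y open_connected_component[OF \<open>open X\<close>] by (auto simp: I_def X_def connected_component_subset)
  have lim_y: "(\<lambda>j. (c ^^ m j) (of_real y)) \<longlonglongrightarrow> of_real y"
    by (rule loc_unif_limit_tendsto[OF lim y])
  then have "(\<lambda>j. Re ((c ^^ m j) (of_real y))) \<longlonglongrightarrow> y"
    using tendsto_Re[OF lim_y] by simp
  then have "\<forall>\<^sub>F j in sequentially. Re ((c ^^ m j) (of_real y)) \<in> I"
    using I by (rule_tac topological_tendstoD)
  moreover have "\<forall>\<^sub>F j in sequentially. (c ^^ m j) (of_real y) \<in> V"
    using lim_y y VG by (rule_tac topological_tendstoD)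
  moreover have "\<forall>\<^sub>F j in sequentially. j \<ge> 1"
    by (rule eventually_ge_at_top)
  ultimately have "\<forall>\<^sub>F j in sequentially. Re ((c ^^ m j) (of_real y)) \<in> I \<and> (c ^^ m j) (of_real y) \<in> V \<and> m j \<ge> 1"
    by eventually_elim (use m order_trans in blast)
  then obtain j where j: "Re ((c ^^ m j) (of_real y)) \<in> I" "(c ^^ m j) (of_real y) \<in> V" "m j \<ge> 1"
    using eventually_happens'[OF sequentially_bot] by blast
  \<comment> \<open>\<open>j\<close> is so late that \<open>c ^^ M\<close> brings \<open>y\<close>
    back into \<open>V\<close> and into \<open>I\<close>. Both are maximal connected sets, so the
    iterate maps each of them into itself.\<close>
  define M where "M = m j"
  define \<phi> where "\<phi> t = Re ((c ^^ M) (of_real t))" for t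
  have \<phi>: "of_real (\<phi> t) = (c ^^ M) (of_real t)" for t
    using funpow_c_real[of "of_real t" M] by (simp add: \<phi>_def)
  have c_V: "(c ^^ M) ` V \<subseteq> V"
    using component_G_eqI[OF V, of "(c ^^ M) ` V"] funpow_component[OF V, of M] y j(2)
    by (auto simp: M_def in_components_connected component_G_subset)
  have cont: "continuous_on I \<phi>"
    proof -
    have "continuous_on V (c ^^ M)"
      using VG by (intro holomorphic_on_imp_continuous_on holomorphic_on_funpow_c_G)
    then have "continuous_on I (\<lambda>t. (c ^^ M) (of_real t))"
      by (rule continuous_on_compose2) (use I in \<open>auto simp: X_def intro: continuous_on_of_real_id\<close>)
    then show ?thesis
      unfolding \<phi>_def by (rule continuous_on_Re)
  qed
  have \<phi>_I: "\<phi> ` I \<subseteq> I"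
  proof -
    have "\<phi> ` I \<subseteq> X"
      using image_subset_iff[THEN iffD1, OF c_V] I(3) by (auto simp: X_def \<phi> subset_iff)
    moreover have "\<phi> y \<in> \<phi> ` I" "\<phi> y \<in> I"
      using I j by (auto simp: \<phi>_def M_def)
    moreover have "connected (\<phi> ` I)"
      by (rule connected_continuous_image[OF cont I(4)])
    ultimately show ?thesis
      unfolding I_def by (metis connected_component_maximal connected_component_eq)
  qed
  have inj: "inj_on \<phi> I"
  proof (rule inj_onI)
    fix s t assume st: "s \<in> I" "t \<in> I" "\<phi> s = \<phi> t"
    then have "(c ^^ M) (of_real s) = (c ^^ M) (of_real t)"
      using \<phi> by metis
    moreover have "of_real s \<in> V" "of_real t \<in> V"
      using st I(3) by (auto simp: X_def)
    ultimately have "complex_of_real s = of_real t"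
      using inj_onD[OF identity_limit_imp_inj_on[OF V m lim, of M]] by blast
    then show "s = t" by simp
  qed
  have "is_interval I"
    using I(4) by (simp add: is_interval_connected_1)
  then have mono: "strict_mono_on I \<phi> \<or> strict_antimono_on I \<phi>"
    using injective_eq_monotone_map cont inj by blast
  \<comment> \<open>Whichever way \<open>\<phi>\<close> is monotone, its square is
    increasing.\<close>
  define \<psi> where "\<psi> t = \<phi> (\<phi> t)" for t
  have \<psi>_I: "\<psi> t \<in> I" if "t \<in> I" for t
    using \<phi>_I that by (auto simp: \<psi>_def)
  have \<psi>_mono: "\<psi> s \<le> \<psi> t" if "s \<in> I" "t \<in> I" "s \<le> t" for s t
  proof (cases "s = t")
    case False
    then have "s < t" using that by simp
    moreover have "\<phi> s \<in> I" "\<phi> t \<in> I"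
      using \<phi>_I that by auto
    ultimately show ?thesis
      using mono that unfolding \<psi>_def monotone_on_def by (metis less_imp_le)
  qed simp
  have \<psi>_pow: "of_real ((\<psi> ^^ i) t) = (c ^^ (2 * M * i)) (of_real t)" for i t
  proof (induction i)
    case (Suc i)
    have "of_real ((\<psi> ^^ Suc i) t) = (c ^^ M) ((c ^^ M) (of_real ((\<psi> ^^ i) t)))"
      by (simp add: \<psi>_def \<phi>)
    also have "\<dots> = (c ^^ (2 * M * Suc i)) (of_real t)"
      unfolding Suc by (simp add: mult_2 funpow_add)
    finally show ?case .
  qed simp
  have \<psi>_id: "\<psi> t = t" if t: "t \<in> I" for t
  proof -
    have "(\<lambda>j. (c ^^ (2 * M * m j)) (of_real t)) \<longlonglongrightarrow> of_real t"
      by (rule identity_limit_funpow[OF V lim]) (use t I X_def in auto)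
    then have "(\<lambda>j. complex_of_real ((\<psi> ^^ m j) t)) \<longlonglongrightarrow> of_real t"
      by (simp add: \<psi>_pow)
    then have lim_t: "(\<lambda>j. (\<psi> ^^ m j) t) \<longlonglongrightarrow> t"
      using tendsto_of_real_iff by blast
    have pow_I: "(\<psi> ^^ i) t \<in> I" for i
      by (induction i) (auto simp: t \<psi>_I)
    have m1: "\<forall>\<^sub>F j in sequentially. 1 \<le> m j"
      using eventually_ge_at_top[of 1] by eventually_elim (use m order_trans in blast)
    show ?thesis
    proof (rule antisym; rule ccontr)
      assume "\<not> \<psi> t \<le> t"
      then have gt: "t < \<psi> t" by simp
      \<comment> \<open>If \<open>t\<close> moves up in the first step, monotonicity keeps all later
        iterates at or above \<open>\<psi> t\<close>, and \<open>t\<close> is not recurrent.\<close>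
      have *: "\<psi> t \<le> (\<psi> ^^ Suc i) t" for i
      proof (induction i)
        case (Suc i)
        then have "\<psi> t \<le> \<psi> ((\<psi> ^^ Suc i) t)"
          using gt pow_I[of "Suc i"] t by (intro \<psi>_mono) auto
        then show ?case by simp
      qed simp
      have "\<forall>\<^sub>F j in sequentially. \<psi> t \<le> (\<psi> ^^ m j) t"
        using m1
      proof eventually_elim
        case (elim j)
        then show ?case using *[of "m j - 1"] by (cases "m j") auto
      qed
      then have "\<psi> t \<le> t"
        by (rule tendsto_lowerbound[OF lim_t]) simp
      then show False using gt by simp
    next
      assume "\<not> t \<le> \<psi> t"
      then have gt: "\<psi> t < t" by simp
      have *: "(\<psi> ^^ Suc i) t \<le> \<psi> t" for i
      proof (induction i)
        case (Suc i)
        then have "\<psi> ((\<psi> ^^ Suc i) t) \<le> \<psi> t"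
          using gt pow_I[of "Suc i"] t by (intro \<psi>_mono) auto
        then show ?case by simp
      qed simp
      have "\<forall>\<^sub>F j in sequentially. (\<psi> ^^ m j) t \<le> \<psi> t"
        using m1
      proof eventually_elim
        case (elim j)
        then show ?case using *[of "m j - 1"] by (cases "m j") auto
      qed
      then have "t \<le> \<psi> t"
        by (rule tendsto_upperbound[OF lim_t]) simp
      then show False using gt by simp
    qed
  qed
  have "y islimpt I"
    using I by (intro interior_limit_point) (simp add: interior_open)
  then have "of_real y islimpt (of_real ` I :: complex set)"
    unfolding islimpt_approachable by (fastforce simp: dist_of_real)
  then show False
  proof (rule funpow_f_not_identity[of "2 * M", rotated])
    show "0 < 2 * M" using j by (simp add: M_def)
    show "of_real y \<notin> E (2 * M)"
      using y VG G_disjoint_E by blast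
    fix z :: complex assume "z \<in> of_real ` I"
    then obtain t where t: "t \<in> I" "z = of_real t" by auto
    then have "z \<in> G" using I VG by (auto simp: X_def)
    then show "(f ^^ (2 * M)) (Fin z) = Fin z"
      using \<psi>_pow[of 1 t] \<psi>_id[OF t(1)] t(2) by (simp add: funpow_f_G)
  qed
qed

lemma limit_constant:
  assumes W: "W \<in> components G" and x: "x \<in> W" "x \<in> \<real>" and n: "strict_mono n" and h: "h holomorphic_on W"
    and lim: "loc_unif_limit W (\<lambda>j. c ^^ n j) h"
  shows "h constant_on W"
proof (rule ccontr)
  assume nc: "\<not> h constant_on W"
  obtain V m i where V: "V \<in> components G" "(c ^^ i) x \<in> V" and m: "\<And>j. j \<le> m j"
    "loc_unif_limit V (\<lambda>j. c ^^ m j) (\<lambda>z. z)"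
    by (rule nonconstant_limit_imp_identity_limit[OF W n h lim nc x(1)]) (rule that)
  obtain y where "(c ^^ i) x = of_real y"
    using funpow_c_real[OF x(2)] Reals_cases by metis
  then show False
    using no_identity_limit[OF V(1) _ m] V(2) by auto
qed

end

section \<open>Orbits near infinity and isolation of fixed points\<close>

lemma closed_insert_Infty:
  assumes "closed A" shows "closed (insert Infty (Fin ` A))"
proof -
  have "x \<in> insert Infty (Fin ` A) \<longleftrightarrow> x \<in> - Fin ` (- A)" for x
    by (cases x) auto
  then have "insert Infty (Fin ` A) = - Fin ` (- A)"
    by blast
  moreover have "open (Fin ` (- A))"
    using assms by (intro open_Fin_image) (rule open_Compl)
  ultimately show ?thesis
    by (metis closed_Compl)
qed

context rational_repelling_infinity
begin

lemma orbit_leaves_exterior: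
  assumes R: "R > 0" "0 < \<mu>" "\<mu> < 1" "\<And>z. R \<le> cmod z \<Longrightarrow> poly D z \<noteq> 0 \<and> cmod (c z) \<le> \<mu> * cmod z"
  shows "\<exists>n\<ge>m. cmod ((c ^^ n) z) < R"
proof (rule ccontr)
  assume "\<not> ?thesis"
  then have ge: "R \<le> cmod ((c ^^ n) z)" if "n \<ge> m" for n
    using that not_less by blast
  have le: "cmod ((c ^^ (m + k)) z) \<le> \<mu> ^ k * cmod ((c ^^ m) z)" for k
  proof (induction k)
    case (Suc k)
    have "cmod ((c ^^ (m + Suc k)) z) \<le> \<mu> * cmod ((c ^^ (m + k)) z)"
      using R(4)[OF ge[of "m + k"]] by simp
    also have "\<dots> \<le> \<mu> * (\<mu> ^ k * cmod ((c ^^ m) z))"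
      using Suc R by (intro mult_left_mono) auto
    finally show ?case by simp
  qed simp
  have "(\<lambda>k. \<mu> ^ k * cmod ((c ^^ m) z)) \<longlonglongrightarrow> 0 * cmod ((c ^^ m) z)"
    using R by (intro tendsto_mult LIMSEQ_realpow_zero) auto
  then have "\<forall>\<^sub>F k in sequentially. \<mu> ^ k * cmod ((c ^^ m) z) < R"
    using R(1) by (intro order_tendstoD(2)) auto
  then obtain k where "\<mu> ^ k * cmod ((c ^^ m) z) < R"
    using eventually_happens'[OF sequentially_bot] by blast
  then show False
    using ge[of "m + k"] le[of k] by simp
qed

text \<open>Isolates \<open>Infty\<close> among the fixed points of \<open>f ^^ p\<close>, and
  excludes it as a limit of every \<open>p\<close>-th iterate of a Fatou point.\<close>

lemma near_infinity_periodic: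
  assumes p: "p > 0"
  shows "\<exists>U. open U \<and> Infty \<in> U \<and> (\<forall>y\<in>U. (f ^^ p) y = y \<longrightarrow> y = Infty) \<and>
    (\<forall>z\<in>G. \<not> (\<forall>\<^sub>F k in sequentially. (f ^^ (k * p)) (Fin z) \<in> U))"
proof -
  obtain R \<mu> where R: "R > 0" "0 < \<mu>" "\<mu> < 1" "\<And>z. R \<le> cmod z \<Longrightarrow> poly D z \<noteq> 0 \<and> cmod (c z) \<le> \<mu> * cmod z"
    by (rule near_infinity) (rule that)
  \<comment> \<open>The first \<open>p\<close> images of a point of \<open>U\<close> lie in
    \<open>exterior R\<close>, so control at multiples of \<open>p\<close> becomes control at all
    times, against \<open>orbit_leaves_exterior\<close>.\<close>
  define U where "U = (\<Inter>n\<in>{..<p}. (f ^^ n) -` exterior R) \<inter> exterior R"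
  have "open U"
    unfolding U_def by (intro open_Int open_INT finite_lessThan ballI open_vimage open_exterior continuous_on_funpow_f R)
  moreover have "Infty \<in> U"
    by (auto simp: U_def exterior_def)
  moreover have "y = Infty" if y: "y \<in> U" "(f ^^ p) y = y" for y
  proof (rule ccontr)
    assume "y \<noteq> Infty"
    then obtain z where z: "y = Fin z" by (cases y) auto
    have per: "(f ^^ (k * p)) y = y" for k
      by (induction k) (simp_all add: funpow_add y)
    have ext: "(f ^^ n) y \<in> exterior R" for n
    proof -
      have "(f ^^ n) y = (f ^^ (n mod p)) ((f ^^ (n div p * p)) y)"
        by (simp add: funpow_funpow)
      also have "\<dots> \<in> exterior R"
        using y p by (auto simp: per U_def)
      finally show ?thesis .
    qed
    have "z \<notin> E n" for n
    proof
      assume "z \<in> E n"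
      then have "z \<in> E (n * p)"
        using E_mono[of n "n * p"] p by auto
      then show False
        using per[of n] by (simp add: E_iff z)
    qed
    then have "cmod ((c ^^ n) z) > R" for n
      using ext[of n] funpow_f_E[of z n] by (auto simp: z exterior_def)
    then show False
      using orbit_leaves_exterior[OF R, of 0 z] by (meson less_asym)
  qed
  moreover have "\<not> (\<forall>\<^sub>F k in sequentially. (f ^^ (k * p)) (Fin z) \<in> U)" if z: "z \<in> G" for z
  proof
    assume "\<forall>\<^sub>F k in sequentially. (f ^^ (k * p)) (Fin z) \<in> U"
    then obtain K where K: "\<And>k. k \<ge> K \<Longrightarrow> (f ^^ (k * p)) (Fin z) \<in> U"
      by (auto simp: eventually_sequentially)
    have "R < cmod ((c ^^ n) z)" if n: "n \<ge> K * p" for n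
    proof -
      have "n div p \<ge> K"
        using n p by (metis div_le_mono div_mult_self_is_m)
      then have "(f ^^ (n mod p)) ((f ^^ (n div p * p)) (Fin z)) \<in> exterior R"
        using K p by (auto simp: U_def)
      moreover have "(f ^^ (n mod p)) ((f ^^ (n div p * p)) (Fin z)) = Fin ((c ^^ n) z)"
        using funpow_f_G[OF z, of n] by (simp only: funpow_funpow mod_div_mult_eq)
      ultimately have "Fin ((c ^^ n) z) \<in> exterior R"
        by simp
      then show ?thesis
        by (auto simp: exterior_def)
    qed
    then show False
      using orbit_leaves_exterior[OF R, of "K * p" z] by (meson less_asym)
  qed
  ultimately show ?thesis
    by (intro exI[of _ U]) simp
qed

text \<open>At a finite point, accumulating fixed points would make \<open>f ^^ p\<close> the
  identity; at infinity the repelling neighbourhood contains no other fixed point.\<close>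

lemma fixed_point_isolated:
  assumes "p > 0" "(f ^^ p) q = q"
  shows "\<not> q islimpt {y. (f ^^ p) y = y}"
proof
  assume lp: "q islimpt {y. (f ^^ p) y = y}"
  show False
  proof (cases q)
    case (Fin \<zeta>)
    have "\<zeta> islimpt {z. (f ^^ p) (Fin z) = Fin z}"
      unfolding islimpt_def
    proof (intro allI impI)
      fix T assume "\<zeta> \<in> T" "open T"
      then have "q \<in> Fin ` T" "open (Fin ` T)"
        by (auto simp: Fin open_Fin_image)
      then obtain y where "y \<in> {y. (f ^^ p) y = y}" "y \<in> Fin ` T" "y \<noteq> q"
        using lp unfolding islimpt_def by blast
      then show "\<exists>y\<in>{z. (f ^^ p) (Fin z) = Fin z}. y \<in> T \<and> y \<noteq> \<zeta>"
        by (auto simp: Fin)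
    qed
    moreover have "\<zeta> \<notin> E p"
      using assms(2) by (simp add: Fin E_iff)
    ultimately show False
      by (rule funpow_f_not_identity[OF assms(1)]) auto
  next
    case Infty
    obtain U where U: "open U" "Infty \<in> U" "\<forall>y\<in>U. (f ^^ p) y = y \<longrightarrow> y = Infty"
      using near_infinity_periodic[OF assms(1)] by auto
    then obtain y where "y \<in> {y. (f ^^ p) y = y}" "y \<in> U" "y \<noteq> Infty"
      using lp unfolding Infty by (auto elim: islimptE)
    then show False
      using U(3) by auto
  qed
qed

end

section \<open>Convergence of orbits on components with real points\<close>

context real_rational_repelling_infinity
begin

lemma subsequence_limit_constant:
  assumes W: "W \<in> components G" and x: "x \<in> W" "x \<in> \<real>" and n: "strict_mono n"
  obtains r q where "strict_mono (r :: nat \<Rightarrow> nat)" "\<And>z. z \<in> W \<Longrightarrow> (\<lambda>j. (f ^^ n (r j)) (Fin z)) \<longlonglongrightarrow> q"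
proof -
  have WG: "W \<subseteq> G" "connected W" "open W"
    using W in_components_connected open_component_G component_G_subset by auto
  obtain r where r: "strict_mono (r :: nat \<Rightarrow> nat)" and alt: "(\<exists>h. h holomorphic_on W \<and>
        loc_unif_limit W (\<lambda>j. c ^^ n (r j)) h) \<or> loc_unif_infinity W (\<lambda>j. c ^^ n (r j))"
    by (rule normal_G[OF WG(3,2,1)])
  have fc: "(f ^^ m) (Fin z) = Fin ((c ^^ m) z)" if "z \<in> W" for z m
    using that WG funpow_f_G by blast
  from alt show thesis
  proof
    assume "\<exists>h. h holomorphic_on W \<and> loc_unif_limit W (\<lambda>j. c ^^ n (r j)) h"
    then obtain h where h: "h holomorphic_on W" "loc_unif_limit W (\<lambda>j. c ^^ n (r j)) h" by blast
    have "h constant_on W"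
      by (rule limit_constant[OF W x _ h(1), of "\<lambda>j. n (r j)"])
        (use h(2) strict_mono_o[OF n r] in \<open>simp_all add: o_def\<close>)
    then obtain w where w: "\<And>z. z \<in> W \<Longrightarrow> h z = w"
      by (auto simp: constant_on_def)
    show thesis
    proof (rule that[OF r])
      fix z assume z: "z \<in> W"
      then show "(\<lambda>j. (f ^^ n (r j)) (Fin z)) \<longlonglongrightarrow> Fin w"
        using loc_unif_limit_tendsto[OF h(2) z] w[OF z] by (simp add: fc tendsto_Fin_iff)
    qed
  next
    assume inf: "loc_unif_infinity W (\<lambda>j. c ^^ n (r j))"
    show thesis
    proof (rule that[OF r])
      fix z assume z: "z \<in> W"
      then show "(\<lambda>j. (f ^^ n (r j)) (Fin z)) \<longlonglongrightarrow> Infty"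
        using loc_unif_infinity_filterlim[OF WG(3) inf z tendsto_const] by (simp add: fc tendsto_Infty_iff)
    qed
  qed
qed

lemma real_orbit_limit:
  assumes x: "x \<in> G" "x \<in> \<real>" and lim: "(\<lambda>j. (f ^^ n j) (Fin x)) \<longlonglongrightarrow> q"
  shows "q \<in> insert Infty (Fin ` \<real>)"
proof (rule Lim_in_closed_set[OF _ _ _ lim])
  show "closed (insert Infty (Fin ` \<real>))"
    by (intro closed_insert_Infty closed_complex_Reals)
  show "\<forall>\<^sub>F j in sequentially. (f ^^ n j) (Fin x) \<in> insert Infty (Fin ` \<real>)"
    using x by (intro always_eventually) (simp add: funpow_f_G funpow_c_real)
qed simp

text \<open>On such a component every limit of iterates would be constant with value in
  \<open>{0, \<infinity>}\<close>; but \<open>0\<close> is mapped to \<open>\<infinity>\<close>, and orbits cannot stay near the repelling point \<open>\<infinity>\<close>.\<close>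

lemma no_component_meets_both_axes:
  assumes W: "W \<in> components G" and x: "x \<in> W" "x \<in> \<real>" and y: "y \<in> W" "Re y = 0"
    and imag: "\<And>z. Re z = 0 \<Longrightarrow> Re (c z) = 0" and zero: "poly D 0 = 0"
  shows False
proof -
  have xyG: "x \<in> G" "y \<in> G"
    using W x y component_G_subset by auto
  have lim: "\<exists>r. strict_mono (r :: nat \<Rightarrow> nat) \<and> ((\<lambda>j. (f ^^ n (r j)) (Fin x)) \<longlonglongrightarrow> Fin 0 \<or> (\<lambda>j. (f ^^ n (r j)) (Fin x)) \<longlonglongrightarrow> Infty)"
    if n: "strict_mono n" for n
  proof -
    obtain r q where r: "strict_mono (r :: nat \<Rightarrow> nat)" and q: "\<And>z. z \<in> W \<Longrightarrow> (\<lambda>j. (f ^^ n (r j)) (Fin z)) \<longlonglongrightarrow> q"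
      by (rule subsequence_limit_constant[OF W x n]) (rule that)
    have "q \<in> insert Infty (Fin ` \<real>)"
      using real_orbit_limit[OF xyG(1) x(2) q[OF x(1)]] .
    moreover have "q \<in> insert Infty (Fin ` {z. Re z = 0})"
    proof (rule Lim_in_closed_set[OF _ _ _ q[OF y(1)]])
      show "closed (insert Infty (Fin ` {z. Re z = 0}))"
        by (intro closed_insert_Infty closed_Collect_eq continuous_intros)
      have "Re ((c ^^ m) y) = 0" for m
        by (induction m) (auto simp: y imag)
      then show "\<forall>\<^sub>F j in sequentially. (f ^^ n (r j)) (Fin y) \<in> insert Infty (Fin ` {z. Re z = 0})"
        using xyG by (intro always_eventually) (simp add: funpow_f_G)
    qed simp
    ultimately have "q = Fin 0 \<or> q = Infty"
      by (auto elim!: Reals_cases)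
    then show ?thesis
      using r q[OF x(1)] by blast
  qed
  obtain R \<mu> where R: "R > 0" "0 < \<mu>" "\<mu> < 1" "\<And>z. R \<le> cmod z \<Longrightarrow> poly D z \<noteq> 0 \<and> cmod (c z) \<le> \<mu> * cmod z"
    by (rule near_infinity) (rule that)
  have orbit: "(f ^^ n) (Fin x) = Fin ((c ^^ n) x)" for n
    using xyG by (simp add: funpow_f_G)
  have next_Infty: "(\<lambda>j. (f ^^ Suc (n j)) (Fin x)) \<longlonglongrightarrow> Infty"
    if "(\<lambda>j. (f ^^ n j) (Fin x)) \<longlonglongrightarrow> q" "f q = Infty" for n q
    using continuous_on_tendsto_compose[OF continuous_on_f[of UNIV] that(1)] that(2) by simp
  have not_Infty: False if "(\<lambda>j. (f ^^ n j) (Fin x)) \<longlonglongrightarrow> Infty" "\<And>j. cmod ((c ^^ n j) x) < R" for n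
  proof -
    have "filterlim (\<lambda>j. (c ^^ n j) x) at_infinity sequentially"
      using that(1) by (simp add: orbit tendsto_Infty_iff)
    then have "\<forall>\<^sub>F j in sequentially. R \<le> cmod ((c ^^ n j) x)"
      using R(1) unfolding filterlim_at_infinity[OF order_refl] by blast
    then show False
      using that(2) eventually_happens'[OF sequentially_bot] by (metis not_le)
  qed
  \<comment> \<open>The times just before the orbit enters the disk of radius \<open>R\<close>. If
    there are infinitely many, a limit in {0, infinity} along them makes the next points tend to
    infinity although their moduli are below \<open>R\<close>. If there are finitely many, the orbit
    finally stays in the disk, and the same argument applies to all late times.\<close>
  define A where "A = {m. R \<le> cmod ((c ^^ m) x) \<and> cmod ((c ^^ Suc m) x) < R}"
  show False
  proof (cases "finite A")
    case False
    then obtain n :: "nat \<Rightarrow> nat" where n: "strict_mono n" "\<And>j. n j \<in> A"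
      using infinite_enumerate by blast
    obtain r where r: "strict_mono (r :: nat \<Rightarrow> nat)"
      and alt: "(\<lambda>j. (f ^^ n (r j)) (Fin x)) \<longlonglongrightarrow> Fin 0 \<or> (\<lambda>j. (f ^^ n (r j)) (Fin x)) \<longlonglongrightarrow> Infty"
      using lim[OF n(1)] by blast
    have "\<exists>q. (\<lambda>j. (f ^^ n (r j)) (Fin x)) \<longlonglongrightarrow> q \<and> f q = Infty"
      using alt zero f_simps by blast
    then have "(\<lambda>j. (f ^^ Suc (n (r j))) (Fin x)) \<longlonglongrightarrow> Infty"
      using next_Infty[of "\<lambda>j. n (r j)"] by auto
    then show False
      using n(2) not_Infty[of "\<lambda>j. Suc (n (r j))"] by (auto simp: A_def)
  next
    case True
    then obtain n0 where n0: "\<And>m. m \<in> A \<Longrightarrow> m < n0"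
      using finite_nat_iff_bounded by auto
    have stay: "R \<le> cmod ((c ^^ (m + k)) x)" if "m \<ge> n0" "R \<le> cmod ((c ^^ m) x)" for m k
    proof (induction k)
      case (Suc k)
      have "m + k \<notin> A" using n0[of "m + k"] that(1) by linarith
      then show ?case using Suc by (auto simp: A_def)
    qed (simp add: that)
    have small: "cmod ((c ^^ m) x) < R" if "m \<ge> n0" for m
    proof (rule ccontr)
      assume "\<not> cmod ((c ^^ m) x) < R"
      then have "R \<le> cmod ((c ^^ k) x)" if "k \<ge> m" for k
        using stay[OF \<open>m \<ge> n0\<close>, of "k - m"] that by simp
      then show False
        using orbit_leaves_exterior[OF R, of m x] by (meson not_less)
    qed
    have "strict_mono (\<lambda>j. j + n0)" by (simp add: strict_mono_def)
    from lim[OF this] obtain r where r: "strict_mono (r :: nat \<Rightarrow> nat)"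
      and alt: "(\<lambda>j. (f ^^ (r j + n0)) (Fin x)) \<longlonglongrightarrow> Fin 0 \<or> (\<lambda>j. (f ^^ (r j + n0)) (Fin x)) \<longlonglongrightarrow> Infty"
      by blast
    have "\<exists>q. (\<lambda>j. (f ^^ (r j + n0)) (Fin x)) \<longlonglongrightarrow> q \<and> f q = Infty"
      using alt zero f_simps by blast
    then have "(\<lambda>j. (f ^^ Suc (r j + n0)) (Fin x)) \<longlonglongrightarrow> Infty"
      using next_Infty[of "\<lambda>j. r j + n0"] by auto
    then show False
    proof (rule not_Infty)
      show "cmod ((c ^^ Suc (r j + n0)) x) < R" for j
        by (rule small) simp
    qed
  qed
qed

text \<open>A limit along multiples of \<open>p\<close> has the same value at \<open>x\<close> and
  at \<open>(c ^^ p) x\<close>, so \<open>f ^^ p\<close> fixes it. As fixed points are isolated, the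
  orbit of \<open>x\<close> cannot keep moving between several of them and converges; infinity is
  excluded because it repels.\<close>

lemma periodic_component_limit:
  assumes W: "W \<in> components G" and x: "x \<in> W" "x \<in> \<real>" and p: "p > 0" and per: "(c ^^ p) ` W \<subseteq> W"
  obtains \<xi> :: real where "(f ^^ p) (Fin (of_real \<xi>)) = Fin (of_real \<xi>)"
    "\<And>z. z \<in> W \<Longrightarrow> (\<lambda>k. (f ^^ (k * p)) (Fin z)) \<longlonglongrightarrow> Fin (of_real \<xi>)"
proof -
  have WG: "W \<subseteq> G"
    using W component_G_subset by auto
  have xG: "x \<in> G" using WG x by auto
  define s where "s k = (f ^^ (k * p)) (Fin x)" for k
  have sub: "\<exists>r q. strict_mono (r :: nat \<Rightarrow> nat) \<and> (\<forall>z\<in>W. (\<lambda>j. (f ^^ (n (r j) * p)) (Fin z)) \<longlonglongrightarrow> q) \<and> (f ^^ p) q = q"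
    if n: "strict_mono n" for n
  proof -
    have "strict_mono (\<lambda>j. n j * p)"
      using n p by (simp add: strict_mono_def)
    then obtain r q where r: "strict_mono (r :: nat \<Rightarrow> nat)" and q: "\<And>z. z \<in> W \<Longrightarrow> (\<lambda>j. (f ^^ (n (r j) * p)) (Fin z)) \<longlonglongrightarrow> q"
      by (rule subsequence_limit_constant[OF W x]) (rule that)
    have "(\<lambda>j. (f ^^ p) ((f ^^ (n (r j) * p)) (Fin x))) \<longlonglongrightarrow> (f ^^ p) q"
      by (rule continuous_on_tendsto_compose[OF continuous_on_funpow_f[of UNIV] q[OF x(1)]]) auto
    moreover have "(f ^^ p) ((f ^^ m) (Fin x)) = (f ^^ m) (Fin ((c ^^ p) x))" for m
      using xG funpow_f_G[of x p, symmetric] by (simp add: funpow_funpow add.commute)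
    moreover have "(c ^^ p) x \<in> W" using per x by auto
    ultimately have "(f ^^ p) q = q"
      using q[of "(c ^^ p) x"] LIMSEQ_unique by auto
    then show ?thesis using r q by blast
  qed
  obtain r0 q where r0: "strict_mono (r0 :: nat \<Rightarrow> nat)" "(\<lambda>j. s (r0 j)) \<longlonglongrightarrow> q" "(f ^^ p) q = q"
    using sub[OF strict_mono_id] x(1) unfolding s_def by auto
  obtain e where e: "e > 0" "\<And>y. (f ^^ p) y = y \<Longrightarrow> dist y q < e \<Longrightarrow> y = q"
    using fixed_point_isolated[OF p r0(3)] unfolding islimpt_approachable by blast
  have s_lim: "s \<longlonglongrightarrow> q"
  proof (rule tendstoI)
    fix \<epsilon> :: real assume \<epsilon>: "\<epsilon> > 0"
    have "\<exists>d>0. \<forall>y. dist y q < d \<longrightarrow> dist ((f ^^ p) y) q < e / 2"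
      using continuous_on_funpow_f[of UNIV p, unfolded continuous_on_iff, rule_format, of q "e / 2"] r0(3) e(1) by auto
    then obtain d where d: "d > 0" "\<And>y. dist y q < d \<Longrightarrow> dist ((f ^^ p) y) q < e / 2" by blast
    define \<delta> where "\<delta> = min d \<epsilon>"
    have \<delta>: "\<delta> > 0" "\<delta> \<le> d" "\<delta> \<le> \<epsilon>" using d \<epsilon> by (auto simp: \<delta>_def)
    have s_Suc: "s (Suc k) = (f ^^ p) (s k)" for k
      by (simp add: s_def funpow_add)
    \<comment> \<open>Infinitely many visits to this shell would produce a fixed point other than
      \<open>q\<close> within distance \<open>e\<close> of it. One step from within
      \<open>\<delta>\<close> reaches a distance below \<open>e / 2\<close>, so leaving would
      require a visit to the shell.\<close>
    define B where "B = {k. \<delta> \<le> dist (s k) q \<and> dist (s k) q \<le> e / 2}"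
    have "finite B"
    proof (rule ccontr)
      assume "infinite B"
      then obtain n :: "nat \<Rightarrow> nat" where n: "strict_mono n" "\<And>j. n j \<in> B"
        using infinite_enumerate by blast
      obtain r q' where q': "strict_mono (r :: nat \<Rightarrow> nat)" "(\<lambda>j. s (n (r j))) \<longlonglongrightarrow> q'" "(f ^^ p) q' = q'"
        using sub[OF n(1)] x(1) unfolding s_def by blast
      have lim: "(\<lambda>j. dist (s (n (r j))) q) \<longlonglongrightarrow> dist q' q"
        by (intro tendsto_intros q')
      have "\<delta> \<le> dist q' q"
        by (rule LIMSEQ_le_const[OF lim]) (use n(2) in \<open>auto simp: B_def\<close>)
      moreover have "dist q' q \<le> e / 2"
        by (rule LIMSEQ_le_const2[OF lim]) (use n(2) in \<open>auto simp: B_def\<close>)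
      ultimately show False
        using e(2)[OF q'(3)] e(1) \<delta>(1) by auto
    qed
    then obtain n0 where n0: "\<And>k. k \<in> B \<Longrightarrow> k < n0"
      using finite_nat_iff_bounded by auto
    have "\<forall>\<^sub>F j in sequentially. dist (s (r0 j)) q < \<delta>"
      by (rule tendstoD[OF r0(2) \<delta>(1)])
    moreover have "\<forall>\<^sub>F j in sequentially. j \<ge> n0"
      by (rule eventually_ge_at_top)
    ultimately have "\<forall>\<^sub>F j in sequentially. dist (s (r0 j)) q < \<delta> \<and> r0 j \<ge> n0"
      by eventually_elim (use seq_suble[OF r0(1)] order_trans in blast)
    then obtain j where j: "dist (s (r0 j)) q < \<delta>" "r0 j \<ge> n0"
      using eventually_happens'[OF sequentially_bot] by blast
    have "dist (s (r0 j + k)) q < \<delta>" for k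
    proof (induction k)
      case (Suc k)
      then have "dist (s (Suc (r0 j + k))) q < e / 2"
        unfolding s_Suc using \<delta>(2) by (intro d) simp
      moreover have "Suc (r0 j + k) \<notin> B"
        using n0[of "Suc (r0 j + k)"] j(2) by auto
      ultimately show ?case
        by (auto simp: B_def not_le)
    qed (simp add: j)
    then have "dist (s k) q < \<epsilon>" if "k \<ge> r0 j" for k
      using that \<delta>(3) by (metis le_add_diff_inverse less_le_trans)
    then show "\<forall>\<^sub>F k in sequentially. dist (s k) q < \<epsilon>"
      by (auto simp: eventually_sequentially)
  qed
  \<comment> \<open>Otherwise some subsequence at \<open>z\<close> stays away from \<open>q\<close>;
    but its constant limit on \<open>W\<close> is already determined at \<open>x\<close>.\<close>
  have all: "(\<lambda>k. (f ^^ (k * p)) (Fin z)) \<longlonglongrightarrow> q" if z: "z \<in> W" for z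
  proof (rule ccontr)
    assume "\<not> ?thesis"
    then obtain \<epsilon> where \<epsilon>: "\<epsilon> > 0" "\<not> (\<forall>\<^sub>F k in sequentially. dist ((f ^^ (k * p)) (Fin z)) q < \<epsilon>)"
      unfolding tendsto_iff by blast
    then have "infinite {k. \<epsilon> \<le> dist ((f ^^ (k * p)) (Fin z)) q}"
      unfolding cofinite_eq_sequentially[symmetric] eventually_cofinite by (simp add: not_less)
    then obtain n :: "nat \<Rightarrow> nat" where n: "strict_mono n" "\<And>j. \<epsilon> \<le> dist ((f ^^ (n j * p)) (Fin z)) q"
      using infinite_enumerate by (metis (mono_tags, lifting) mem_Collect_eq)
    obtain r q' where q': "strict_mono (r :: nat \<Rightarrow> nat)" "\<forall>z\<in>W. (\<lambda>j. (f ^^ (n (r j) * p)) (Fin z)) \<longlonglongrightarrow> q'"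
      using sub[OF n(1)] by blast
    have "(\<lambda>j. s (n (r j))) \<longlonglongrightarrow> q"
      using LIMSEQ_subseq_LIMSEQ[OF s_lim strict_mono_o[OF n(1) q'(1)]] by (simp add: o_def)
    then have "q' = q"
      using q'(2) x(1) LIMSEQ_unique unfolding s_def by blast
    then have "(\<lambda>j. (f ^^ (n (r j) * p)) (Fin z)) \<longlonglongrightarrow> q"
      using q'(2) z by blast
    then have "\<forall>\<^sub>F j in sequentially. dist ((f ^^ (n (r j) * p)) (Fin z)) q < \<epsilon>"
      using \<epsilon>(1) by (rule tendstoD)
    then obtain j where "dist ((f ^^ (n (r j) * p)) (Fin z)) q < \<epsilon>"
      using eventually_happens'[OF sequentially_bot] by blast
    then show False
      using n(2)[of "r j"] by simp
  qed
  have "q \<noteq> Infty"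
  proof
    assume "q = Infty"
    obtain U where U: "open U" "Infty \<in> U"
      "\<forall>z\<in>G. \<not> (\<forall>\<^sub>F k in sequentially. (f ^^ (k * p)) (Fin z) \<in> U)"
      using near_infinity_periodic[OF p] by auto
    have "\<forall>\<^sub>F k in sequentially. s k \<in> U"
      using s_lim U \<open>q = Infty\<close> by (intro topological_tendstoD) auto
    then show False
      using U(3) xG by (simp add: s_def)
  qed
  moreover have "q \<in> insert Infty (Fin ` \<real>)"
    using s_lim unfolding s_def by (rule real_orbit_limit[OF xG x(2)])
  ultimately obtain \<xi> :: real where "q = Fin (of_real \<xi>)"
    by (auto elim!: Reals_cases)
  then show thesis
    using that[of \<xi>] r0(3) all by simp
qed

end

section \<open>Periodic components\<close>

lemma has_field_derivative_funpow_fixed_point: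
  assumes "(F has_field_derivative l) (at \<xi>)" "F \<xi> = \<xi>"
  shows "((F ^^ k) has_field_derivative l ^ k) (at \<xi>)"
proof (induction k)
  case (Suc k)
  have "(F ^^ k) \<xi> = \<xi>"
    by (induction k) (simp_all add: assms(2))
  then have "(F \<circ> F ^^ k has_field_derivative l * l ^ k) (at \<xi>)"
    using assms(1) by (intro DERIV_chain Suc) simp
  then show ?case by (simp add: o_def)
qed (simp add: id_def)

lemma eventually_derivative_bound:
  fixes F :: "complex \<Rightarrow> complex"
  assumes "(F has_field_derivative l) (at \<xi>)" "F \<xi> = \<xi>"
  shows "cmod l < \<mu> \<Longrightarrow> \<forall>\<^sub>F z in at \<xi>. cmod (F z - \<xi>) \<le> \<mu> * cmod (z - \<xi>)"
    and "\<mu> < cmod l \<Longrightarrow> \<forall>\<^sub>F z in at \<xi>. \<mu> * cmod (z - \<xi>) \<le> cmod (F z - \<xi>)"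
proof -
  have "((\<lambda>z. (F z - \<xi>) / (z - \<xi>)) \<longlongrightarrow> l) (at \<xi>)"
    using assms by (simp add: has_field_derivative_iff)
  then have lim: "((\<lambda>z. cmod ((F z - \<xi>) / (z - \<xi>))) \<longlongrightarrow> cmod l) (at \<xi>)"
    by (rule tendsto_norm)
  have ne: "\<forall>\<^sub>F z in at \<xi>. z \<noteq> \<xi>"
    by (simp add: eventually_at_filter)
  show "\<forall>\<^sub>F z in at \<xi>. cmod (F z - \<xi>) \<le> \<mu> * cmod (z - \<xi>)" if "cmod l < \<mu>"
    using order_tendstoD(2)[OF lim that] ne
    by eventually_elim (simp add: norm_divide divide_less_eq)
  show "\<forall>\<^sub>F z in at \<xi>. \<mu> * cmod (z - \<xi>) \<le> cmod (F z - \<xi>)" if "\<mu> < cmod l"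
    using order_tendstoD(1)[OF lim that] ne
    by eventually_elim (simp add: norm_divide less_divide_eq)
qed

context rational_repelling_infinity
begin

lemma disjoint_backward_orbit_imp_G:
  assumes "open S" "\<And>z n. z \<in> S \<Longrightarrow> z \<notin> E n" shows "S \<subseteq> G"
proof -
  have "Fin ` S \<inter> backward_orbit = {}"
    using assms(2) backward_orbit_eq by auto
  then have "Fin ` S \<inter> closure backward_orbit = {}"
    using open_Fin_image[OF assms(1)] open_Int_closure_eq_empty by blast
  then show ?thesis
    by (auto simp: G_def)
qed

lemma fixed_point_derivative:
  assumes "(f ^^ p) (Fin \<xi>) = Fin \<xi>"
  shows "\<xi> \<notin> E p" "(c ^^ p) \<xi> = \<xi>" "((c ^^ p) has_field_derivative multiplier (f ^^ p) (Fin \<xi>)) (at \<xi>)"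
proof -
  show nE: "\<xi> \<notin> E p"
    using assms by (simp add: E_iff)
  then show "(c ^^ p) \<xi> = \<xi>"
    using assms funpow_f_E by simp
  have "(c ^^ p) holomorphic_on - E p"
    by (intro holomorphic_on_funpow_c) auto
  then have "((c ^^ p) has_field_derivative deriv (c ^^ p) \<xi>) (at \<xi>)"
    using open_Compl_E nE by (intro holomorphic_derivI) auto
  moreover have "multiplier (f ^^ p) (Fin \<xi>) = deriv (c ^^ p) \<xi>"
    unfolding multiplier_def rsphere.case
  proof (rule deriv_cong_ev)
    have "\<forall>\<^sub>F z in nhds \<xi>. z \<in> - E p"
      using open_Compl_E nE by (intro eventually_nhds_in_open) auto
    then show "\<forall>\<^sub>F z in nhds \<xi>. finite_part ((f ^^ p) (Fin z)) = (c ^^ p) z"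
      by eventually_elim (simp add: funpow_f_E)
  qed simp
  ultimately show "((c ^^ p) has_field_derivative multiplier (f ^^ p) (Fin \<xi>)) (at \<xi>)"
    by simp
qed

text \<open>A small disk about the point is mapped into itself by \<open>c ^^ p\<close>, so none of
  its points ever reaches \<open>Infty\<close>.\<close>

lemma attracting_fixed_point_in_G:
  assumes p: "p > 0" and fixp: "(f ^^ p) (Fin \<xi>) = Fin \<xi>" and attr: "cmod (multiplier (f ^^ p) (Fin \<xi>)) < 1"
  shows "\<xi> \<in> G"
proof -
  define F where "F = c ^^ p"
  have F: "\<xi> \<notin> E p" "F \<xi> = \<xi>" "(F has_field_derivative multiplier (f ^^ p) (Fin \<xi>)) (at \<xi>)"
    using fixed_point_derivative[OF fixp] by (simp_all add: F_def)
  have "\<forall>\<^sub>F z in at \<xi>. cmod (F z - \<xi>) \<le> 1 * cmod (z - \<xi>)"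
    by (rule eventually_derivative_bound(1)[OF F(3,2) attr])
  moreover have "\<forall>\<^sub>F z in at \<xi>. z \<in> - E p"
    using open_Compl_E F(1) by (intro eventually_at_in_open') auto
  ultimately have "\<forall>\<^sub>F z in at \<xi>. cmod (F z - \<xi>) \<le> cmod (z - \<xi>) \<and> z \<notin> E p"
    by eventually_elim simp
  then obtain r where r: "r > 0" and "\<And>z. z \<noteq> \<xi> \<Longrightarrow> dist z \<xi> < r \<Longrightarrow> cmod (F z - \<xi>) \<le> cmod (z - \<xi>) \<and> z \<notin> E p"
    unfolding eventually_at by auto
  then have step: "F z \<in> ball \<xi> r" "z \<notin> E p" if "z \<in> ball \<xi> r" for z
    using that F by (cases "z = \<xi>"; force simp: dist_norm norm_minus_commute)+
  have iter: "(F ^^ k) z \<in> ball \<xi> r" if "z \<in> ball \<xi> r" for z k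
    by (induction k) (simp_all only: funpow.simps o_apply id_apply step that)
  have iter_f: "(f ^^ (k * p)) (Fin z) = Fin ((F ^^ k) z)" if "z \<in> ball \<xi> r" for z k
  proof (induction k)
    case (Suc k)
    have "(f ^^ (Suc k * p)) (Fin z) = (f ^^ p) (Fin ((F ^^ k) z))"
      using Suc by (simp add: funpow_add)
    also have "\<dots> = Fin ((F ^^ Suc k) z)"
      using funpow_f_E[OF step(2)[OF iter[OF that]]] by (simp add: F_def)
    finally show ?case .
  qed simp
  have "ball \<xi> r \<subseteq> G"
  proof (rule disjoint_backward_orbit_imp_G)
    fix z n assume "z \<in> ball \<xi> r"
    then have "z \<notin> E (n * p)"
      by (simp add: E_iff iter_f)
    moreover have "n \<le> n * p" using p by simp
    ultimately show "z \<notin> E n"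
      using E_mono by blast
  qed simp
  then show ?thesis using r by auto
qed

text \<open>Once the orbit is close to the fixed point, its distance no longer decreases; it can
  tend to 0 only by being 0.\<close>

lemma repelling_fixed_point_no_limit:
  assumes fixp: "(f ^^ p) (Fin \<xi>) = Fin \<xi>" and rep: "cmod (multiplier (f ^^ p) (Fin \<xi>)) > 1"
    and lim: "(\<lambda>k. (c ^^ (k * p)) z) \<longlonglongrightarrow> \<xi>"
  shows "\<exists>k. (c ^^ (k * p)) z = \<xi>"
proof (rule ccontr)
  assume "\<not> ?thesis"
  then have ne: "(c ^^ (k * p)) z \<noteq> \<xi>" for k by blast
  define F where "F = c ^^ p"
  have F: "F \<xi> = \<xi>" "(F has_field_derivative multiplier (f ^^ p) (Fin \<xi>)) (at \<xi>)"
    using fixed_point_derivative[OF fixp] by (simp_all add: F_def)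
  have "\<forall>\<^sub>F z in at \<xi>. 1 * cmod (z - \<xi>) \<le> cmod (F z - \<xi>)"
    by (rule eventually_derivative_bound(2)[OF F(2,1) rep])
  moreover have "filterlim (\<lambda>k. (c ^^ (k * p)) z) (at \<xi>) sequentially"
    using lim ne by (simp add: filterlim_at)
  ultimately have "\<forall>\<^sub>F k in sequentially. 1 * cmod ((c ^^ (k * p)) z - \<xi>) \<le> cmod (F ((c ^^ (k * p)) z) - \<xi>)"
    unfolding filterlim_iff by blast
  then obtain K where K: "\<And>k. k \<ge> K \<Longrightarrow> cmod ((c ^^ (k * p)) z - \<xi>) \<le> cmod (F ((c ^^ (k * p)) z) - \<xi>)"
    unfolding eventually_sequentially by auto
  have "cmod ((c ^^ (K * p)) z - \<xi>) \<le> cmod ((c ^^ ((K + j) * p)) z - \<xi>)" for j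
  proof (induction j)
    case (Suc j)
    have "(c ^^ ((K + Suc j) * p)) z = F ((c ^^ ((K + j) * p)) z)"
      by (simp add: F_def funpow_funpow algebra_simps)
    then show ?case
      using Suc K[of "K + j"] by simp
  qed simp
  then have "\<forall>\<^sub>F k in sequentially. cmod ((c ^^ (K * p)) z - \<xi>) \<le> cmod ((c ^^ (k * p)) z - \<xi>)"
    unfolding eventually_sequentially by (metis le_add_diff_inverse)
  moreover have "(\<lambda>k. cmod ((c ^^ (k * p)) z - \<xi>)) \<longlonglongrightarrow> cmod (\<xi> - \<xi>)"
    by (intro tendsto_intros lim)
  ultimately have "cmod ((c ^^ (K * p)) z - \<xi>) \<le> cmod (\<xi> - \<xi>)"
    by (intro tendsto_lowerbound) auto
  then show False
    using ne[of K] by simp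
qed

text \<open>Some iterate \<open>F ^^ k\<close> with \<open>k\<close> positive maps the closed disk
  of radius \<open>e\<close> about the point to within \<open>e / 2\<close> of it. Cauchy's estimate
  then bounds the derivative \<open>l ^ k\<close> by 1/2.\<close>

lemma limit_in_component_imp_attracting:
  assumes W: "W \<in> components G" and \<xi>: "\<xi> \<in> W" and p: "p > 0" and fixp: "(f ^^ p) (Fin \<xi>) = Fin \<xi>"
    and lim: "\<And>z. z \<in> W \<Longrightarrow> (\<lambda>k. (f ^^ (k * p)) (Fin z)) \<longlonglongrightarrow> Fin \<xi>"
  shows "cmod (multiplier (f ^^ p) (Fin \<xi>)) < 1"
proof -
  have WG: "W \<subseteq> G" "connected W" "open W"
    using W in_components_connected open_component_G component_G_subset by auto
  have lim_c: "(\<lambda>k. (c ^^ (k * p)) z) \<longlonglongrightarrow> \<xi>" if "z \<in> W" for z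
    using lim[OF that] that WG(1) by (simp add: funpow_f_G subset_iff tendsto_Fin_iff)
  define F where "F = c ^^ p"
  define l where "l = multiplier (f ^^ p) (Fin \<xi>)"
  have F: "F \<xi> = \<xi>" "(F has_field_derivative l) (at \<xi>)"
    using fixed_point_derivative[OF fixp] by (simp_all add: F_def l_def)
  obtain r where r: "strict_mono (r :: nat \<Rightarrow> nat)" and alt: "(\<exists>h. h holomorphic_on W \<and>
        loc_unif_limit W (\<lambda>j. c ^^ (r j * p)) h) \<or> loc_unif_infinity W (\<lambda>j. c ^^ (r j * p))"
    by (rule normal_G[OF WG(3,2,1), of "\<lambda>k. k * p"])
  have lim_r: "(\<lambda>j. (c ^^ (r j * p)) z) \<longlonglongrightarrow> \<xi>" if "z \<in> W" for z
    using LIMSEQ_subseq_LIMSEQ[OF lim_c[OF that] r] by (simp add: o_def)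
  from alt obtain h where h: "loc_unif_limit W (\<lambda>j. c ^^ (r j * p)) h"
  proof
    assume inf: "loc_unif_infinity W (\<lambda>j. c ^^ (r j * p))"
    have "filterlim (\<lambda>j. (c ^^ (r j * p)) \<xi>) at_infinity sequentially"
      by (rule loc_unif_infinity_filterlim[OF WG(3) inf \<xi> tendsto_const])
    then show thesis
      using lim_r[OF \<xi>] not_tendsto_and_filterlim_at_infinity sequentially_bot by blast
  qed blast
  have h_eq: "h z = \<xi>" if "z \<in> W" for z
    using loc_unif_limit_tendsto[OF h that] lim_r[OF that] by (rule LIMSEQ_unique)
  obtain e where e: "e > 0" "cball \<xi> e \<subseteq> W"
    using \<xi> WG(3) open_contains_cball by blast
  have "uniform_limit (cball \<xi> e) (\<lambda>j. c ^^ (r j * p)) h sequentially"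
    using h e by (simp add: loc_unif_limit_def)
  from uniform_limitD[OF this, of "e / 2"] e(1)
  have "\<forall>\<^sub>F j in sequentially. \<forall>z\<in>cball \<xi> e. dist ((c ^^ (r j * p)) z) (h z) < e / 2"
    by simp
  moreover have "\<forall>\<^sub>F j in sequentially. j \<ge> 1"
    by (rule eventually_ge_at_top)
  ultimately have "\<forall>\<^sub>F j in sequentially. (\<forall>z\<in>cball \<xi> e. dist ((c ^^ (r j * p)) z) (h z) < e / 2) \<and> r j \<ge> 1"
    by eventually_elim (use seq_suble[OF r] order_trans in blast)
  then obtain j where j: "\<And>z. z \<in> cball \<xi> e \<Longrightarrow> dist ((c ^^ (r j * p)) z) (h z) < e / 2" "r j \<ge> 1"
    using eventually_happens'[OF sequentially_bot] by blast
  define k where "k = r j"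
  define g where "g z = (c ^^ (k * p)) z - \<xi>" for z
  have "(c ^^ (k * p)) = F ^^ k"
    by (simp add: F_def funpow_mult mult.commute)
  then have "((c ^^ (k * p)) has_field_derivative l ^ k) (at \<xi>)"
    using has_field_derivative_funpow_fixed_point[OF F(2,1)] by simp
  then have "(g has_field_derivative l ^ k) (at \<xi>)"
    unfolding g_def using DERIV_diff[OF _ DERIV_const] by fastforce
  then have der: "deriv g \<xi> = l ^ k"
    by (rule DERIV_imp_deriv)
  have hol: "g holomorphic_on cball \<xi> e"
    unfolding g_def using e(2) WG(1) by (intro holomorphic_intros holomorphic_on_funpow_c_G) auto
  have "cmod ((deriv ^^ 1) g \<xi>) \<le> fact 1 * (e / 2) / e ^ 1"
  proof (rule Cauchy_inequality)
    show "g holomorphic_on ball \<xi> e"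
      using hol by (rule holomorphic_on_subset) auto
    show "continuous_on (cball \<xi> e) g"
      by (rule holomorphic_on_imp_continuous_on[OF hol])
    fix x assume x: "cmod (\<xi> - x) = e"
    then have xb: "x \<in> cball \<xi> e" by (simp add: dist_norm)
    then have "x \<in> W" using e by auto
    then show "cmod (g x) \<le> e / 2"
      using j(1)[OF xb] by (simp add: g_def k_def dist_norm h_eq)
  qed (rule e(1))
  then have "cmod l ^ k \<le> 1 / 2"
    using e(1) by (simp add: der norm_power)
  then have "\<not> 1 \<le> cmod l"
    using one_le_power[of "cmod l" k] by linarith
  then show ?thesis
    by (simp add: l_def)
qed

text \<open>Every orbit in the basin enters the component, so complete invariance places the basin
  inside the Fatou set; its connected part through the fixed point then cannot leave
  \<open>W\<close>.\<close>

lemma attracting_domainI: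
  assumes W: "W \<in> components G" and \<xi>: "\<xi> \<in> W" and p: "p > 0" and per: "(c ^^ p) ` W = W"
    and fixp: "(f ^^ p) (Fin \<xi>) = Fin \<xi>"
    and lim: "\<And>z. z \<in> W \<Longrightarrow> (\<lambda>k. (f ^^ (k * p)) (Fin z)) \<longlonglongrightarrow> Fin \<xi>"
  shows "attracting_domain f (Fin ` W) (Fin \<xi>)"
proof -
  have WG: "W \<subseteq> G" "connected W" "open W"
    using W in_components_connected open_component_G component_G_subset by auto
  let ?B = "{y. (\<lambda>k. (f ^^ (k * p)) y) \<longlonglongrightarrow> Fin \<xi>}"
  have "Fin ` W = connected_component_set ?B (Fin \<xi>)"
  proof
    show "Fin ` W \<subseteq> connected_component_set ?B (Fin \<xi>)"
      using WG \<xi> lim by (intro connected_component_maximal) (auto simp: connected_Fin_image_iff)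
    have BG: "?B \<subseteq> Fin ` G"
    proof
      fix y assume "y \<in> ?B"
      moreover have "open (Fin ` W)" "Fin \<xi> \<in> Fin ` W"
        using WG \<xi> by (auto intro: open_Fin_image)
      ultimately have "\<forall>\<^sub>F k in sequentially. (f ^^ (k * p)) y \<in> Fin ` W"
        using topological_tendstoD by blast
      then obtain k where "(f ^^ (k * p)) y \<in> Fin ` W"
        using eventually_happens'[OF sequentially_bot] by blast
      then have "(f ^^ (k * p)) y \<notin> closure backward_orbit"
        using WG(1) by (auto simp: G_def)
      moreover have "(f ^^ m) y \<in> closure backward_orbit \<longleftrightarrow> y \<in> closure backward_orbit" for m
        by (induction m) simp_all
      ultimately show "y \<in> Fin ` G"
        by (simp add: Fin_G)
    qed
    obtain S where S: "connected_component_set ?B (Fin \<xi>) = Fin ` S" "S \<subseteq> G"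
      using BG connected_component_subset[of ?B "Fin \<xi>"] by (meson order_trans subset_image_iff)
    have "Fin \<xi> \<in> ?B"
      using lim \<xi> by simp
    then have "Fin \<xi> \<in> connected_component_set ?B (Fin \<xi>)"
      by (intro CollectI connected_component_refl) simp
    then have "Fin \<xi> \<in> Fin ` S"
      by (simp only: S(1))
    moreover have "connected S"
      using S(1) connected_connected_component connected_Fin_image_iff by metis
    ultimately have "S \<subseteq> W"
      using component_G_eqI[OF W _ S(2)] \<xi> by auto
    then show "connected_component_set ?B (Fin \<xi>) \<subseteq> Fin ` W"
      using S by auto
  qed
  moreover have "periodic_Fatou_component f (Fin ` W)"
    using W p per WG(1) by (auto simp: periodic_Fatou_component_def Fatou_component_f funpow_f_image intro!: exI[of _ p])
  moreover have "cmod (multiplier (f ^^ p) (Fin \<xi>)) < 1"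
    by (rule limit_in_component_imp_attracting[OF W \<xi> p fixp lim])
  ultimately show ?thesis
    unfolding attracting_domain_def using p fixp by blast
qed

end

context real_rational_repelling_infinity
begin

text \<open>The derivative may be computed along the real line, where the difference quotients are
  real.\<close>

lemma multiplier_real:
  fixes \<xi> :: real
  assumes "(f ^^ p) (Fin (of_real \<xi>)) = Fin (of_real \<xi>)"
  shows "multiplier (f ^^ p) (Fin (of_real \<xi>)) \<in> \<real>"
proof -
  let ?l = "multiplier (f ^^ p) (Fin (of_real \<xi>))"
  have "((\<lambda>z. ((c ^^ p) z - of_real \<xi>) / (z - of_real \<xi>)) \<longlongrightarrow> ?l) (at (of_real \<xi>))"
    using fixed_point_derivative[OF assms] by (simp add: has_field_derivative_iff)
  moreover have "filterlim (\<lambda>t. of_real t) (at (of_real \<xi> :: complex)) (at \<xi>)"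
    unfolding filterlim_at by (auto intro!: tendsto_intros simp: eventually_at_filter)
  ultimately have "((\<lambda>t. ((c ^^ p) (of_real t) - of_real \<xi>) / (of_real t - of_real \<xi>)) \<longlongrightarrow> ?l) (at \<xi>)"
    by (rule filterlim_compose)
  then show ?thesis
    by (rule Lim_in_closed_set[OF closed_complex_Reals, rotated 2])
      (auto intro!: always_eventually Reals_divide Reals_diff funpow_c_real)
qed

text \<open>A limit outside \<open>W\<close> lies in its closure and hence outside \<open>G\<close>,
  since its own component would meet \<open>W\<close>. Attracting points lie in \<open>G\<close>,
  and a repelling point is no limit of an orbit that avoids it. So the multiplier has modulus 1 and,
  being real, squares to 1.\<close>

lemma periodic_component_classification:
  assumes W: "W \<in> components G" and x: "x \<in> W" "x \<in> \<real>" and p: "p > 0" and per: "(c ^^ p) ` W = W"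
  shows "\<exists>\<xi> :: real. attracting_domain f (Fin ` W) (Fin (of_real \<xi>)) \<or> parabolic_domain f (Fin ` W) (Fin (of_real \<xi>))"
proof -
  have WG: "W \<subseteq> G" "connected W" "open W"
    using W in_components_connected open_component_G component_G_subset by auto
  obtain \<xi> :: real where fixp: "(f ^^ p) (Fin (of_real \<xi>)) = Fin (of_real \<xi>)"
    and lim: "\<And>z. z \<in> W \<Longrightarrow> (\<lambda>k. (f ^^ (k * p)) (Fin z)) \<longlonglongrightarrow> Fin (of_real \<xi>)"
    by (rule periodic_component_limit[OF W x p equalityD1[OF per]]) (rule that)
  let ?\<xi> = "complex_of_real \<xi>"
  let ?l = "multiplier (f ^^ p) (Fin ?\<xi>)"
  show ?thesis
  proof (cases "?\<xi> \<in> W")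
    case True
    then show ?thesis
      using attracting_domainI[OF W True p per fixp lim] by blast
  next
    case False
    have inv: "(c ^^ (k * p)) ` W = W" for k
      by (induction k) (simp_all add: funpow_add per image_comp[symmetric] del: o_apply)
    have lim_c: "(\<lambda>k. (c ^^ (k * p)) x) \<longlonglongrightarrow> ?\<xi>"
      using lim[OF x(1)] x(1) WG(1) by (simp add: funpow_f_G subset_iff tendsto_Fin_iff)
    have orb: "(c ^^ (k * p)) x \<in> W" for k
      using inv[of k] x(1) by blast
    have "?\<xi> \<in> closure W"
      unfolding closure_sequential using orb lim_c by (intro exI[of _ "\<lambda>k. (c ^^ (k * p)) x"]) simp
    moreover have notG: "?\<xi> \<notin> G"
    proof
      assume "?\<xi> \<in> G"
      then have V: "connected_component_set G ?\<xi> \<in> components G" "?\<xi> \<in> connected_component_set G ?\<xi>"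
        by (auto simp: componentsI)
      then have "W \<inter> connected_component_set G ?\<xi> \<noteq> {}"
        using open_Int_closure_eq_empty[OF open_component_G[OF V(1)], of W] \<open>?\<xi> \<in> closure W\<close> by blast
      then have "W = connected_component_set G ?\<xi>"
        using components_nonoverlap[OF W V(1)] by blast
      then show False using False V by simp
    qed
    have "\<not> cmod ?l < 1"
      using attracting_fixed_point_in_G[OF p fixp] notG by blast
    moreover have "\<not> cmod ?l > 1"
      using repelling_fixed_point_no_limit[OF fixp _ lim_c] orb False by metis
    ultimately have "cmod ?l = 1" by simp
    moreover obtain t where "?l = of_real t"
      using multiplier_real[OF fixp] Reals_cases by blast
    ultimately have "?l ^ 2 = 1"
      by (auto simp: abs_if power2_eq_square split: if_splits)
    moreover have "Fin ?\<xi> \<in> frontier (Fin ` W)"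
    proof -
      have "Fin ?\<xi> \<in> closure (Fin ` W)"
        unfolding closure_sequential using lim[OF x(1)] orb WG(1) x(1)
        by (intro exI[of _ "\<lambda>k. (f ^^ (k * p)) (Fin x)"]) (auto simp: funpow_f_G subset_iff)
      then show ?thesis
        using open_Fin_image[OF WG(3)] False by (auto simp: frontier_def interior_open)
    qed
    moreover have "Fatou_component f (Fin ` W)"
      using W by (auto simp: Fatou_component_f)
    moreover have "(f ^^ p) ` Fin ` W = Fin ` W"
      using funpow_f_image[OF WG(1)] per by simp
    ultimately have "parabolic_domain f (Fin ` W) (Fin ?\<xi>)"
      unfolding parabolic_domain_def using p fixp lim
      by (intro conjI exI[of _ p] exI[of _ "2::nat"]) auto
    then show ?thesis by blast
  qed
qed

end

section \<open>Multiply connected components\<close>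

lemma simply_connected_Fin_image_iff: "simply_connected (Fin ` S) \<longleftrightarrow> simply_connected S"
  using homeomorphism_Fin[of S] homeomorphic_simply_connected_eq homeomorphic_def by blast

text \<open>Some loop in \<open>W\<close> winds around a point \<open>z\<close> outside
  \<open>W\<close>. The component through \<open>z\<close> of the complement of the loop is bounded,
  since winding numbers vanish in the outside.\<close>

lemma not_simply_connected_imp_enclosing_domain:
  fixes W :: "complex set"
  assumes W: "open W" "connected W" "\<not> simply_connected W"
  obtains \<Omega> where "open \<Omega>" "connected \<Omega>" "bounded \<Omega>" "frontier \<Omega> \<subseteq> W" "\<not> \<Omega> \<subseteq> W" "frontier \<Omega> \<noteq> {}"
proof -
  obtain \<gamma> z where \<gamma>: "path \<gamma>" "path_image \<gamma> \<subseteq> W" "pathfinish \<gamma> = pathstart \<gamma>" "z \<notin> W" "winding_number \<gamma> z \<noteq> 0"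
    using W simply_connected_eq_winding_number_zero[OF W(1)] by blast
  define \<Omega> where "\<Omega> = connected_component_set (- path_image \<gamma>) z"
  have op: "open (- path_image \<gamma>)"
    using \<gamma>(1) by (intro open_Compl closed_path_image)
  have z: "z \<in> \<Omega>"
    unfolding \<Omega>_def using \<gamma>(2,4) by (intro CollectI connected_component_refl) auto
  have "z \<notin> outside (path_image \<gamma>)"
    using winding_number_zero_in_outside[OF \<gamma>(1,3)] \<gamma>(5) by blast
  then have bdd: "bounded \<Omega>"
    using \<gamma>(2,4) by (auto simp: outside_def \<Omega>_def)
  have "open \<Omega>" "connected \<Omega>"
    unfolding \<Omega>_def using op by (auto intro: open_connected_component)
  moreover have "frontier \<Omega> \<subseteq> path_image \<gamma>"
  proof -
    have "\<Omega> \<in> components (- path_image \<gamma>)"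
      using z connected_component_in unfolding \<Omega>_def by (intro componentsI) blast
    then show ?thesis
      using frontier_of_components_closed_complement[of "path_image \<gamma>" \<Omega>] \<gamma>(1) closed_path_image by blast
  qed
  moreover have "frontier \<Omega> \<noteq> {}"
    using z bdd by (metis frontier_eq_empty not_bounded_UNIV empty_iff)
  ultimately show thesis
    using that[of \<Omega>] bdd z \<gamma>(2,4) by blast
qed

lemma annulus_not_simply_connected:
  assumes "R > 1" shows "\<not> simply_connected {z. 1 < cmod z \<and> cmod z < R}"
proof
  let ?A = "{z. 1 < cmod z \<and> cmod z < R}"
  assume sc: "simply_connected ?A"
  have op: "open ?A"
    by (intro open_Collect_conj open_Collect_less continuous_intros)
  define s where "s = (1 + R) / 2"
  have s: "1 < s" "s < R" using assms by (auto simp: s_def)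
  have "winding_number (circlepath 0 s) 0 = 0"
  proof -
    have "path_image (circlepath 0 s) \<subseteq> ?A"
      using s by auto
    then show ?thesis
      using sc simply_connected_eq_winding_number_zero[OF op] by (metis (no_types, lifting) path_circlepath pathfinish_circlepath pathstart_circlepath mem_Collect_eq norm_zero not_one_less_zero)
  qed
  moreover have "winding_number (circlepath 0 s) 0 = 1"
    using s by (intro winding_number_circlepath) simp
  ultimately show False by simp
qed

text \<open>A connected set through \<open>P\<close> that avoids \<open>W\<close> would lie in the
  bounded component of the complement.\<close>

lemma surrounds_meets:
  assumes "surrounds (Fin ` W) P" "connected A" "P \<in> A" "\<not> bounded A"
  shows "\<exists>z\<in>A. z \<in> W"
proof (rule ccontr)
  assume none: "\<not> ?thesis"
  obtain B where B: "Fin ` B \<in> components (- Fin ` W)" "bounded B" "P \<in> B"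
    using assms(1) by (auto simp: surrounds_def)
  have "Fin ` A \<subseteq> Fin ` B"
  proof (rule components_maximal[OF B(1)])
    show "connected (Fin ` A)"
      by (simp add: connected_Fin_image_iff assms(2))
    show "Fin ` A \<subseteq> - Fin ` W"
      using none by auto
    show "Fin ` B \<inter> Fin ` A \<noteq> {}"
      using assms(3) B(3) by blast
  qed
  then have "A \<subseteq> B" by auto
  then show False
    using assms(4) B(2) bounded_subset by blast
qed

context rational_repelling_infinity
begin

text \<open>If the enclosed domain \<open>\<Omega>\<close> avoided all preimages of infinity, its
  closure would lie in \<open>G\<close> and thus in \<open>W\<close>. Otherwise push it forward by
  the first iterate \<open>c ^^ m\<close> whose values on \<open>\<Omega>\<close> include a pole:
  this iterate is still holomorphic on the closure, so the image is bounded.\<close>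

lemma multiply_connected_surrounds_pole:
  assumes W: "W \<in> components G" and nsc: "\<not> simply_connected W"
  obtains m P where "poly D P = 0" "surrounds (Fin ` (c ^^ m) ` W) P"
proof -
  have WG: "W \<subseteq> G" "connected W" "open W"
    using W in_components_connected open_component_G component_G_subset by auto
  obtain \<Omega> where \<Omega>: "open \<Omega>" "connected \<Omega>" "bounded \<Omega>" "frontier \<Omega> \<subseteq> W" "\<not> \<Omega> \<subseteq> W" "frontier \<Omega> \<noteq> {}"
    by (rule not_simply_connected_imp_enclosing_domain[OF WG(3,2) nsc])
  have cl: "closure \<Omega> \<subseteq> \<Omega> \<union> W" "\<Omega> \<subseteq> closure \<Omega>"
    using \<Omega>(4) closure_Un_frontier[of \<Omega>] closure_subset by auto
  have "\<exists>n. \<Omega> \<inter> E n \<noteq> {}"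
  proof (rule ccontr)
    assume "\<not> ?thesis"
    then have "\<Omega> \<subseteq> G"
      by (intro disjoint_backward_orbit_imp_G \<Omega>(1)) blast
    then have "closure \<Omega> \<subseteq> G" "closure \<Omega> \<inter> W \<noteq> {}"
      using cl WG(1) \<Omega>(4,6) closure_Un_frontier[of \<Omega>] by auto
    then have "closure \<Omega> \<subseteq> W"
      by (intro component_G_eqI[OF W] connected_imp_connected_closure \<Omega>(2))
    then show False
      using \<Omega>(5) cl by blast
  qed
  \<comment> \<open>\<open>E n\<close> records poles met before time \<open>n\<close>; the least
    \<open>M\<close> is therefore \<open>Suc m\<close>, with a pole met at time \<open>m\<close> and
    none earlier.\<close>
  define M where "M = (LEAST n. \<Omega> \<inter> E n \<noteq> {})"
  have M: "\<Omega> \<inter> E M \<noteq> {}"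
    unfolding M_def using \<open>\<exists>n. \<Omega> \<inter> E n \<noteq> {}\<close> by (rule LeastI_ex)
  then have "M \<noteq> 0" by auto
  then obtain m where m: "M = Suc m" using not0_implies_Suc by blast
  have Em: "\<Omega> \<inter> E m = {}"
    using not_less_Least[of m "\<lambda>n. \<Omega> \<inter> E n \<noteq> {}"] m by (simp add: M_def)
  obtain z where z: "z \<in> \<Omega>" "z \<in> E (Suc m)"
    using M m by blast
  define P where "P = (c ^^ m) z"
  have P: "poly D P = 0"
    using z Em by (auto simp: E_def P_def less_Suc_eq)
  define W' where "W' = (c ^^ m) ` W"
  have W': "W' \<in> components G"
    unfolding W'_def by (rule funpow_component[OF W])
  have PW': "P \<notin> W'"
    using P G_step(1) component_G_subset[OF W'] by blast
  have closE: "closure \<Omega> \<inter> E m = {}"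
    using cl Em WG(1) G_disjoint_E by blast
  define T where "T = (c ^^ m) ` \<Omega>"
  have fT: "Fin ` T = (f ^^ m) ` Fin ` \<Omega>"
    unfolding T_def image_image using Em by (intro image_cong refl funpow_f_E[symmetric]) blast
  have opT: "open (Fin ` T)"
    unfolding fT by (intro open_image_funpow_f open_Fin_image \<Omega>)
  have "continuous_on (closure \<Omega>) (c ^^ m)"
    using closE by (intro holomorphic_on_imp_continuous_on holomorphic_on_funpow_c)
  then have cmp: "compact ((c ^^ m) ` closure \<Omega>)"
    using \<Omega>(3) by (intro compact_continuous_image) auto
  have bdd: "bounded T"
    unfolding T_def by (rule bounded_subset[OF compact_imp_bounded[OF cmp] image_mono[OF cl(2)]])
  have fr: "frontier (Fin ` T) \<subseteq> Fin ` W'"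
  proof -
    have "closed (Fin ` (c ^^ m) ` closure \<Omega>)"
      using cmp by (intro compact_imp_closed) (simp add: compact_Fin_image_iff)
    then have "closure (Fin ` T) \<subseteq> Fin ` (c ^^ m) ` closure \<Omega>"
      unfolding T_def using cl(2) by (intro closure_minimal image_mono)
    also have "\<dots> \<subseteq> Fin ` T \<union> Fin ` W'"
      using cl(1) unfolding T_def W'_def by blast
    finally show ?thesis
      using opT by (auto simp: frontier_def interior_open)
  qed
  \<comment> \<open>This component of the complement cannot cross the frontier of \<open>T\<close>,
    which lies in \<open>W'\<close>, so it is trapped in the bounded set \<open>T\<close>.\<close>
  define Bs where "Bs = connected_component_set (- Fin ` W') (Fin P)"
  have Bs: "Bs \<in> components (- Fin ` W')" "Fin P \<in> Bs" "connected Bs" "Bs \<subseteq> - Fin ` W'"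
    unfolding Bs_def using PW' by (auto intro!: componentsI connected_component_subset)
  have "Bs \<subseteq> Fin ` T"
  proof (rule ccontr)
    assume "\<not> Bs \<subseteq> Fin ` T"
    moreover have "Fin P \<in> Bs \<inter> Fin ` T"
      using Bs(2) z by (auto simp: T_def P_def)
    ultimately have "Bs \<inter> frontier (Fin ` T) \<noteq> {}"
      using Bs(3) by (intro connected_Int_frontier) auto
    then show False
      using fr Bs(4) by blast
  qed
  then obtain B where B: "Bs = Fin ` B" "B \<subseteq> T"
    by (meson subset_image_iff)
  have "surrounds (Fin ` W') P"
    unfolding surrounds_def
    using Bs(1,2) B(1) bounded_subset[OF bdd B(2)] by (intro exI[of _ B]) auto
  then show thesis
    using that[of P m] P by (simp add: W'_def)
qed

end

text \<open>Without isolated points in the sphere, the \<open>Lim\<close> in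
  \<open>chebyshev_method\<close> is determined at every point.\<close>

lemma at_rsphere_neq_bot [simp]: "at (x :: rsphere) \<noteq> bot"
proof -
  have not_open: "\<not> open {Fin z}" for z
  proof
    assume "open {Fin z}"
    moreover have "Fin -` {Fin z} = {z}" by auto
    moreover have "continuous_on UNIV Fin"
      by (intro continuous_on_Fin continuous_on_id)
    ultimately have "open {z}"
      by (metis open_vimage)
    then show False
      by (simp add: not_open_singleton)
  qed
  have "\<not> open {x}"
  proof (cases x)
    case Infty
    have "open (sphere_inverse ` {x})" if "open {x}"
      using that by (rule open_sphere_inverse_image)
    then show ?thesis
      using not_open[of 0] Infty by auto
  qed (use not_open in simp)
  then show ?thesis
    by (simp add: at_eq_bot_iff)
qed

section \<open>Absence of Herman rings\<close>

context real_rational_repelling_infinity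
begin

text \<open>A ring is homeomorphic to an annulus, so by \<open>key\<close> some image of it has a
  real point, and orbits there converge to one point. This forces all orbits in the ring to a common
  limit, whereas the rotation keeps each of them on its own invariant curve.\<close>

lemma no_Herman_ring:
  assumes key: "\<And>W. W \<in> components G \<Longrightarrow> \<not> simply_connected W \<Longrightarrow> \<exists>m. \<exists>x\<in>(c ^^ m) ` W. x \<in> \<real>"
  shows "\<not> Herman_ring f U"
proof
  assume H: "Herman_ring f U"
  then obtain p R \<theta> \<phi> where p: "p > 0" "(f ^^ p) ` U = U" and R: "R > 1"
    and an: "sphere_analytic_on \<phi> {z. 1 < cmod z \<and> cmod z < R}"
    and bij: "bij_betw \<phi> {z. 1 < cmod z \<and> cmod z < R} U"
    and rot: "\<And>z. 1 < cmod z \<Longrightarrow> cmod z < R \<Longrightarrow> (f ^^ p) (\<phi> z) = \<phi> (cis (2 * pi * \<theta>) * z)"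
    unfolding Herman_ring_def by blast
  let ?A = "{z. 1 < cmod z \<and> cmod z < R}"
  have op: "open ?A"
    by (intro open_Collect_conj open_Collect_less continuous_intros)
  have cont: "continuous_on ?A \<phi>"
    using an by (simp add: sphere_analytic_on_def)
  obtain W where W: "W \<in> components G" "U = Fin ` W"
    using H by (auto simp: Herman_ring_def Fatou_component_f)
  have WG: "W \<subseteq> G" using W component_G_subset by blast
  define \<psi> where "\<psi> z = finite_part (\<phi> z)" for z
  have \<phi>: "\<phi> z \<in> U" "\<phi> z = Fin (\<psi> z)" "\<psi> z \<in> W" if "z \<in> ?A" for z
    using bij_betwE[OF bij] that W(2) by (auto simp: \<psi>_def)
  have inj: "inj_on \<psi> ?A"
    using bij \<phi>(2) unfolding bij_betw_def inj_on_def by metis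
  have im: "\<psi> ` ?A = W"
  proof -
    have "Fin ` \<psi> ` ?A = \<phi> ` ?A"
      unfolding image_image using \<phi>(2) by (intro image_cong) auto
    also have "\<dots> = Fin ` W"
      using bij W(2) by (simp add: bij_betw_def)
    finally show ?thesis
      by (simp add: inj_image_eq_iff inj_def)
  qed
  have "continuous_on ?A \<psi>"
    unfolding \<psi>_def using \<phi>(2)
    by (intro continuous_on_compose2[OF continuous_on_finite_part cont]) auto
  then obtain g where "homeomorphism ?A (\<psi> ` ?A) \<psi> g"
    using invariance_of_domain_homeomorphism[OF op _ order_refl inj] by blast
  then have "?A homeomorphic W"
    unfolding im homeomorphic_def by blast
  then have "\<not> simply_connected W"
    using annulus_not_simply_connected[OF R] homeomorphic_simply_connected_eq by blast
  from key[OF W(1) this] obtain m x where x: "x \<in> (c ^^ m) ` W" "x \<in> \<real>"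
    by blast
  have per: "(c ^^ p) ` W = W"
    using p(2) unfolding W(2) funpow_f_image[OF WG] by (simp add: inj_image_eq_iff inj_def)
  have per_m: "(c ^^ p) ` (c ^^ m) ` W = (c ^^ m) ` W"
    using arg_cong[OF per, of "image (c ^^ m)"] by (simp add: image_image funpow_funpow add.commute)
  obtain \<xi> :: real where lim: "\<And>z. z \<in> (c ^^ m) ` W \<Longrightarrow> (\<lambda>k. (f ^^ (k * p)) (Fin z)) \<longlonglongrightarrow> Fin (of_real \<xi>)"
    by (rule periodic_component_limit[OF funpow_component[OF W(1)] x p(1) equalityD1[OF per_m]]) (rule that)
  \<comment> \<open>Convergence is known on the \<open>m\<close>-th image; another
    \<open>m * p - m\<close> steps complete a multiple of the period \<open>p\<close>.\<close>
  define q where "q = (f ^^ (m * p - m)) (Fin (of_real \<xi>))"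
  have lim_q: "(\<lambda>k. (f ^^ ((k + m) * p)) (Fin u)) \<longlonglongrightarrow> q" if u: "u \<in> W" for u
  proof -
    have "(\<lambda>k. (f ^^ (m * p - m)) ((f ^^ (k * p)) (Fin ((c ^^ m) u)))) \<longlonglongrightarrow> q"
      unfolding q_def using u
      by (intro continuous_on_tendsto_compose[OF continuous_on_funpow_f[of UNIV] lim]) auto
    moreover have "(f ^^ (m * p - m)) ((f ^^ (k * p)) (Fin ((c ^^ m) u))) = (f ^^ ((k + m) * p)) (Fin u)" for k
    proof -
      have "m \<le> m * p" using p(1) by simp
      then have "m * p - m + (k * p + m) = (k + m) * p"
        unfolding add_mult_distrib by linarith
      moreover have "Fin ((c ^^ m) u) = (f ^^ m) (Fin u)"
        using u WG funpow_f_G by auto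
      ultimately show ?thesis
        by (simp only: funpow_funpow)
    qed
    ultimately show ?thesis by simp
  qed
  have rot_k: "(f ^^ (k * p)) (\<phi> z) = \<phi> (cis (2 * pi * \<theta>) ^ k * z)" if z: "z \<in> ?A" for z k
  proof (induction k)
    case (Suc k)
    have "(f ^^ (Suc k * p)) (\<phi> z) = (f ^^ p) (\<phi> (cis (2 * pi * \<theta>) ^ k * z))"
      using Suc by (simp add: funpow_add)
    also have "\<dots> = \<phi> (cis (2 * pi * \<theta>) * (cis (2 * pi * \<theta>) ^ k * z))"
      using z by (intro rot) (simp_all add: norm_mult norm_power)
    finally show ?case by (simp add: mult.assoc)
  qed simp
  have q_circle: "q \<in> \<phi> ` sphere 0 s" if s: "1 < s" "s < R" for s
  proof (rule Lim_in_closed_set)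
    have sub: "sphere 0 s \<subseteq> ?A" using s by auto
    show "closed (\<phi> ` sphere 0 s)"
      by (intro compact_imp_closed compact_continuous_image continuous_on_subset[OF cont sub] compact_sphere)
    have sA: "of_real s \<in> ?A" using s by simp
    show "(\<lambda>k. (f ^^ ((k + m) * p)) (\<phi> (of_real s))) \<longlonglongrightarrow> q"
      unfolding \<phi>(2)[OF sA] by (rule lim_q[OF \<phi>(3)[OF sA]])
    show "\<forall>\<^sub>F k in sequentially. (f ^^ ((k + m) * p)) (\<phi> (of_real s)) \<in> \<phi> ` sphere 0 s"
      using s unfolding rot_k[OF sA] by (intro always_eventually allI imageI) (simp add: norm_mult norm_power)
  qed simp
  \<comment> \<open>The points dividing the interval from 1 to \<open>R\<close> into thirds. The
    common limit would lie on the images of both circles, against injectivity.\<close>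
  define s t where "s = (2 + R) / 3" and "t = (1 + 2 * R) / 3"
  have st: "1 < s" "s < t" "t < R" using R by (auto simp: s_def t_def)
  obtain z w where "z \<in> sphere 0 s" "w \<in> sphere 0 t" "\<phi> z = q" "\<phi> w = q"
    using q_circle[of s] q_circle[of t] st by fastforce
  moreover from this have "z \<in> ?A" "w \<in> ?A" using st by auto
  ultimately have "z = w"
    using inj_onD[OF bij_betw_imp_inj_on[OF bij], of z w] by simp
  then show False
    using \<open>z \<in> sphere 0 s\<close> \<open>w \<in> sphere 0 t\<close> st by simp
qed

end

section \<open>Chebyshev's method for the quartic\<close>

text \<open>Numerator of the Chebyshev formula over the common denominator
  \<open>2 p'^3\<close>.\<close>

definition cheb_num :: "complex poly \<Rightarrow> complex poly" where
  "cheb_num p = [:0, 2:] * pderiv p ^ 3 - 2 * p * pderiv p ^ 2 - p ^ 2 * pderiv (pderiv p)"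

definition cheb_den :: "complex poly \<Rightarrow> complex poly" where
  "cheb_den p = 2 * pderiv p ^ 3"

lemma chebyshev_formula:
  assumes "poly (pderiv p) z \<noteq> 0"
  shows "z - (1 + chebyshev_L p z / 2) * (poly p z / poly (pderiv p) z) = poly (cheb_num p) z / poly (cheb_den p) z"
  using assms
  by (simp add: chebyshev_L_def cheb_num_def cheb_den_def field_simps power2_eq_square power3_eq_cube)

text \<open>The formula agrees with \<open>f\<close> except at infinity and the finitely many zeros
  of \<open>p'\<close>. Punctured neighbourhoods can avoid these points, and continuity of
  \<open>f\<close> gives the limit.\<close>

lemma chebyshev_method_eq:
  assumes Q: "rational_repelling_infinity (cheb_num p) (cheb_den p)"
  shows "chebyshev_method p = rational_repelling_infinity.f (cheb_num p) (cheb_den p)"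
proof
  interpret rational_repelling_infinity "cheb_num p" "cheb_den p" by fact
  fix x
  define g where "g y = (let z = finite_part y in
     Fin (z - (1 + chebyshev_L p z / 2) * (poly p z / poly (pderiv p) z)))" for y
  have "pderiv p \<noteq> 0"
    using D_nonzero by (auto simp: cheb_den_def)
  then have fin: "finite (insert Infty (Fin ` {z. poly (pderiv p) z = 0}))"
    by (intro finite.insertI finite_imageI poly_roots_finite)
  have "\<forall>\<^sub>F y in at x. y \<notin> insert Infty (Fin ` {z. poly (pderiv p) z = 0})"
    using islimpt_finite[OF fin, of x] by (auto simp: islimpt_iff_eventually)
  then have "\<forall>\<^sub>F y in at x. f y = g y"
  proof eventually_elim
    case (elim y)
    then obtain z where z: "y = Fin z" "poly (pderiv p) z \<noteq> 0"
      by (cases y) auto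
    then have "poly (cheb_den p) z \<noteq> 0"
      by (simp add: cheb_den_def)
    then show ?case
      unfolding z(1) g_def Let_def finite_part.simps chebyshev_formula[OF z(2)] by (simp add: c_def)
  qed
  moreover have "(f \<longlongrightarrow> f x) (at x)"
    using continuous_on_f[of UNIV] by (simp add: continuous_on_def)
  ultimately have "(g \<longlongrightarrow> f x) (at x)"
    using tendsto_cong by blast
  then show "chebyshev_method p x = f x"
    unfolding chebyshev_method_def g_def[symmetric] by (intro tendsto_Lim) auto
qed

lemma quartic_eq: "quartic a = [:of_real a, 0, - 1 - of_real a, 0, 1:]"
  by (simp add: quartic_def)

lemma pderiv_quartic: "pderiv (quartic a) = [:0, - 2 - 2 * of_real a, 0, 4:]"
  by (simp add: quartic_eq pderiv_pCons)

lemma pderiv2_quartic: "pderiv (pderiv (quartic a)) = [:- 2 - 2 * of_real a, 0, 12:]"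
  by (simp add: pderiv_quartic pderiv_pCons)

lemma poly_pderiv_quartic: "poly (pderiv (quartic a)) z = 2 * z * (2 * z\<^sup>2 - (1 + of_real a))"
  by (simp add: pderiv_quartic power2_eq_square algebra_simps)

text \<open>The leading coefficients of \<open>p\<close>, \<open>p'\<close>, \<open>p''\<close> are
  1, 4, 12, and 2 * 64 - 2 * 16 - 12 = 84.\<close>

lemma cheb_num_quartic_degree:
  "degree (cheb_num (quartic a)) = 10" "lead_coeff (cheb_num (quartic a)) = 84"
  unfolding cheb_num_def pderiv2_quartic
  unfolding pderiv_quartic
  unfolding quartic_eq
  by (simp_all add: power2_eq_square power3_eq_cube numeral_poly)

lemma cheb_den_quartic_degree:
  "degree (cheb_den (quartic a)) = 9" "lead_coeff (cheb_den (quartic a)) = 128"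
  by (simp_all add: cheb_den_def pderiv_quartic power3_eq_cube numeral_poly)

lemma cheb_den_quartic_zero_iff:
  assumes "-1 < a"
  shows "poly (cheb_den (quartic a)) z = 0 \<longleftrightarrow> z \<in> {0, of_real (sqrt ((1 + a) / 2)), - of_real (sqrt ((1 + a) / 2))}"
proof -
  have "(of_real (sqrt ((1 + a) / 2)))\<^sup>2 = complex_of_real ((1 + a) / 2)"
    using assms by (simp flip: of_real_power)
  then have "2 * z\<^sup>2 - (1 + of_real a) = 2 * (z - of_real (sqrt ((1 + a) / 2))) * (z + of_real (sqrt ((1 + a) / 2)))"
    by (simp add: power2_eq_square algebra_simps)
  then show ?thesis
    by (auto simp: cheb_den_def poly_pderiv_quartic eq_neg_iff_add_eq_0)
qed

text \<open>Where \<open>p'\<close> vanishes the numerator reduces to \<open>- p^2 p''\<close>. At 0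
  the values of \<open>p\<close> and \<open>p''\<close> are \<open>a\<close> and
  \<open>- 2 - 2 a\<close>; where \<open>z^2 = (1 + a) / 2\<close> they are
  \<open>- (1 - a)^2 / 4\<close> and \<open>4 (1 + a)\<close>. Excluding 0 and the end points -1 and
  1 keeps all of them non-zero.\<close>

lemma real_rational_quartic:
  assumes a: "a \<in> {-1<..<0} \<union> {0<..<1}"
  shows "real_rational_repelling_infinity (cheb_num (quartic a)) (cheb_den (quartic a))"
proof -
  interpret rational_repelling_infinity "cheb_num (quartic a)" "cheb_den (quartic a)"
  proof
    fix z assume z: "poly (cheb_den (quartic a)) z = 0"
    then have p': "poly (pderiv (quartic a)) z = 0"
      by (simp add: cheb_den_def)
    then have "z = 0 \<or> 2 * z\<^sup>2 - (1 + of_real a) = 0"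
      unfolding poly_pderiv_quartic by simp
    moreover have "z\<^sup>2 = of_real ((1 + a) / 2)" if "2 * z\<^sup>2 - (1 + of_real a) = 0"
      using that by (simp add: field_simps)
    ultimately consider "z = 0" | "z\<^sup>2 = of_real ((1 + a) / 2)"
      by blast
    then have "poly (quartic a) z \<noteq> 0 \<and> poly (pderiv (pderiv (quartic a))) z \<noteq> 0"
    proof cases
      case 1
      have "- 2 - 2 * complex_of_real a = of_real (- 2 - 2 * a)" by simp
      moreover have "- 2 - 2 * a \<noteq> 0" using a by auto
      ultimately show ?thesis
        using 1 a unfolding pderiv2_quartic unfolding quartic_eq by (auto simp del: of_real_diff)
    next
      case 2
      have "poly (quartic a) z = (z\<^sup>2 - 1) * (z\<^sup>2 - of_real a)"
        by (simp add: quartic_def power2_eq_square algebra_simps)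
      also have "\<dots> = of_real (((1 + a) / 2 - 1) * ((1 + a) / 2 - a))"
        unfolding 2 by (simp only: of_real_mult of_real_diff of_real_1)
      finally have 3: "poly (quartic a) z = of_real (((1 + a) / 2 - 1) * ((1 + a) / 2 - a))" .
      have "poly (pderiv (pderiv (quartic a))) z = 12 * z\<^sup>2 - 2 * (1 + of_real a)"
        by (simp add: pderiv2_quartic power2_eq_square algebra_simps)
      also have "\<dots> = of_real (12 * ((1 + a) / 2) - 2 * (1 + a))"
        unfolding 2 by (simp only: of_real_mult of_real_diff of_real_add of_real_1 of_real_numeral)
      finally have 4: "poly (pderiv (pderiv (quartic a))) z = of_real (12 * ((1 + a) / 2) - 2 * (1 + a))" .
      show ?thesis
        unfolding 3 4 of_real_eq_0_iff using a by auto
    qed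
    then show "poly (cheb_num (quartic a)) z \<noteq> 0"
      using p' by (simp add: cheb_num_def)
  next
    have "0 \<noteq> complex_of_real (sqrt ((1 + a) / 2))"
      using a by auto
    then show "\<exists>p q. p \<noteq> q \<and> poly (cheb_den (quartic a)) p = 0 \<and> poly (cheb_den (quartic a)) q = 0"
      using a by (intro exI[of _ 0] exI[of _ "complex_of_real (sqrt ((1 + a) / 2))"])
        (auto simp: cheb_den_quartic_zero_iff)
  show "degree (cheb_num (quartic a)) = Suc (degree (cheb_den (quartic a)))"
      unfolding cheb_num_quartic_degree(1) cheb_den_quartic_degree(1) by simp
    show "cmod (lead_coeff (cheb_num (quartic a))) < cmod (lead_coeff (cheb_den (quartic a)))"
      unfolding cheb_num_quartic_degree(2) cheb_den_quartic_degree(2) by simp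
  qed
  show ?thesis
  proof
    fix z :: complex assume "z \<in> \<real>"
    then have "poly (quartic a) z \<in> \<real>" "poly (pderiv (quartic a)) z \<in> \<real>" "poly (pderiv (pderiv (quartic a))) z \<in> \<real>"
      unfolding pderiv2_quartic unfolding pderiv_quartic unfolding quartic_eq by auto
    then show "c z \<in> \<real>"
      using \<open>z \<in> \<real>\<close> unfolding c_def by (simp add: cheb_num_def cheb_den_def)
  qed
qed

text \<open>On the imaginary axis the even polynomials \<open>p\<close> and \<open>p''\<close> are
  real and the odd \<open>p'\<close> is imaginary, so the numerator is real and the denominator
  imaginary.\<close>

lemma cheb_quartic_imaginary:
  assumes "Re z = 0"
  shows "Re (poly (cheb_num (quartic a)) z / poly (cheb_den (quartic a)) z) = 0"
proof -
  define t where "t = Im z"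
  have z: "z = \<i> * of_real t"
    using assms by (simp add: t_def complex_eq_iff)
  define P P1 P2 where "P = t ^ 4 + (1 + a) * t ^ 2 + a" and "P1 = - 4 * t ^ 3 - 2 * (1 + a) * t"
    and "P2 = - 12 * t ^ 2 - 2 * (1 + a)"
  have P: "poly (quartic a) z = of_real P" "poly (pderiv (quartic a)) z = \<i> * of_real P1"
    "poly (pderiv (pderiv (quartic a))) z = of_real P2"
    subgoal
      by (simp add: z quartic_eq P_def power2_eq_square power4_eq_xxxx algebra_simps)
    subgoal
      unfolding pderiv_quartic by (simp add: z P1_def power2_eq_square power3_eq_cube algebra_simps)
    subgoal
      unfolding pderiv2_quartic by (simp add: z P2_def power2_eq_square algebra_simps)
    done
  have "poly (cheb_num (quartic a)) z = of_real (2 * t * P1 ^ 3 + 2 * P * P1 ^ 2 - P ^ 2 * P2)"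
    by (simp add: cheb_num_def P) (simp add: z power2_eq_square power3_eq_cube algebra_simps)
  moreover have "poly (cheb_den (quartic a)) z = - \<i> * of_real (2 * P1 ^ 3)"
    by (simp add: cheb_den_def P power3_eq_cube)
  ultimately show ?thesis
    by (simp add: Re_divide)
qed

theorem theorem3p2:
  fixes a :: real
  assumes "a \<in> {-1<..<0} \<union> {0<..<1}"
  shows "(\<forall>U'. Fatou_component (cheb_quartic a) U' \<and> multiply_connected U' \<longrightarrow>
           (\<exists>m. (Fatou_component (cheb_quartic a) ((cheb_quartic a ^^ m) ` U') \<and>
                  (\<exists>z. z \<noteq> 0 \<and> cheb_quartic a (Fin z) = Infty \<and> surrounds ((cheb_quartic a ^^ m) ` U') z)) \<and>
                (\<forall>U. periodic_Fatou_component (cheb_quartic a) U \<and> lands_on (cheb_quartic a) ((cheb_quartic a ^^ m) ` U') U \<longrightarrow>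
                   (\<exists>x :: real. attracting_domain (cheb_quartic a) U (Fin (of_real x)) \<or>
                                parabolic_domain (cheb_quartic a) U (Fin (of_real x))))))
       \<and> (\<forall>U. \<not> Herman_ring (cheb_quartic a) U)"
proof -
  interpret real_rational_repelling_infinity "cheb_num (quartic a)" "cheb_den (quartic a)"
    by (rule real_rational_quartic[OF assms])
  have f: "cheb_quartic a = f"
    unfolding cheb_quartic_def by (rule chebyshev_method_eq) unfold_locales
  let ?D = "cheb_den (quartic a)"
  have D_zero: "poly ?D z = 0 \<longleftrightarrow> z \<in> {0, of_real (sqrt ((1 + a) / 2)), - of_real (sqrt ((1 + a) / 2))}" for z
    using assms by (intro cheb_den_quartic_zero_iff) auto
  have real_unbounded: "\<not> bounded (\<real> :: complex set)"
  proof
    assume "bounded (\<real> :: complex set)"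
    then obtain B where "\<And>z :: complex. z \<in> \<real> \<Longrightarrow> cmod z \<le> B"
      unfolding bounded_iff by blast
    from this[of "of_real (\<bar>B\<bar> + 1)"] show False
      by (simp del: of_real_add)
  qed
  have imag_unbounded: "\<not> bounded {z. Re z = 0}"
  proof
    assume "bounded {z. Re z = 0}"
    then obtain B where "\<And>z. Re z = 0 \<Longrightarrow> cmod z \<le> B"
      unfolding bounded_iff by blast
    from this[of "\<i> * of_real (\<bar>B\<bar> + 1)"] show False
      by (simp add: norm_mult del: of_real_add)
  qed
  have key: "\<exists>m P x. P \<noteq> 0 \<and> poly ?D P = 0 \<and> surrounds (Fin ` (c ^^ m) ` W) P \<and> x \<in> (c ^^ m) ` W \<and> x \<in> \<real>"
    if W: "W \<in> components G" "\<not> simply_connected W" for W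
  proof -
    obtain m P where P: "poly ?D P = 0" "surrounds (Fin ` (c ^^ m) ` W) P"
      by (rule multiply_connected_surrounds_pole[OF W])
    have "P \<in> \<real>"
      using P(1) by (auto simp: D_zero)
    moreover have "connected (\<real> :: complex set)"
      using convex_Reals convex_connected by blast
    ultimately obtain x where x: "x \<in> \<real>" "x \<in> (c ^^ m) ` W"
      using surrounds_meets[OF P(2) _ _ real_unbounded] by blast
    \<comment> \<open>The pole 0 also lies on the unbounded imaginary axis, which the component
      would have to meet as well.\<close>
    moreover have "P \<noteq> 0"
    proof
      assume "P = 0"
      moreover have "connected {z. Re z = 0}"
        by (intro convex_connected) (simp add: convex_def)
      ultimately obtain y where y: "Re y = 0" "y \<in> (c ^^ m) ` W"
        using surrounds_meets[OF P(2) _ _ imag_unbounded] by auto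
      show False
        by (rule no_component_meets_both_axes[OF funpow_component[OF W(1)] x(2,1) y(2,1)])
          (simp_all add: c_def cheb_quartic_imaginary D_zero)
    qed
    ultimately show ?thesis
      using P by blast
  qed
  have "\<not> Herman_ring f U" for U
    by (rule no_Herman_ring) (use key in blast)
  moreover have "\<exists>m. (Fatou_component f ((f ^^ m) ` U') \<and>
                  (\<exists>z. z \<noteq> 0 \<and> f (Fin z) = Infty \<and> surrounds ((f ^^ m) ` U') z)) \<and>
                (\<forall>U. periodic_Fatou_component f U \<and> lands_on f ((f ^^ m) ` U') U \<longrightarrow>
                   (\<exists>x :: real. attracting_domain f U (Fin (of_real x)) \<or> parabolic_domain f U (Fin (of_real x))))"
    if U': "Fatou_component f U'" "multiply_connected U'" for U'
  proof -
    obtain W where W: "W \<in> components G" "U' = Fin ` W"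
      using U'(1) by (auto simp: Fatou_component_f)
    then have "\<not> simply_connected W"
      using U'(2) by (simp add: multiply_connected_def simply_connected_Fin_image_iff)
    then obtain m P x where P: "P \<noteq> 0" "poly ?D P = 0" "surrounds (Fin ` (c ^^ m) ` W) P"
      and x: "x \<in> (c ^^ m) ` W" "x \<in> \<real>"
      using key[OF W(1)] by blast
    have WG: "W \<subseteq> G" using W component_G_subset by blast
    have im: "(f ^^ m) ` U' = Fin ` (c ^^ m) ` W"
      unfolding W(2) by (rule funpow_f_image[OF WG])
    have Wm: "(c ^^ m) ` W \<in> components G"
      by (rule funpow_component[OF W(1)])
    have "\<exists>x :: real. attracting_domain f U (Fin (of_real x)) \<or> parabolic_domain f U (Fin (of_real x))"
      if U: "periodic_Fatou_component f U" "lands_on f ((f ^^ m) ` U') U" for U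
    proof -
      obtain k where k: "U = (f ^^ k) ` Fin ` (c ^^ m) ` W"
        using U(2) by (auto simp: lands_on_def im)
      define V where "V = (c ^^ k) ` (c ^^ m) ` W"
      have UV: "U = Fin ` V"
        unfolding k V_def by (rule funpow_f_image[OF component_G_subset[OF Wm]])
      have V: "V \<in> components G"
        unfolding V_def by (rule funpow_component[OF Wm])
      obtain p where p: "p > 0" "(f ^^ p) ` U = U"
        using U(1) by (auto simp: periodic_Fatou_component_def)
      then have "(c ^^ p) ` V = V"
        unfolding UV funpow_f_image[OF component_G_subset[OF V]] by (simp add: inj_image_eq_iff inj_def)
      \<comment> \<open>The real point \<open>x\<close> is carried along the orbit of components,
        because the real line is invariant.\<close>
      moreover have "(c ^^ k) x \<in> V" "(c ^^ k) x \<in> \<real>"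
        using x by (auto simp: V_def funpow_c_real)
      ultimately show ?thesis
        unfolding UV using periodic_component_classification[OF V] p(1) by blast
    qed
    moreover have "Fatou_component f ((f ^^ m) ` U')"
      using Wm by (auto simp: im Fatou_component_f)
    moreover have "f (Fin P) = Infty" using P(2) by simp
    ultimately show ?thesis
      using P(1,3) unfolding im[symmetric] by blast
  qed
  ultimately show ?thesis
    unfolding f by blast
qed

end
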